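(* (Assuming $\mathsf{AD}$.) There is an ultrafilter $U$ on $2^{\mathbb{N}}/E_0$ such that Martin measure on $2^{\mathbb{N}}/\equiv_T$ is Rudin–Keisler reducible to $U$. Moreover, the Rudin–Keisler reduction can be chosen to be Borel.
   Context: $E_0$ is the equivalence relation on $2^{\mathbb{N}}$ of eventual equality, and $\equiv_T$ is Turing equivalence. For an equivalence relation $E$ on $X$, an ultrafilter on $X/E$ is a collection $U$ of $E$-invariant subsets of $X$ that is an ultrafilter on the Boolean algebra of all $E$-invariant subsets of $X$ (closed under finite intersections and supersets, $\emptyset\notin U$, and for each invariant $A$ either $A\in U$ or $X\setminus A\in U$). Martin measure is the ultrafilter on $2^{\mathbb{N}}/\equiv_T$ consisting of the Turing-invariant sets that contain a Turing cone $\{x: x\ge_T y\}$ for some $y$. For ultrafilters $U$ on $X/E$ and $V$ on $Y/F$, $V$ is Rudin–Keisler reducible to $U$ if there is a map $\varphi\colon X/E\to Y/F$ such that for every $F$-invariant $A\subseteq Y$, $A\in V$ iff $\varphi^{-1}(A)\in U$ (viewing $\varphi^{-1}(A)$ as an $E$-invariant subset of $X$); the reduction is Borel if $\varphi$ is induced by a Borel map $g\colon X\to Y$ with $x\mathrel{E}x'\Rightarrow g(x)\mathrel{F}g(x')$. *)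

theory Defs
  imports Main
begin

text \<open>
  Isabelle/HOL proves the axiom of choice, hence refutes the axiom of determinacy AD for sets of
  type \<^typ>\<open>(nat \<Rightarrow> nat) set\<close>; a theorem with that hypothesis would be vacuous. Theorems
  of ZF + AD are therefore rendered as properties of all first-order structures \<open>(M, \<in>\<^sub>M)\<close> that
  satisfy ZF + AD. A type \<open>'a\<close> serves as the universe of the structure, and all mathematical
  notions (naturals, reals, Turing reducibility, Borel sets, strategies, ultrafilters) are the
  internal ones: every definition below quantifies only over elements of \<open>'a\<close> and abbreviates a
  formula in the language of set theory. The structure may be ill-founded or have non-standard
  natural numbers.
\<close>

datatype fm = FMem nat nat | FEq nat nat | FNeg fm | FConj fm fm | FAll nat fm

primrec sat :: "('a \<Rightarrow> 'a \<Rightarrow> bool) \<Rightarrow> (nat \<Rightarrow> 'a) \<Rightarrow> fm \<Rightarrow> bool" where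
  "sat R s (FMem i j) \<longleftrightarrow> R (s i) (s j)"
| "sat R s (FEq i j) \<longleftrightarrow> s i = s j"
| "sat R s (FNeg p) \<longleftrightarrow> \<not> sat R s p"
| "sat R s (FConj p q) \<longleftrightarrow> sat R s p \<and> sat R s q"
| "sat R s (FAll i p) \<longleftrightarrow> (\<forall>x. sat R (s(i := x)) p)"

locale set_structure =
  fixes mem :: "'a \<Rightarrow> 'a \<Rightarrow> bool"  (infix "\<in>\<^sub>M" 50)

text \<open>
  Separation and replacement are the first-order schemes. The assignment \<open>s\<close> supplies the
  parameters. (Allowing arbitrary HOL predicates here would import choice into the structure.)
\<close>

locale ZF_model = set_structure +
  assumes extensionality: "(\<forall>x. x \<in>\<^sub>M a \<longleftrightarrow> x \<in>\<^sub>M b) \<longrightarrow> a = b"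
    and foundation: "(\<exists>x. x \<in>\<^sub>M a) \<longrightarrow> (\<exists>x. x \<in>\<^sub>M a \<and> \<not> (\<exists>y. y \<in>\<^sub>M x \<and> y \<in>\<^sub>M a))"
    and pairing: "\<exists>c. \<forall>x. x \<in>\<^sub>M c \<longleftrightarrow> x = a \<or> x = b"
    and union: "\<exists>u. \<forall>x. x \<in>\<^sub>M u \<longleftrightarrow> (\<exists>y. y \<in>\<^sub>M a \<and> x \<in>\<^sub>M y)"
    and power_set: "\<exists>p. \<forall>x. x \<in>\<^sub>M p \<longleftrightarrow> (\<forall>y. y \<in>\<^sub>M x \<longrightarrow> y \<in>\<^sub>M a)"
    and infinity: "\<exists>I. (\<exists>e. e \<in>\<^sub>M I \<and> (\<forall>x. \<not> x \<in>\<^sub>M e)) \<and>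
          (\<forall>x. x \<in>\<^sub>M I \<longrightarrow> (\<exists>y. y \<in>\<^sub>M I \<and> (\<forall>z. z \<in>\<^sub>M y \<longleftrightarrow> z \<in>\<^sub>M x \<or> z = x)))"
    and separation: "\<exists>b. \<forall>x. x \<in>\<^sub>M b \<longleftrightarrow> x \<in>\<^sub>M a \<and> sat (\<in>\<^sub>M) (s(0 := x)) p"
    and replacement: "(\<forall>x. x \<in>\<^sub>M a \<longrightarrow> (\<exists>!y. sat (\<in>\<^sub>M) (s(0 := x, 1 := y)) p)) \<longrightarrow>
          (\<exists>b. \<forall>y. y \<in>\<^sub>M b \<longleftrightarrow> (\<exists>x. x \<in>\<^sub>M a \<and> sat (\<in>\<^sub>M) (s(0 := x, 1 := y)) p))"

context set_structure
begin

subsection \<open>Basic set theory inside the structure\<close>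

abbreviation elts :: "'a \<Rightarrow> 'a set" where
  "elts a \<equiv> {x. x \<in>\<^sub>M a}"

text \<open>
  \<open>the_set P\<close> is the element \<open>{x. P x}\<close> of the structure. It is applied below only to first-order
  properties whose extension is a set by the ZF axioms.
\<close>

definition the_set :: "('a \<Rightarrow> bool) \<Rightarrow> 'a" where
  "the_set P = (THE a. \<forall>x. x \<in>\<^sub>M a \<longleftrightarrow> P x)"

definition subset :: "'a \<Rightarrow> 'a \<Rightarrow> bool"  (infix "\<subseteq>\<^sub>M" 50) where
  "a \<subseteq>\<^sub>M b \<longleftrightarrow> (\<forall>x. x \<in>\<^sub>M a \<longrightarrow> x \<in>\<^sub>M b)"

definition emp :: 'a where
  "emp = the_set (\<lambda>x. False)"

definition inter :: "'a \<Rightarrow> 'a \<Rightarrow> 'a" where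
  "inter a b = the_set (\<lambda>x. x \<in>\<^sub>M a \<and> x \<in>\<^sub>M b)"

definition diff :: "'a \<Rightarrow> 'a \<Rightarrow> 'a" where
  "diff a b = the_set (\<lambda>x. x \<in>\<^sub>M a \<and> \<not> x \<in>\<^sub>M b)"

definition upair :: "'a \<Rightarrow> 'a \<Rightarrow> 'a" where
  "upair a b = the_set (\<lambda>x. x = a \<or> x = b)"

definition opair :: "'a \<Rightarrow> 'a \<Rightarrow> 'a"  ("\<langle>_,/ _\<rangle>") where
  "\<langle>a, b\<rangle> = upair (upair a a) (upair a b)"

definition funs :: "'a \<Rightarrow> 'a \<Rightarrow> 'a" where
  "funs A B = the_set (\<lambda>f.
     (\<forall>p \<in> elts f. \<exists>x \<in> elts A. \<exists>y \<in> elts B. p = \<langle>x, y\<rangle>) \<and>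
     (\<forall>x \<in> elts A. \<exists>!y. \<langle>x, y\<rangle> \<in>\<^sub>M f))"

definition app :: "'a \<Rightarrow> 'a \<Rightarrow> 'a"  (infixl "\<cdot>" 90) where
  "f \<cdot> x = (THE y. \<langle>x, y\<rangle> \<in>\<^sub>M f)"

text \<open>Von Neumann naturals: \<open>n = {0, \<dots>, n - 1}\<close>, so \<open>m \<in>\<^sub>M n\<close> is \<open>m < n\<close>.\<close>

definition osucc :: "'a \<Rightarrow> 'a" where
  "osucc n = the_set (\<lambda>x. x \<in>\<^sub>M n \<or> x = n)"

definition omega :: 'a where
  "omega = the_set (\<lambda>n. \<forall>I. emp \<in>\<^sub>M I \<and> (\<forall>m \<in> elts I. osucc m \<in>\<^sub>M I) \<longrightarrow> n \<in>\<^sub>M I)"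

definition one :: 'a where
  "one = osucc emp"

definition two :: 'a where
  "two = osucc one"

definition evens :: 'a where
  "evens = the_set (\<lambda>n. n \<in>\<^sub>M omega \<and>
     (\<forall>I. emp \<in>\<^sub>M I \<and> (\<forall>m \<in> elts I. osucc (osucc m) \<in>\<^sub>M I) \<longrightarrow> n \<in>\<^sub>M I))"

definition restr :: "'a \<Rightarrow> 'a \<Rightarrow> 'a" where
  "restr x n = the_set (\<lambda>p. \<exists>i \<in> elts n. p = \<langle>i, x \<cdot> i\<rangle>)"

subsection \<open>The axiom of determinacy\<close>

text \<open>
  Games on \<open>\<omega>\<close> of length \<open>\<omega>\<close>: player I makes the moves with even index, player II those with odd
  index. A strategy assigns a move to every finite sequence of naturals.
\<close>

definition strategies :: 'a where
  "strategies = funs (the_set (\<lambda>s. \<exists>n \<in> elts omega. s \<in>\<^sub>M funs n omega)) omega"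

definition I_wins :: "'a \<Rightarrow> bool" where
  "I_wins A \<longleftrightarrow> (\<exists>\<sigma> \<in> elts strategies. \<forall>x \<in> elts (funs omega omega).
     (\<forall>n \<in> elts omega. n \<in>\<^sub>M evens \<longrightarrow> x \<cdot> n = \<sigma> \<cdot> restr x n) \<longrightarrow> x \<in>\<^sub>M A)"

definition II_wins :: "'a \<Rightarrow> bool" where
  "II_wins A \<longleftrightarrow> (\<exists>\<tau> \<in> elts strategies. \<forall>x \<in> elts (funs omega omega).
     (\<forall>n \<in> elts omega. \<not> n \<in>\<^sub>M evens \<longrightarrow> x \<cdot> n = \<tau> \<cdot> restr x n) \<longrightarrow> \<not> x \<in>\<^sub>M A)"

definition AD :: bool where
  "AD \<longleftrightarrow> (\<forall>A. A \<subseteq>\<^sub>M funs omega omega \<longrightarrow> I_wins A \<or> II_wins A)"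

subsection \<open>Cantor space and its Borel maps\<close>

definition cantor :: 'a where
  "cantor = funs omega two"

definition is_open :: "'a \<Rightarrow> bool" where
  "is_open A \<longleftrightarrow> A \<subseteq>\<^sub>M cantor \<and>
     (\<forall>x \<in> elts A. \<exists>n \<in> elts omega. \<forall>y \<in> elts cantor. (\<forall>m \<in> elts n. y \<cdot> m = x \<cdot> m) \<longrightarrow> y \<in>\<^sub>M A)"

definition is_sigma_algebra :: "'a \<Rightarrow> bool" where
  "is_sigma_algebra S \<longleftrightarrow>
     (\<forall>A \<in> elts S. A \<subseteq>\<^sub>M cantor) \<and>
     emp \<in>\<^sub>M S \<and>
     (\<forall>A \<in> elts S. diff cantor A \<in>\<^sub>M S) \<and>
     (\<forall>F \<in> elts (funs omega S). the_set (\<lambda>x. \<exists>n \<in> elts omega. x \<in>\<^sub>M F \<cdot> n) \<in>\<^sub>M S)"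

definition is_borel :: "'a \<Rightarrow> bool" where
  "is_borel A \<longleftrightarrow> (\<forall>S. is_sigma_algebra S \<and> (\<forall>B. is_open B \<longrightarrow> B \<in>\<^sub>M S) \<longrightarrow> A \<in>\<^sub>M S)"

definition borel_map :: "'a \<Rightarrow> bool" where
  "borel_map g \<longleftrightarrow> g \<in>\<^sub>M funs cantor cantor \<and>
     (\<forall>B. is_borel B \<longrightarrow> is_borel (the_set (\<lambda>x. x \<in>\<^sub>M cantor \<and> g \<cdot> x \<in>\<^sub>M B)))"

subsection \<open>Turing reducibility\<close>

text \<open>
  \<open>tuples k\<close> is \<open>\<omega>\<^sup>k\<close>, and \<open>snoc k a v\<close> is \<open>(a\<^sub>0, \<dots>, a\<^bsub>k-1\<^esub>, v)\<close>. The total functions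
  recursive in \<open>z\<close> form the least class of functions \<open>\<omega>\<^sup>k \<rightarrow> \<omega>\<close> that contains the zero functions,
  successor, projections and \<open>z\<close>, and is closed under composition, primitive recursion and
  minimisation of regular functions.
\<close>

definition tuples :: "'a \<Rightarrow> 'a" where
  "tuples k = funs k omega"

definition snoc :: "'a \<Rightarrow> 'a \<Rightarrow> 'a \<Rightarrow> 'a" where
  "snoc k a v = the_set (\<lambda>p. p \<in>\<^sub>M a \<or> p = \<langle>k, v\<rangle>)"

definition ops :: "'a \<Rightarrow> 'a" where
  "ops k = funs (tuples k) omega"

definition rec_closed :: "'a \<Rightarrow> 'a \<Rightarrow> bool" where
  "rec_closed z C \<longleftrightarrow>
     (\<forall>k \<in> elts omega. \<forall>f \<in> elts (ops k). (\<forall>a \<in> elts (tuples k). f \<cdot> a = emp) \<longrightarrow> f \<in>\<^sub>M C) \<and>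
     (\<forall>f \<in> elts (ops one). (\<forall>a \<in> elts (tuples one). f \<cdot> a = osucc (a \<cdot> emp)) \<longrightarrow> f \<in>\<^sub>M C) \<and>
     (\<forall>k \<in> elts omega. \<forall>i \<in> elts k. \<forall>f \<in> elts (ops k).
        (\<forall>a \<in> elts (tuples k). f \<cdot> a = a \<cdot> i) \<longrightarrow> f \<in>\<^sub>M C) \<and>
     (\<forall>f \<in> elts (ops one). (\<forall>a \<in> elts (tuples one). f \<cdot> a = z \<cdot> (a \<cdot> emp)) \<longrightarrow> f \<in>\<^sub>M C) \<and>
     (\<forall>k \<in> elts omega. \<forall>m \<in> elts omega. \<forall>f \<in> elts (ops k).
        \<forall>h \<in> elts (inter C (ops m)). \<forall>G \<in> elts (funs m (inter C (ops k))).
        (\<forall>a \<in> elts (tuples k). \<forall>b \<in> elts (tuples m).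
           (\<forall>i \<in> elts m. b \<cdot> i = (G \<cdot> i) \<cdot> a) \<longrightarrow> f \<cdot> a = h \<cdot> b) \<longrightarrow> f \<in>\<^sub>M C) \<and>
     (\<forall>k \<in> elts omega. \<forall>f \<in> elts (ops (osucc k)).
        \<forall>g \<in> elts (inter C (ops k)). \<forall>h \<in> elts (inter C (ops (osucc (osucc k)))).
        (\<forall>a \<in> elts (tuples k). f \<cdot> snoc k a emp = g \<cdot> a \<and>
           (\<forall>n \<in> elts omega.
              f \<cdot> snoc k a (osucc n) = h \<cdot> snoc (osucc k) (snoc k a n) (f \<cdot> snoc k a n)))
        \<longrightarrow> f \<in>\<^sub>M C) \<and>
     (\<forall>k \<in> elts omega. \<forall>f \<in> elts (ops k). \<forall>g \<in> elts (inter C (ops (osucc k))).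
        (\<forall>a \<in> elts (tuples k). g \<cdot> snoc k a (f \<cdot> a) = emp \<and>
           (\<forall>n \<in> elts (f \<cdot> a). g \<cdot> snoc k a n \<noteq> emp)) \<longrightarrow> f \<in>\<^sub>M C)"

definition turing_le :: "'a \<Rightarrow> 'a \<Rightarrow> bool"  (infix "\<le>\<^sub>T" 50) where
  "x \<le>\<^sub>T z \<longleftrightarrow> (\<forall>C. rec_closed z C \<longrightarrow>
     (\<exists>f. f \<in>\<^sub>M C \<and> f \<in>\<^sub>M ops one \<and> (\<forall>a \<in> elts (tuples one). f \<cdot> a = x \<cdot> (a \<cdot> emp))))"

subsection \<open>Ultrafilters on quotients\<close>

text \<open>Equivalence relations are elements of the structure, namely sets of ordered pairs.\<close>

definition E0 :: 'a where
  "E0 = the_set (\<lambda>p. \<exists>x \<in> elts cantor. \<exists>y \<in> elts cantor. p = \<langle>x, y\<rangle> \<and>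
     (\<exists>m \<in> elts omega. \<forall>n \<in> elts omega. \<not> n \<in>\<^sub>M m \<longrightarrow> x \<cdot> n = y \<cdot> n))"

definition turing_equiv :: 'a where
  "turing_equiv = the_set (\<lambda>p. \<exists>x \<in> elts cantor. \<exists>y \<in> elts cantor. p = \<langle>x, y\<rangle> \<and>
     x \<le>\<^sub>T y \<and> y \<le>\<^sub>T x)"

definition eq_class :: "'a \<Rightarrow> 'a \<Rightarrow> 'a" where
  "eq_class E x = the_set (\<lambda>y. \<langle>x, y\<rangle> \<in>\<^sub>M E)"

definition quot :: "'a \<Rightarrow> 'a \<Rightarrow> 'a" where
  "quot X E = the_set (\<lambda>c. \<exists>x \<in> elts X. c = eq_class E x)"

definition invariant :: "'a \<Rightarrow> 'a \<Rightarrow> 'a \<Rightarrow> bool" where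
  "invariant X E A \<longleftrightarrow> A \<subseteq>\<^sub>M X \<and> (\<forall>x y. x \<in>\<^sub>M A \<and> \<langle>x, y\<rangle> \<in>\<^sub>M E \<longrightarrow> y \<in>\<^sub>M A)"

definition ultrafilter_on_quot :: "'a \<Rightarrow> 'a \<Rightarrow> 'a \<Rightarrow> bool" where
  "ultrafilter_on_quot X E U \<longleftrightarrow>
     (\<forall>A \<in> elts U. invariant X E A) \<and>
     \<not> emp \<in>\<^sub>M U \<and>
     (\<forall>A \<in> elts U. \<forall>B \<in> elts U. inter A B \<in>\<^sub>M U) \<and>
     (\<forall>A \<in> elts U. \<forall>B. invariant X E B \<and> A \<subseteq>\<^sub>M B \<longrightarrow> B \<in>\<^sub>M U) \<and>
     (\<forall>A. invariant X E A \<longrightarrow> A \<in>\<^sub>M U \<or> diff X A \<in>\<^sub>M U)"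

definition martin_measure :: 'a where
  "martin_measure = the_set (\<lambda>A. invariant cantor turing_equiv A \<and>
     (\<exists>y \<in> elts cantor. \<forall>x \<in> elts cantor. y \<le>\<^sub>T x \<longrightarrow> x \<in>\<^sub>M A))"

text \<open>
  \<open>pullback X E \<phi> A\<close> is \<open>\<phi>\<^sup>-\<^sup>1(A)\<close> viewed as an \<open>E\<close>-invariant subset of \<open>X\<close>: an invariant set \<open>A\<close>
  stands for the set of equivalence classes included in it.
\<close>

definition pullback :: "'a \<Rightarrow> 'a \<Rightarrow> 'a \<Rightarrow> 'a \<Rightarrow> 'a" where
  "pullback X E \<phi> A = the_set (\<lambda>x. x \<in>\<^sub>M X \<and> \<phi> \<cdot> eq_class E x \<subseteq>\<^sub>M A)"

text \<open>\<open>\<phi>\<close> witnesses that \<open>V\<close> on \<open>Y/F\<close> is Rudin-Keisler reducible to \<open>U\<close> on \<open>X/E\<close>.\<close>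

definition rk_reduction :: "'a \<Rightarrow> 'a \<Rightarrow> 'a \<Rightarrow> 'a \<Rightarrow> 'a \<Rightarrow> 'a \<Rightarrow> 'a \<Rightarrow> bool" where
  "rk_reduction X E U Y F V \<phi> \<longleftrightarrow>
     \<phi> \<in>\<^sub>M funs (quot X E) (quot Y F) \<and>
     (\<forall>A. invariant Y F A \<longrightarrow> (A \<in>\<^sub>M V \<longleftrightarrow> pullback X E \<phi> A \<in>\<^sub>M U))"

text \<open>For equivalence relations \<open>E\<close> and \<open>F\<close> on Cantor space.\<close>

definition borel_induced :: "'a \<Rightarrow> 'a \<Rightarrow> 'a \<Rightarrow> bool" where
  "borel_induced E F \<phi> \<longleftrightarrow> (\<exists>g. borel_map g \<and>
     (\<forall>x x'. \<langle>x, x'\<rangle> \<in>\<^sub>M E \<longrightarrow> \<langle>g \<cdot> x, g \<cdot> x'\<rangle> \<in>\<^sub>M F) \<and>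
     (\<forall>x \<in> elts cantor. \<phi> \<cdot> eq_class E x = eq_class F (g \<cdot> x)))"

end

end

theory Submission
  imports Defs
begin

text \<open>
  The reduction is the identity, which maps \<open>E\<^sub>0\<close>-equivalent reals to Turing equivalent ones. The
  point is to find an ultrafilter on \<open>E\<^sub>0\<close>-invariant sets that contains all Turing cones.

  Let \<open>D\<close> be a countable set of reals closed under joins, halves and shifts. Build a sequence of
  reals in \<open>D\<close> in which each real is a half of the next one or the next one is obtained by deleting
  the first bit, and record in a real \<open>e\<close> only the deleted bits and which half was taken. A finite
  change of the recipe that leads back to the same element of \<open>D\<close> changes only finitely many bits of \<open>e\<close>. As any
  two members of \<open>D\<close> can be merged into their join, the Banach-Mazur game gives a zero-one law: every
  \<open>E\<^sub>0\<close>-invariant set contains \<open>e\<close> for all sufficiently generic sequences, or its complement does.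
  On the other hand \<open>e\<close> computes every member of \<open>D\<close>, since each bit is eventually deleted. So one obtains
  an ultrafilter \<open>U\<^bsub>D\<^esub>\<close> that contains the cones above the members of \<open>D\<close>. It depends only on the set \<open>D\<close>, and not
  on an enumeration of it; hence, if \<open>D\<close> is generated by \<open>x\<close> under operations that include the
  application of coded strategies, Martin's argument shows that the \<open>U\<^bsub>D\<^esub>\<close> converge along the cones of
  \<open>x\<close>. The limit is the required ultrafilter. By Martin's cone theorem its restriction to
  Turing invariant sets is Martin measure.
\<close>

section \<open>Definability over the structure\<close>

text \<open>Choice in HOL is of no use inside the structure: AD refutes full choice there, and
  separation and replacement hold for formulas only. So each object needs a definition.
  \<open>fo\<close> and \<open>tm\<close> form a calculus of definable predicates and operations,
  and a selection is always the least candidate under a given injection into the internal \<omega>,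
  which may be nonstandard.

  The construction has to reconcile homogeneity with coding. Cohen category also yields a zero-one
  law for E_0-invariant sets, but the reals above a fixed nonrecursive real are meagre, so its
  filter misses the cones. Writing a list of D into a real reaches the cones, but then finite
  changes no longer connect the results. The remedy is that neither the state nor a joined real is
  ever written out: they are disclosed only by later removals, and the future depends on the past
  through the present state alone.

  The operation \<open>resp\<close> is in the closure for the sake of the limit: with a strategy
  from \<open>clo x\<close>, the play against x generates the same closure as x. Any property of
  \<open>clo x\<close> then behaves as a Turing invariant property does in the cone theorem.\<close>

primrec rename_fm :: "(nat \<Rightarrow> nat) \<Rightarrow> fm \<Rightarrow> fm" where
  "rename_fm f (FMem i j) = FMem (f i) (f j)"
| "rename_fm f (FEq i j) = FEq (f i) (f j)"
| "rename_fm f (FNeg p) = FNeg (rename_fm f p)"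
| "rename_fm f (FConj p q) = FConj (rename_fm f p) (rename_fm f q)"
| "rename_fm f (FAll i p) = FAll (f i) (rename_fm f p)"

text \<open>Quantifiers bind variables by number, so injectivity is what prevents capture: an update
  at \<open>f i\<close> must not touch the image of another variable.\<close>

lemma sat_rename_fm:
  assumes "inj f"
  shows "sat R s (rename_fm f p) \<longleftrightarrow> sat R (s \<circ> f) p"
proof (induction p arbitrary: s)
  case (FAll i p)
  have "s(f i := x) \<circ> f = (s \<circ> f)(i := x)" for x
    using assms by (auto simp: fun_eq_iff inj_eq)
  then show ?case by (simp only: rename_fm.simps sat.simps FAll)
qed simp_all

text \<open>Variables occupy the even positions, parameters the odd ones.\<close>

definition mix :: "(nat \<Rightarrow> 'a) \<Rightarrow> (nat \<Rightarrow> 'a) \<Rightarrow> nat \<Rightarrow> 'a" where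
  "mix \<sigma> s i = (if even i then s (i div 2) else \<sigma> (i div 2))"

lemma mix_simps [simp]: "mix \<sigma> s (2 * i) = s i" "mix \<sigma> s (Suc (2 * i)) = \<sigma> i" "mix \<sigma> s 0 = s 0"
  "mix \<sigma> s (Suc 0) = \<sigma> 0"
  by (auto simp: mix_def)

lemma mix_eqI:
  assumes "\<And>i. t (2 * i) = s i" "\<And>i. t (Suc (2 * i)) = \<sigma> i"
  shows "t = mix \<sigma> s"
proof
  fix i
  show "t i = mix \<sigma> s i"
  proof (cases "even i")
    case True
    then obtain j where "i = 2 * j" by blast
    then show ?thesis using assms by simp
  next
    case False
    then obtain j where "i = Suc (2 * j)" using oddE by (metis Suc_eq_plus1)
    then show ?thesis using assms by simp
  qed
qed

lemma inj_mix:
  assumes "inj s" "inj \<sigma>" "\<And>i j. s i \<noteq> \<sigma> j"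
  shows "inj (mix \<sigma> s)"
proof (rule injI)
  fix x y
  assume *: "mix \<sigma> s x = mix \<sigma> s y"
  have "even x = even y" "x div 2 = y div 2"
    using * assms unfolding mix_def by (auto split: if_splits dest: injD) metis+
  then show "x = y" by (metis dvd_mult_div_cancel odd_two_times_div_two_succ)
qed

lemma mix_comp: "mix \<sigma> s \<circ> mix \<tau> t = mix (mix \<sigma> s \<circ> \<tau>) (mix \<sigma> s \<circ> t)"
  by (rule mix_eqI) simp_all

text \<open>
  \<open>fo Q\<close>: the predicate \<open>Q\<close> of assignments is first-order definable with parameters.
  \<open>tm t\<close>: the graph of the operation \<open>t\<close> is. Binders shift the variables as in de Bruijn notation.
\<close>

definition (in set_structure) fo :: "((nat \<Rightarrow> 'a) \<Rightarrow> bool) \<Rightarrow> bool" where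
  "fo Q \<longleftrightarrow> (\<exists>p \<sigma>. \<forall>s. Q s \<longleftrightarrow> sat (\<in>\<^sub>M) (mix \<sigma> s) p)"

definition (in set_structure) tm :: "((nat \<Rightarrow> 'a) \<Rightarrow> 'a) \<Rightarrow> bool" where
  "tm t \<longleftrightarrow> fo (\<lambda>s. s 0 = t (\<lambda>i. s (Suc i)))"

named_theorems fos

context set_structure
begin

lemma fo_mem_var: "fo (\<lambda>s. s i \<in>\<^sub>M s j)"
  unfolding fo_def by (rule exI[of _ "FMem (2*i) (2*j)"]) simp

lemma fo_eq_var: "fo (\<lambda>s. s i = s j)"
  unfolding fo_def by (rule exI[of _ "FEq (2*i) (2*j)"]) simp

lemma fo_eq_par: "fo (\<lambda>s. s i = c)"
  unfolding fo_def
  by (rule exI[of _ "FEq (2*i) (Suc (2*0))"], rule exI[of _ "\<lambda>_. c"]) (simp del: mult_0_right)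

lemma fo_not [fos]: "fo Q \<Longrightarrow> fo (\<lambda>s. \<not> Q s)"
  unfolding fo_def by (metis sat.simps(3))

text \<open>The two formulas come with two parameter sequences. These are interleaved into one, and
  each formula is renamed to read its own half, while both keep the same variables.\<close>

lemma fo_conj [fos]:
  assumes "fo P" "fo Q"
  shows "fo (\<lambda>s. P s \<and> Q s)"
proof -
  obtain p \<sigma> where p: "\<And>s. P s \<longleftrightarrow> sat (\<in>\<^sub>M) (mix \<sigma> s) p" using assms(1) unfolding fo_def by blast
  obtain q \<tau> where q: "\<And>s. Q s \<longleftrightarrow> sat (\<in>\<^sub>M) (mix \<tau> s) q" using assms(2) unfolding fo_def by blast
  define f :: "nat \<Rightarrow> nat" where "f = mix (\<lambda>i. Suc (2 * (2 * i))) ((*) 2)"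
  define g :: "nat \<Rightarrow> nat" where "g = mix (\<lambda>i. Suc (2 * Suc (2 * i))) ((*) 2)"
  have inj: "inj f" "inj g"
    unfolding f_def g_def by (rule inj_mix; auto simp: inj_def; presburger)+
  define \<rho> where "\<rho> = mix \<tau> \<sigma>"
  have 1: "mix \<rho> s \<circ> f = mix \<sigma> s" "mix \<rho> s \<circ> g = mix \<tau> s" for s
    unfolding f_def g_def \<rho>_def mix_comp by (simp_all only: comp_def mix_simps)
  show ?thesis unfolding fo_def
    by (rule exI[of _ "FConj (rename_fm f p) (rename_fm g q)"], rule exI[of _ \<rho>])
       (simp add: sat_rename_fm inj 1 p q)
qed

lemma fo_all [fos]:
  assumes "fo (\<lambda>s. Q (\<lambda>i. s (Suc i)) (s 0))"
  shows "fo (\<lambda>s. \<forall>x. Q s x)"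
proof -
  obtain p \<sigma> where p: "\<And>s. Q (\<lambda>i. s (Suc i)) (s 0) \<longleftrightarrow> sat (\<in>\<^sub>M) (mix \<sigma> s) p"
    using assms unfolding fo_def by blast
  \<comment> \<open>The bound variable moves to position 1, where parameter 0 used to be; the other
    variables drop by one and the parameters move up by one. The quantifier overwrites position 1,
    so the value that \<open>\<rho>\<close> puts there is a dummy.\<close>
  define f :: "nat \<Rightarrow> nat" where "f = mix (\<lambda>i. Suc (2 * Suc i)) (case_nat (Suc 0) ((*) 2))"
  have inj: "inj f"
    unfolding f_def by (rule inj_mix) (auto simp: inj_def split: nat.splits; presburger)+
  define \<rho> where "\<rho> = case_nat (\<sigma> 0) \<sigma>"
  have 1: "(mix \<rho> s)(Suc 0 := x) \<circ> f = mix \<sigma> (case_nat x s)" for s x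
  proof (rule mix_eqI)
    fix i
    have "2 * j \<noteq> Suc 0" for j :: nat by presburger
    then show "((mix \<rho> s)(Suc 0 := x) \<circ> f) (2 * i) = case_nat x s i"
      by (simp add: f_def split: nat.splits)
    show "((mix \<rho> s)(Suc 0 := x) \<circ> f) (Suc (2 * i)) = \<sigma> i"
      by (simp add: f_def \<rho>_def del: mult_Suc_right)
  qed
  have "sat (\<in>\<^sub>M) (mix \<rho> s) (FAll 1 (rename_fm f p)) \<longleftrightarrow> (\<forall>x. Q s x)" for s
  proof -
    have "Q s x \<longleftrightarrow> sat (\<in>\<^sub>M) (mix \<sigma> (case_nat x s)) p" for x
      using p[of "case_nat x s"] by simp
    then show ?thesis by (simp add: sat_rename_fm inj 1)
  qed
  then show ?thesis unfolding fo_def by blast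
qed

lemma fo_disj [fos]:
  assumes "fo P" "fo Q"
  shows "fo (\<lambda>s. P s \<or> Q s)"
proof -
  have "fo (\<lambda>s. \<not> (\<not> P s \<and> \<not> Q s))"
    by (intro fo_not fo_conj assms)
  then show ?thesis by simp
qed

lemma fo_imp [fos]:
  assumes "fo P" "fo Q"
  shows "fo (\<lambda>s. P s \<longrightarrow> Q s)"
proof -
  have "fo (\<lambda>s. \<not> P s \<or> Q s)"
    by (intro fo_not fo_disj assms)
  then show ?thesis by (simp only: imp_conv_disj)
qed

lemma fo_iff [fos]:
  assumes "fo P" "fo Q"
  shows "fo (\<lambda>s. P s \<longleftrightarrow> Q s)"
proof -
  have "fo (\<lambda>s. (P s \<longrightarrow> Q s) \<and> (Q s \<longrightarrow> P s))"
    by (intro fo_imp fo_conj assms)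
  then show ?thesis by (simp only: iff_conv_conj_imp)
qed

lemma fo_ex [fos]:
  assumes "fo (\<lambda>s. Q (\<lambda>i. s (Suc i)) (s 0))"
  shows "fo (\<lambda>s. \<exists>x. Q s x)"
  using fo_not[OF fo_all[of "\<lambda>s x. \<not> Q s x"]] fo_not[OF assms] by simp

text \<open>Variables outside \<open>V\<close> are frozen: they become parameters with values from
  \<open>t\<close>, interleaved with the old parameters. In this way a predicate with many free
  variables turns into one with a single variable, the form in which separation and replacement are
  used.\<close>

lemma fo_subst:
  assumes "fo Q" "inj_on g V"
  shows "fo (\<lambda>s. Q (\<lambda>i. if i \<in> V then s (g i) else t i))"
proof -
  obtain p \<sigma> where p: "\<And>s. Q s \<longleftrightarrow> sat (\<in>\<^sub>M) (mix \<sigma> s) p" using assms(1) unfolding fo_def by blast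
  define f :: "nat \<Rightarrow> nat" where
    "f = mix (\<lambda>i. Suc (2 * Suc (2 * i))) (\<lambda>i. if i \<in> V then 2 * g i else Suc (2 * (2 * i)))"
  have inj: "inj f"
    unfolding f_def using assms(2)
    by (intro inj_mix) (auto simp: inj_def inj_on_def split: if_splits; presburger)+
  have 1: "mix (mix \<sigma> t) s \<circ> f = mix \<sigma> (\<lambda>i. if i \<in> V then s (g i) else t i)" for s
  proof (rule mix_eqI)
    fix i
    show "(mix (mix \<sigma> t) s \<circ> f) (2 * i) = (if i \<in> V then s (g i) else t i)"
      unfolding f_def comp_def mix_simps by (cases "i \<in> V") (simp_all only: mix_simps if_True if_False)
    show "(mix (mix \<sigma> t) s \<circ> f) (Suc (2 * i)) = \<sigma> i"
      unfolding f_def comp_def mix_simps ..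
  qed
  show ?thesis unfolding fo_def
    by (rule exI[of _ "rename_fm f p"], rule exI[of _ "mix \<sigma> t"]) (simp add: sat_rename_fm inj 1 p)
qed

lemma fo_shift: "fo Q \<Longrightarrow> fo (\<lambda>s. Q (\<lambda>i. s (Suc i)))"
  using fo_subst[of Q Suc UNIV] by simp

lemma fo_shift1:
  assumes "fo (\<lambda>s. Q (s 0) (\<lambda>i. s (Suc i)))"
  shows "fo (\<lambda>s. Q (s 0) (\<lambda>i. s (Suc (Suc i))))"
proof -
  have "inj_on (case_nat 0 (\<lambda>i. Suc (Suc i))) UNIV"
    by (auto simp: inj_def split: nat.splits)
  from fo_subst[OF assms this] show ?thesis by simp
qed

lemma fo_inst:
  assumes "fo (\<lambda>s. Q (\<lambda>i. s (Suc i)) (s 0))"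
  shows "fo (\<lambda>s. Q t (s 0))"
  using fo_subst[OF assms, of "\<lambda>i. i" "{0}" "\<lambda>i. t (i - 1)"] by simp

lemma fo_inst2:
  assumes "fo (\<lambda>s. Q (\<lambda>i. s (Suc (Suc i))) (s 0) (s (Suc 0)))"
  shows "fo (\<lambda>s. Q t (s 0) (s (Suc 0)))"
  using fo_subst[OF assms, of "\<lambda>i. i" "{0, Suc 0}" "\<lambda>i. t (i - 2)"] by simp

lemma tm_var [fos]: "tm (\<lambda>s. s n)"
  unfolding tm_def by (rule fo_eq_var)

lemma tm_const [fos]: "tm (\<lambda>s. c)"
  unfolding tm_def by (rule fo_eq_par)

text \<open>Formulas contain no terms. The values of \<open>t\<close> and \<open>u\<close> are named
  by quantified variables that satisfy the defining graphs.\<close>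

lemma fo_mem [fos]:
  assumes "tm t" "tm u"
  shows "fo (\<lambda>s. t s \<in>\<^sub>M u s)"
proof -
  have "fo (\<lambda>s. \<exists>x y. x = t s \<and> y = u s \<and> x \<in>\<^sub>M y)"
    apply (intro fo_ex fo_conj fo_mem_var)
    subgoal using fo_shift1[of "\<lambda>x s. x = t s"] fo_shift[OF assms(1)[unfolded tm_def]] by simp
    subgoal using fo_shift1[of "\<lambda>x s. x = u s"] assms(2)[unfolded tm_def] by simp
    done
  then show ?thesis by simp
qed

lemma fo_eq [fos]:
  assumes "tm t" "tm u"
  shows "fo (\<lambda>s. t s = u s)"
proof -
  have "fo (\<lambda>s. \<exists>x y. x = t s \<and> y = u s \<and> x = y)"
    apply (intro fo_ex fo_conj fo_eq_var)
    subgoal using fo_shift1[of "\<lambda>x s. x = t s"] fo_shift[OF assms(1)[unfolded tm_def]] by simp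
    subgoal using fo_shift1[of "\<lambda>x s. x = u s"] assms(2)[unfolded tm_def] by simp
    done
  then show ?thesis by simp
qed

lemma fo_const [fos]: "fo (\<lambda>s. P)"
proof -
  have "fo (\<lambda>s. \<forall>x::'a. x = x)"
    by (intro fo_all fo_eq tm_var)
  moreover from this have "fo (\<lambda>s. \<not> (\<forall>x::'a. x = x))"
    by (rule fo_not)
  ultimately show ?thesis by (cases P) simp_all
qed

lemma tm_shift: "tm t \<Longrightarrow> tm (\<lambda>s. t (\<lambda>i. s (Suc i)))"
  unfolding tm_def using fo_shift1[of "\<lambda>x s. x = t s"] by simp

lemma fo_ball [fos]:
  assumes "tm A" "fo (\<lambda>s. Q (\<lambda>i. s (Suc i)) (s 0))"
  shows "fo (\<lambda>s. \<forall>x \<in> elts (A s). Q s x)"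
proof -
  have "fo (\<lambda>s. \<forall>x. x \<in>\<^sub>M A s \<longrightarrow> Q s x)"
    by (intro fo_all fo_imp fo_mem tm_shift tm_var assms)
  then show ?thesis by simp
qed

lemma fo_bex [fos]:
  assumes "tm A" "fo (\<lambda>s. Q (\<lambda>i. s (Suc i)) (s 0))"
  shows "fo (\<lambda>s. \<exists>x \<in> elts (A s). Q s x)"
  using fo_not[OF fo_ball[OF assms(1), of "\<lambda>s x. \<not> Q s x"]] fo_not[OF assms(2)] by simp

lemma tm_if [fos]:
  assumes "fo P" "tm t" "tm u"
  shows "tm (\<lambda>s. if P s then t s else u s)"
proof -
  have "fo (\<lambda>s. (P (\<lambda>i. s (Suc i)) \<longrightarrow> s 0 = t (\<lambda>i. s (Suc i))) \<and>
                (\<not> P (\<lambda>i. s (Suc i)) \<longrightarrow> s 0 = u (\<lambda>i. s (Suc i))))"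
    using assms unfolding tm_def by (intro fo_conj fo_imp fo_not fo_shift)
  then show ?thesis unfolding tm_def by (rule back_subst[of fo]) (auto simp: fun_eq_iff)
qed

lemma fo_subset [fos]: "tm t \<Longrightarrow> tm u \<Longrightarrow> fo (\<lambda>s. t s \<subseteq>\<^sub>M u s)"
  unfolding subset_def by (intro fo_all fo_imp fo_mem tm_shift tm_var)

lemma fo_ex1 [fos]:
  assumes "fo (\<lambda>s. Q (\<lambda>i. s (Suc i)) (s 0))"
  shows "fo (\<lambda>s. \<exists>!x. Q s x)"
proof -
  have "fo (\<lambda>s. \<exists>x. \<forall>y. Q s y \<longleftrightarrow> y = x)"
    apply (intro fo_ex fo_all fo_iff fo_eq tm_var)
    using fo_shift1[of "\<lambda>x s. Q s x", OF assms] by simp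
  moreover have "(\<exists>!x. R x) \<longleftrightarrow> (\<exists>x. \<forall>y. R y \<longleftrightarrow> y = x)" for R :: "'a \<Rightarrow> bool" by auto
  ultimately show ?thesis by simp
qed

text \<open>The description is eliminated: y equals it iff y has exactly the required members.
  Existence is demanded for every assignment, since the unspecified value of a failed
  \<open>THE\<close> need not be definable. Extensionality is a premise because this locale has no
  axioms.\<close>

lemma tm_the_set:
  assumes "fo (\<lambda>s. P (\<lambda>i. s (Suc i)) (s 0))" "\<And>s. \<exists>a. \<forall>x. x \<in>\<^sub>M a \<longleftrightarrow> P s x"
    and ext: "\<And>a b. (\<forall>x. x \<in>\<^sub>M a \<longleftrightarrow> x \<in>\<^sub>M b) \<Longrightarrow> a = b"
  shows "tm (\<lambda>s. the_set (P s))"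
proof -
  have *: "y = the_set (P s) \<longleftrightarrow> (\<forall>x. x \<in>\<^sub>M y \<longleftrightarrow> P s x)" for y s
  proof -
    obtain a where a: "\<forall>x. x \<in>\<^sub>M a \<longleftrightarrow> P s x" using assms(2) by blast
    have "the_set (P s) = a" unfolding the_set_def by (rule the_equality) (use a ext in auto)
    then show ?thesis using a ext by auto
  qed
  have "fo (\<lambda>s. \<forall>x. x \<in>\<^sub>M s 0 \<longleftrightarrow> P (\<lambda>i. s (Suc i)) x)"
    apply (intro fo_all fo_iff fo_mem tm_var)
    using fo_shift1[of "\<lambda>x s. P s x", OF assms(1)] by simp
  then show ?thesis unfolding tm_def * .
qed

end

section \<open>Sets, pairs and functions inside the structure\<close>

context set_structure
begin

definition isset :: "('a \<Rightarrow> bool) \<Rightarrow> bool" where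
  "isset P \<longleftrightarrow> (\<exists>a. \<forall>x. x \<in>\<^sub>M a \<longleftrightarrow> P x)"

definition sep :: "'a \<Rightarrow> ('a \<Rightarrow> bool) \<Rightarrow> 'a" where
  "sep A P = the_set (\<lambda>x. x \<in>\<^sub>M A \<and> P x)"

definition repl :: "'a \<Rightarrow> ('a \<Rightarrow> 'a) \<Rightarrow> 'a" where
  "repl A t = the_set (\<lambda>y. \<exists>x. x \<in>\<^sub>M A \<and> y = t x)"

definition Uni :: "'a \<Rightarrow> 'a" where
  "Uni a = the_set (\<lambda>x. \<exists>y. y \<in>\<^sub>M a \<and> x \<in>\<^sub>M y)"

definition Pw :: "'a \<Rightarrow> 'a" where
  "Pw a = the_set (\<lambda>x. x \<subseteq>\<^sub>M a)"

definition un :: "'a \<Rightarrow> 'a \<Rightarrow> 'a" where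
  "un a b = the_set (\<lambda>x. x \<in>\<^sub>M a \<or> x \<in>\<^sub>M b)"

definition lam :: "'a \<Rightarrow> ('a \<Rightarrow> 'a) \<Rightarrow> 'a" where
  "lam A t = repl A (\<lambda>x. \<langle>x, t x\<rangle>)"

definition cart :: "'a \<Rightarrow> 'a \<Rightarrow> 'a" where
  "cart A B = Uni (repl A (\<lambda>x. repl B (\<lambda>y. \<langle>x, y\<rangle>)))"

text \<open>
  A variant of application whose value is determined for all arguments, hence definable without
  side conditions.
\<close>

definition ap :: "'a \<Rightarrow> 'a \<Rightarrow> 'a"  (infixl "\<bullet>" 90) where
  "f \<bullet> x = the_set (\<lambda>z. \<exists>y. \<langle>x, y\<rangle> \<in>\<^sub>M f \<and> z \<in>\<^sub>M y)"

end

context ZF_model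
begin

lemma ext: "(\<And>x. x \<in>\<^sub>M a \<longleftrightarrow> x \<in>\<^sub>M b) \<Longrightarrow> a = b"
  using extensionality by blast

lemma mem_the_set: "isset P \<Longrightarrow> x \<in>\<^sub>M the_set P \<longleftrightarrow> P x"
proof -
  assume "isset P"
  then obtain a where a: "\<forall>x. x \<in>\<^sub>M a \<longleftrightarrow> P x" unfolding isset_def by blast
  have "the_set P = a" unfolding the_set_def by (rule the_equality) (use a ext in auto)
  then show ?thesis using a by simp
qed

lemma the_set_eqI: "(\<And>x. x \<in>\<^sub>M a \<longleftrightarrow> P x) \<Longrightarrow> the_set P = a"
  unfolding the_set_def by (rule the_equality) (auto intro: ext)

lemma isset_mem: "isset (\<lambda>x. x \<in>\<^sub>M a)"
  unfolding isset_def by blast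

lemma tm_the_setI:
  assumes "fo (\<lambda>s. P (\<lambda>i. s (Suc i)) (s 0))" "\<And>s. isset (P s)"
  shows "tm (\<lambda>s. the_set (P s))"
  using tm_the_set[OF assms(1)] assms(2) ext unfolding isset_def by blast

lemma isset_sep:
  assumes "fo (\<lambda>s. P (s 0))"
  shows "isset (\<lambda>x. x \<in>\<^sub>M A \<and> P x)"
proof -
  obtain p \<sigma> where p: "\<And>s. P (s 0) \<longleftrightarrow> sat (\<in>\<^sub>M) (mix \<sigma> s) p" using assms unfolding fo_def by blast
  have "(mix \<sigma> s)(0 := x) = mix \<sigma> (case_nat x (\<lambda>i. s (Suc i)))" for s x
    by (rule mix_eqI) (auto split: nat.splits)
  then have "P x \<longleftrightarrow> sat (\<in>\<^sub>M) ((mix \<sigma> s)(0 := x)) p" for s x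
    using p[of "case_nat x _"] by simp
  then show ?thesis using separation[of A "mix \<sigma> _" p] unfolding isset_def by simp
qed

lemma isset_subset:
  assumes "fo (\<lambda>s. P (s 0))" "\<And>x. P x \<Longrightarrow> x \<in>\<^sub>M A"
  shows "isset P"
  using isset_sep[OF assms(1), of A] assms(2) by (metis (mono_tags, lifting) isset_def)

lemma mem_sep: "fo (\<lambda>s. P (s 0)) \<Longrightarrow> x \<in>\<^sub>M sep A P \<longleftrightarrow> x \<in>\<^sub>M A \<and> P x"
  unfolding sep_def by (rule mem_the_set[OF isset_sep])

lemma tm_sep [fos]:
  assumes "tm A" "fo (\<lambda>s. P (\<lambda>i. s (Suc i)) (s 0))"
  shows "tm (\<lambda>s. sep (A s) (P s))"
  unfolding sep_def
proof (rule tm_the_setI)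
  show "fo (\<lambda>s. s 0 \<in>\<^sub>M A (\<lambda>i. s (Suc i)) \<and> P (\<lambda>i. s (Suc i)) (s 0))"
    by (intro fo_conj fo_mem tm_var tm_shift assms)
  show "isset (\<lambda>x. x \<in>\<^sub>M A s \<and> P s x)" for s
    by (rule isset_sep) (rule fo_inst[OF assms(2)])
qed

lemma isset_repl:
  assumes "tm (\<lambda>s. t (s 0))"
  shows "isset (\<lambda>y. \<exists>x. x \<in>\<^sub>M A \<and> y = t x)"
proof -
  obtain p \<sigma> where p: "\<And>s. s 0 = t (s (Suc 0)) \<longleftrightarrow> sat (\<in>\<^sub>M) (mix \<sigma> s) p"
    using assms unfolding tm_def fo_def by blast
  \<comment> \<open>Replacement expects the argument at position 0 and the value at position 1. The
    graph of \<open>t\<close> has the value as variable 0 and the argument as variable 1, hence at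
    positions 0 and 2. The parameters move up to free position 1.\<close>
  define f :: "nat \<Rightarrow> nat" where
    "f = mix (\<lambda>i. Suc (2 * Suc i)) (\<lambda>i. if i = 0 then 1 else if i = 1 then 0 else 2 * i)"
  have inj: "inj f"
    unfolding f_def by (intro inj_mix) (auto simp: inj_def split: if_splits; presburger)+
  define \<rho> where "\<rho> = mix (case_nat (\<sigma> 0) \<sigma>) (\<lambda>_. \<sigma> 0)"
  have 1: "(\<rho>(0 := x, 1 := y)) \<circ> f = mix \<sigma> (\<lambda>i. if i = 0 then y else if i = 1 then x else \<sigma> 0)" for x y
  proof (rule mix_eqI)
    fix i
    show "(\<rho>(0 := x, 1 := y) \<circ> f) (2 * i) = (if i = 0 then y else if i = 1 then x else \<sigma> 0)"
      unfolding f_def comp_def mix_simps by (simp add: \<rho>_def)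
    show "(\<rho>(0 := x, 1 := y) \<circ> f) (Suc (2 * i)) = \<sigma> i"
      unfolding f_def comp_def mix_simps by (simp add: \<rho>_def del: mult_Suc_right)
  qed
  have "sat (\<in>\<^sub>M) (\<rho>(0 := x, 1 := y)) (rename_fm f p) \<longleftrightarrow> y = t x" for x y
    by (simp only: sat_rename_fm[OF inj] 1 p[symmetric]) simp
  then show ?thesis using replacement[of A \<rho> "rename_fm f p"] unfolding isset_def by simp
qed

lemma mem_repl: "tm (\<lambda>s. t (s 0)) \<Longrightarrow> y \<in>\<^sub>M repl A t \<longleftrightarrow> (\<exists>x. x \<in>\<^sub>M A \<and> y = t x)"
  unfolding repl_def by (rule mem_the_set[OF isset_repl])

lemma tm_inst:
  assumes "tm (\<lambda>s. t (\<lambda>i. s (Suc i)) (s 0))"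
  shows "tm (\<lambda>s. t c (s 0))"
  using fo_inst2[of "\<lambda>c y x. y = t c x"] assms unfolding tm_def by simp

lemma tm_repl [fos]:
  assumes "tm A" "tm (\<lambda>s. t (\<lambda>i. s (Suc i)) (s 0))"
  shows "tm (\<lambda>s. repl (A s) (t s))"
  unfolding repl_def
proof (rule tm_the_setI)
  have "fo (\<lambda>s. s (Suc 0) = t (\<lambda>i. s (Suc (Suc i))) (s 0))"
  proof -
    have "inj_on (\<lambda>i. if i = 0 then Suc 0 else if i = Suc 0 then 0 else i) UNIV"
      by (auto simp: inj_on_def)
    from fo_subst[OF assms(2)[unfolded tm_def] this] show ?thesis by simp
  qed
  then show "fo (\<lambda>s. \<exists>x. x \<in>\<^sub>M A (\<lambda>i. s (Suc i)) \<and> s 0 = t (\<lambda>i. s (Suc i)) x)"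
    by (intro fo_ex fo_conj fo_mem tm_var tm_shift[OF tm_shift[OF assms(1)]])
  show "isset (\<lambda>y. \<exists>x. x \<in>\<^sub>M A s \<and> y = t s x)" for s
    by (rule isset_repl) (rule tm_inst[OF assms(2)])
qed

lemma tm_Uni [fos]:
  assumes "tm A"
  shows "tm (\<lambda>s. Uni (A s))"
  unfolding Uni_def
proof (rule tm_the_setI)
  show "isset (\<lambda>x. \<exists>y. y \<in>\<^sub>M a \<and> x \<in>\<^sub>M y)" for a
    using union unfolding isset_def by blast
qed (intro fos assms tm_shift)

lemma mem_Uni [simp]: "x \<in>\<^sub>M Uni a \<longleftrightarrow> (\<exists>y. y \<in>\<^sub>M a \<and> x \<in>\<^sub>M y)"
  unfolding Uni_def by (rule mem_the_set) (use union in \<open>simp add: isset_def\<close>)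

lemma isset_Pw: "isset (\<lambda>x. x \<subseteq>\<^sub>M a)"
  using power_set unfolding isset_def subset_def by blast

lemma mem_Pw [simp]: "x \<in>\<^sub>M Pw a \<longleftrightarrow> x \<subseteq>\<^sub>M a"
  unfolding Pw_def by (rule mem_the_set[OF isset_Pw])

lemma tm_Pw [fos]: "tm A \<Longrightarrow> tm (\<lambda>s. Pw (A s))"
  unfolding Pw_def by (rule tm_the_setI) (intro fos tm_shift isset_Pw | assumption)+

lemma isset_upair: "isset (\<lambda>x. x = a \<or> x = b)"
  using pairing unfolding isset_def by blast

lemma mem_upair [simp]: "x \<in>\<^sub>M upair a b \<longleftrightarrow> x = a \<or> x = b"
  unfolding upair_def by (rule mem_the_set[OF isset_upair])

lemma tm_upair [fos]: "tm A \<Longrightarrow> tm B \<Longrightarrow> tm (\<lambda>s. upair (A s) (B s))"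
  unfolding upair_def by (rule tm_the_setI) (intro fos tm_shift isset_upair | assumption)+

lemma tm_opair [fos]: "tm A \<Longrightarrow> tm B \<Longrightarrow> tm (\<lambda>s. \<langle>A s, B s\<rangle>)"
  unfolding opair_def by (intro fos)

lemma opair_eq [simp]: "\<langle>a, b\<rangle> = \<langle>c, d\<rangle> \<longleftrightarrow> a = c \<and> b = d"
proof
  assume *: "\<langle>a, b\<rangle> = \<langle>c, d\<rangle>"
  have "x = upair a a \<or> x = upair a b \<longleftrightarrow> x = upair c c \<or> x = upair c d" for x
    using arg_cong[OF *, of "\<lambda>p. x \<in>\<^sub>M p"] by (simp add: opair_def)
  moreover have "upair u v = upair w z \<longleftrightarrow> (\<forall>x. x = u \<or> x = v \<longleftrightarrow> x = w \<or> x = z)" for u v w z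
    by (metis ext mem_upair)
  ultimately show "a = c \<and> b = d" by metis
qed simp

lemma emp_iff [simp]: "\<not> x \<in>\<^sub>M emp"
  unfolding emp_def by (subst mem_the_set) (use isset_subset[OF fo_const[of False]] in auto)

lemma emp_eqI: "(\<And>x. \<not> x \<in>\<^sub>M a) \<Longrightarrow> a = emp"
  by (rule ext) simp

lemma isset_un: "isset (\<lambda>x. x \<in>\<^sub>M a \<or> x \<in>\<^sub>M b)"
  unfolding isset_def by (rule exI[of _ "Uni (upair a b)"]) auto

lemma mem_un [simp]: "x \<in>\<^sub>M un a b \<longleftrightarrow> x \<in>\<^sub>M a \<or> x \<in>\<^sub>M b"
  unfolding un_def by (rule mem_the_set[OF isset_un])

lemma tm_un [fos]: "tm A \<Longrightarrow> tm B \<Longrightarrow> tm (\<lambda>s. un (A s) (B s))"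
  unfolding un_def by (rule tm_the_setI) (intro fos tm_shift isset_un | assumption)+

lemma osucc_un: "osucc n = un n (upair n n)"
  unfolding osucc_def by (rule the_set_eqI) simp

lemma mem_osucc [simp]: "x \<in>\<^sub>M osucc n \<longleftrightarrow> x \<in>\<^sub>M n \<or> x = n"
  by (simp add: osucc_un)

lemma tm_osucc [fos]: "tm A \<Longrightarrow> tm (\<lambda>s. osucc (A s))"
  unfolding osucc_un by (intro fos)

lemma isset_inter: "isset (\<lambda>x. x \<in>\<^sub>M a \<and> x \<in>\<^sub>M b)"
  by (intro isset_sep fos)

lemma mem_inter [simp]: "x \<in>\<^sub>M inter a b \<longleftrightarrow> x \<in>\<^sub>M a \<and> x \<in>\<^sub>M b"
  unfolding inter_def by (rule mem_the_set[OF isset_inter])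

lemma tm_inter [fos]: "tm A \<Longrightarrow> tm B \<Longrightarrow> tm (\<lambda>s. inter (A s) (B s))"
  unfolding inter_def by (rule tm_the_setI) (intro fos tm_shift isset_inter | assumption)+

lemma isset_diff: "isset (\<lambda>x. x \<in>\<^sub>M a \<and> \<not> x \<in>\<^sub>M b)"
  by (intro isset_sep fos)

lemma mem_diff [simp]: "x \<in>\<^sub>M diff a b \<longleftrightarrow> x \<in>\<^sub>M a \<and> \<not> x \<in>\<^sub>M b"
  unfolding diff_def by (rule mem_the_set[OF isset_diff])

lemma tm_diff [fos]: "tm A \<Longrightarrow> tm B \<Longrightarrow> tm (\<lambda>s. diff (A s) (B s))"
  unfolding diff_def by (rule tm_the_setI) (intro fos tm_shift isset_diff | assumption)+

lemma tm_lam [fos]: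
  assumes "tm A" "tm (\<lambda>s. t (\<lambda>i. s (Suc i)) (s 0))"
  shows "tm (\<lambda>s. lam (A s) (t s))"
  unfolding lam_def by (intro fos assms)

lemma mem_lam: "tm (\<lambda>s. t (s 0)) \<Longrightarrow> p \<in>\<^sub>M lam A t \<longleftrightarrow> (\<exists>x. x \<in>\<^sub>M A \<and> p = \<langle>x, t x\<rangle>)"
  unfolding lam_def by (rule mem_repl) (intro fos)

lemma tm_cart [fos]: "tm A \<Longrightarrow> tm B \<Longrightarrow> tm (\<lambda>s. cart (A s) (B s))"
  unfolding cart_def by (intro fos tm_shift)

lemma mem_cart [simp]: "p \<in>\<^sub>M cart A B \<longleftrightarrow> (\<exists>x y. x \<in>\<^sub>M A \<and> y \<in>\<^sub>M B \<and> p = \<langle>x, y\<rangle>)"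
proof -
  have 1: "z \<in>\<^sub>M repl B (\<lambda>y. \<langle>x, y\<rangle>) \<longleftrightarrow> (\<exists>y. y \<in>\<^sub>M B \<and> z = \<langle>x, y\<rangle>)" for x z
    by (rule mem_repl) (intro fos)
  have 2: "z \<in>\<^sub>M repl A (\<lambda>x. repl B (\<lambda>y. \<langle>x, y\<rangle>)) \<longleftrightarrow> (\<exists>x. x \<in>\<^sub>M A \<and> z = repl B (\<lambda>y. \<langle>x, y\<rangle>))" for z
    by (rule mem_repl) (intro fos)
  show ?thesis unfolding cart_def by (auto simp: 1 2)
qed

lemma isset_ap: "isset (\<lambda>z. \<exists>y. \<langle>x, y\<rangle> \<in>\<^sub>M f \<and> z \<in>\<^sub>M y)"
proof (rule isset_subset)
  show "fo (\<lambda>s. \<exists>y. \<langle>x, y\<rangle> \<in>\<^sub>M f \<and> s 0 \<in>\<^sub>M y)" by (intro fos)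
  show "z \<in>\<^sub>M Uni (Uni (Uni f))" if "\<exists>y. \<langle>x, y\<rangle> \<in>\<^sub>M f \<and> z \<in>\<^sub>M y" for z
  proof -
    obtain y where y: "\<langle>x, y\<rangle> \<in>\<^sub>M f" "z \<in>\<^sub>M y" using \<open>\<exists>y. _\<close> by blast
    have "upair x y \<in>\<^sub>M \<langle>x, y\<rangle>" "y \<in>\<^sub>M upair x y" by (simp_all add: opair_def)
    then show ?thesis using y unfolding mem_Uni by blast
  qed
qed

lemma tm_ap [fos]: "tm A \<Longrightarrow> tm B \<Longrightarrow> tm (\<lambda>s. A s \<bullet> B s)"
  unfolding ap_def by (rule tm_the_setI) (intro fos tm_shift isset_ap | assumption)+

lemma ap_eqI:
  assumes "\<langle>x, y\<rangle> \<in>\<^sub>M f" "\<And>z. \<langle>x, z\<rangle> \<in>\<^sub>M f \<Longrightarrow> z = y"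
  shows "f \<bullet> x = y"
  unfolding ap_def by (rule the_set_eqI) (use assms in metis)

lemma ap_lam: "tm (\<lambda>s. t (s 0)) \<Longrightarrow> x \<in>\<^sub>M A \<Longrightarrow> lam A t \<bullet> x = t x"
  by (rule ap_eqI) (auto simp: mem_lam)

lemma isset_funs: "isset (\<lambda>f. (\<forall>p \<in> elts f. \<exists>x \<in> elts A. \<exists>y \<in> elts B. p = \<langle>x, y\<rangle>) \<and>
     (\<forall>x \<in> elts A. \<exists>!y. \<langle>x, y\<rangle> \<in>\<^sub>M f))"
proof (rule isset_subset)
  show "f \<in>\<^sub>M Pw (cart A B)" if "(\<forall>p \<in> elts f. \<exists>x \<in> elts A. \<exists>y \<in> elts B. p = \<langle>x, y\<rangle>) \<and>
     (\<forall>x \<in> elts A. \<exists>!y. \<langle>x, y\<rangle> \<in>\<^sub>M f)" for f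
    using that by (simp add: subset_def)
qed (intro fos)

lemma tm_funs [fos]: "tm A \<Longrightarrow> tm B \<Longrightarrow> tm (\<lambda>s. funs (A s) (B s))"
  unfolding funs_def by (rule tm_the_setI) (intro fos tm_shift isset_funs | assumption)+

lemma mem_funs: "f \<in>\<^sub>M funs A B \<longleftrightarrow> (\<forall>p. p \<in>\<^sub>M f \<longrightarrow> (\<exists>x y. x \<in>\<^sub>M A \<and> y \<in>\<^sub>M B \<and> p = \<langle>x, y\<rangle>)) \<and>
     (\<forall>x. x \<in>\<^sub>M A \<longrightarrow> (\<exists>!y. \<langle>x, y\<rangle> \<in>\<^sub>M f))"
  unfolding funs_def by (subst mem_the_set[OF isset_funs]) simp

lemma pair_in_fun: "f \<in>\<^sub>M funs A B \<Longrightarrow> \<langle>x, y\<rangle> \<in>\<^sub>M f \<longleftrightarrow> x \<in>\<^sub>M A \<and> y = f \<bullet> x"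
proof -
  assume f: "f \<in>\<^sub>M funs A B"
  have dom: "x \<in>\<^sub>M A" if "\<langle>x, y\<rangle> \<in>\<^sub>M f" for x y using f that unfolding mem_funs by fastforce
  have "\<exists>y. \<langle>x, y\<rangle> \<in>\<^sub>M f \<and> f \<bullet> x = y" if "x \<in>\<^sub>M A" for x
    using f that unfolding mem_funs by (metis ap_eqI)
  then show ?thesis using f dom unfolding mem_funs by metis
qed

lemma app_eq_ap: "f \<in>\<^sub>M funs A B \<Longrightarrow> x \<in>\<^sub>M A \<Longrightarrow> f \<cdot> x = f \<bullet> x"
  unfolding app_def by (rule the_equality) (auto simp: pair_in_fun)

lemma ap_type: "f \<in>\<^sub>M funs A B \<Longrightarrow> x \<in>\<^sub>M A \<Longrightarrow> f \<bullet> x \<in>\<^sub>M B"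
proof -
  assume f: "f \<in>\<^sub>M funs A B" and x: "x \<in>\<^sub>M A"
  then have "\<langle>x, f \<bullet> x\<rangle> \<in>\<^sub>M f" by (simp add: pair_in_fun)
  then show ?thesis using f unfolding mem_funs by fastforce
qed

lemma fun_ext:
  assumes "f \<in>\<^sub>M funs A B" "g \<in>\<^sub>M funs A C" "\<And>x. x \<in>\<^sub>M A \<Longrightarrow> f \<bullet> x = g \<bullet> x"
  shows "f = g"
proof (rule ext)
  fix p
  have "(\<exists>x y. p = \<langle>x, y\<rangle>)" if "p \<in>\<^sub>M f \<or> p \<in>\<^sub>M g"
    using that assms(1,2) unfolding mem_funs by blast
  then show "p \<in>\<^sub>M f \<longleftrightarrow> p \<in>\<^sub>M g"
    using pair_in_fun[OF assms(1)] pair_in_fun[OF assms(2)] assms(3) by metis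
qed

lemma lam_funs:
  assumes "tm (\<lambda>s. t (s 0))" "\<And>x. x \<in>\<^sub>M A \<Longrightarrow> t x \<in>\<^sub>M B"
  shows "lam A t \<in>\<^sub>M funs A B"
  unfolding mem_funs mem_lam[OF assms(1)] using assms(2) by auto

lemma lam_eta: "f \<in>\<^sub>M funs A B \<Longrightarrow> lam A (\<lambda>x. f \<bullet> x) = f"
  by (rule fun_ext[of _ A B _ B]) (auto intro!: lam_funs fos ap_type simp: ap_lam fos)

lemma funs_mono: "f \<in>\<^sub>M funs A B \<Longrightarrow> B \<subseteq>\<^sub>M C \<Longrightarrow> f \<in>\<^sub>M funs A C"
  unfolding mem_funs subset_def by blast

end

section \<open>Internal natural numbers and definition by recursion\<close>

context set_structure
begin

lemma fo_rename:
  assumes "fo Q" "inj g"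
  shows "fo (\<lambda>s. Q (\<lambda>i. s (g i)))"
  using fo_subst[OF assms(1), of g UNIV] assms(2) by simp

lemma tm_rename:
  assumes "tm t" "inj g"
  shows "tm (\<lambda>s. t (\<lambda>i. s (g i)))"
proof -
  define g' where "g' = case_nat 0 (\<lambda>i. Suc (g i))"
  have "inj g'"
    unfolding g'_def by (intro injI) (simp add: inj_eq[OF assms(2)] split: nat.splits)
  then have "fo (\<lambda>s. s (g' 0) = t (\<lambda>i. s (g' (Suc i))))"
    using fo_rename[of "\<lambda>s. s 0 = t (\<lambda>i. s (Suc i))" g'] assms(1) unfolding tm_def by blast
  then show ?thesis unfolding tm_def g'_def nat.case .
qed

lemma tm_inst2:
  assumes "tm (\<lambda>s. t (\<lambda>i. s (Suc (Suc i))) (s (Suc 0)) (s 0))"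
  shows "tm (\<lambda>s. t c (s (Suc 0)) (s 0))"
proof -
  let ?d = "case_nat undefined (case_nat undefined (case_nat undefined c))"
  have "fo (\<lambda>s. (\<lambda>s. s 0 = t (\<lambda>i. s (Suc (Suc (Suc i)))) (s (Suc (Suc 0))) (s (Suc 0)))
      (\<lambda>i. if i \<in> {0, Suc 0, Suc (Suc 0)} then s i else ?d i))"
    by (rule fo_subst[OF assms[unfolded tm_def], of "\<lambda>i. i"]) simp
  then show ?thesis unfolding tm_def by simp
qed

text \<open>An approximation \<open>h\<close> only has to justify each of its pairs by an earlier
  pair. It need be neither a function nor defined on an initial segment, so the successor step just
  adds one pair; uniqueness of the value is left to induction.\<close>

definition rec_graph :: "'a \<Rightarrow> ('a \<Rightarrow> 'a \<Rightarrow> 'a) \<Rightarrow> 'a \<Rightarrow> 'a \<Rightarrow> bool" where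
  "rec_graph a F n y \<longleftrightarrow> (\<exists>h. \<langle>n, y\<rangle> \<in>\<^sub>M h \<and>
     (\<forall>p. p \<in>\<^sub>M h \<longrightarrow> p = \<langle>emp, a\<rangle> \<or>
        (\<exists>i. i \<in>\<^sub>M omega \<and> (\<exists>r. \<langle>i, r\<rangle> \<in>\<^sub>M h \<and> p = \<langle>osucc i, F i r\<rangle>))))"

text \<open>The union over all values, instead of a description of the value, is a set for every
  argument \<open>n\<close>, empty outside \<open>omega\<close>. Hence the operation is definable
  without a typing condition on \<open>n\<close>.\<close>

definition nrec :: "'a \<Rightarrow> ('a \<Rightarrow> 'a \<Rightarrow> 'a) \<Rightarrow> 'a \<Rightarrow> 'a" where
  "nrec a F n = the_set (\<lambda>z. n \<in>\<^sub>M omega \<and> (\<exists>y. rec_graph a F n y \<and> z \<in>\<^sub>M y))"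

end

context ZF_model
begin

lemma mem_irrefl: "\<not> x \<in>\<^sub>M x"
  using foundation[of "upair x x"] unfolding mem_upair by blast

lemma mem_asym: "x \<in>\<^sub>M y \<Longrightarrow> \<not> y \<in>\<^sub>M x"
  using foundation[of "upair x y"] unfolding mem_upair by blast

lemma mem_omega: "n \<in>\<^sub>M omega \<longleftrightarrow>
  (\<forall>I. emp \<in>\<^sub>M I \<and> (\<forall>m \<in> elts I. osucc m \<in>\<^sub>M I) \<longrightarrow> n \<in>\<^sub>M I)"
proof -
  obtain I where I: "\<exists>e. e \<in>\<^sub>M I \<and> (\<forall>x. \<not> x \<in>\<^sub>M e)"
    "\<forall>x. x \<in>\<^sub>M I \<longrightarrow> (\<exists>y. y \<in>\<^sub>M I \<and> (\<forall>z. z \<in>\<^sub>M y \<longleftrightarrow> z \<in>\<^sub>M x \<or> z = x))"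
    using infinity by blast
  have "emp \<in>\<^sub>M I" using I(1) emp_eqI by metis
  moreover have "osucc x \<in>\<^sub>M I" if "x \<in>\<^sub>M I" for x
    using I(2) that by (metis ext mem_osucc)
  ultimately show ?thesis
    unfolding omega_def
    by (intro mem_the_set isset_subset[of _ I] fos) blast
qed

lemma emp_omega [simp]: "emp \<in>\<^sub>M omega"
  by (simp add: mem_omega)

lemma osucc_omega [simp]: "n \<in>\<^sub>M omega \<Longrightarrow> osucc n \<in>\<^sub>M omega"
  by (simp add: mem_omega)

text \<open>Since \<open>omega\<close> may be nonstandard, induction holds for definable predicates
  only: it is minimality of \<open>omega\<close> applied to the set that separation provides. The
  case \<open>definable\<close> therefore returns in every induction below.\<close>

lemma nat_induct [consumes 1, case_names definable emp osucc]:
  assumes "n \<in>\<^sub>M omega" "fo (\<lambda>s. P (s 0))" "P emp"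
    "\<And>n. n \<in>\<^sub>M omega \<Longrightarrow> P n \<Longrightarrow> P (osucc n)"
  shows "P n"
proof -
  have "emp \<in>\<^sub>M sep omega P \<and> (\<forall>m \<in> elts (sep omega P). osucc m \<in>\<^sub>M sep omega P)"
    using assms(3,4) by (simp add: mem_sep[OF assms(2)])
  then have "n \<in>\<^sub>M sep omega P"
    using assms(1) mem_omega by blast
  then show ?thesis by (simp add: mem_sep[OF assms(2)])
qed

lemma osucc_not_emp [simp]: "osucc n \<noteq> emp" "emp \<noteq> osucc n"
  by (metis emp_iff mem_osucc)+

lemma osucc_inject [simp]: "osucc m = osucc n \<longleftrightarrow> m = n"
  by (metis mem_asym mem_osucc)

lemma nat_cases:
  assumes "n \<in>\<^sub>M omega"
  obtains "n = emp" | m where "m \<in>\<^sub>M omega" "n = osucc m"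
proof -
  have "n = emp \<or> (\<exists>m \<in> elts omega. n = osucc m)"
    using assms by (induction rule: nat_induct) ((intro fos)?; auto)+
  then show ?thesis using that by auto
qed

lemma nat_trans:
  assumes "n \<in>\<^sub>M omega" "m \<in>\<^sub>M n"
  shows "m \<in>\<^sub>M omega" "k \<in>\<^sub>M m \<Longrightarrow> k \<in>\<^sub>M n"
proof -
  have "\<forall>m. m \<in>\<^sub>M n \<longrightarrow> m \<in>\<^sub>M omega"
    using assms(1) by (induction rule: nat_induct) ((intro fos)?; auto)+
  moreover have "\<forall>m. m \<in>\<^sub>M n \<longrightarrow> (\<forall>k. k \<in>\<^sub>M m \<longrightarrow> k \<in>\<^sub>M n)"
    using assms(1) by (induction rule: nat_induct) ((intro fos)?; auto)+
  ultimately show "m \<in>\<^sub>M omega" "k \<in>\<^sub>M m \<Longrightarrow> k \<in>\<^sub>M n" using assms(2) by auto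
qed

lemma emp_mem_osucc: "n \<in>\<^sub>M omega \<Longrightarrow> emp \<in>\<^sub>M osucc n"
  by (induction rule: nat_induct) ((intro fos)?; auto)+

lemma osucc_mem_osucc: "n \<in>\<^sub>M omega \<Longrightarrow> osucc m \<in>\<^sub>M osucc n \<longleftrightarrow> m \<in>\<^sub>M n"
proof
  assume n: "n \<in>\<^sub>M omega" and *: "osucc m \<in>\<^sub>M osucc n"
  have "m \<in>\<^sub>M osucc m" by simp
  then show "m \<in>\<^sub>M n" using * nat_trans(2)[OF n, of "osucc m" m] by auto
next
  assume n: "n \<in>\<^sub>M omega" and *: "m \<in>\<^sub>M n"
  have "\<forall>m. m \<in>\<^sub>M n \<longrightarrow> osucc m \<in>\<^sub>M osucc n"
    using n by (induction rule: nat_induct) ((intro fos)?; auto)+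
  then show "osucc m \<in>\<^sub>M osucc n" using * by blast
qed

lemma nat_trichotomy:
  assumes "m \<in>\<^sub>M omega" "n \<in>\<^sub>M omega"
  shows "m \<in>\<^sub>M n \<or> m = n \<or> n \<in>\<^sub>M m"
proof -
  have "\<forall>m. m \<in>\<^sub>M omega \<longrightarrow> m \<in>\<^sub>M n \<or> m = n \<or> n \<in>\<^sub>M m"
    using assms(2)
  proof (induction rule: nat_induct)
    case emp
    show ?case using emp_mem_osucc by (metis nat_cases)
  next
    case (osucc n)
    show ?case
    proof (intro allI impI)
      fix m
      assume "m \<in>\<^sub>M omega"
      then show "m \<in>\<^sub>M osucc n \<or> m = osucc n \<or> osucc n \<in>\<^sub>M m"
      proof (cases rule: nat_cases)
        case 1
        then show ?thesis using emp_mem_osucc[OF osucc(1)] by simp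
      next
        case (2 k)
        then have "k \<in>\<^sub>M n \<or> k = n \<or> n \<in>\<^sub>M k" using osucc(2) by blast
        then show ?thesis
          using osucc_mem_osucc[OF osucc(1), of k] osucc_mem_osucc[OF 2(1), of n] unfolding 2(2) by blast
      qed
    qed
  qed (intro fos)
  then show ?thesis using assms(1) by blast
qed

text \<open>Foundation yields a member of the set that contains no other member, and for natural
  numbers this is the least one.\<close>

lemma nat_least:
  assumes "fo (\<lambda>s. P (s 0))" "n \<in>\<^sub>M omega" "P n"
  obtains m where "m \<in>\<^sub>M omega" "P m" "\<And>k. k \<in>\<^sub>M m \<Longrightarrow> \<not> P k"
proof -
  have "\<exists>x. x \<in>\<^sub>M sep omega P" using assms by (auto simp: mem_sep)
  from foundation[of "sep omega P"] this obtain m where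
    "m \<in>\<^sub>M omega" "P m" "\<And>k. k \<in>\<^sub>M m \<Longrightarrow> \<not> (k \<in>\<^sub>M omega \<and> P k)"
    by (auto simp: mem_sep[OF assms(1)])
  then show ?thesis using that nat_trans(1) by blast
qed

subsection \<open>Recursion\<close>

lemma rec_graph_emp: "rec_graph a F emp y \<longleftrightarrow> y = a"
proof
  assume "y = a"
  then show "rec_graph a F emp y"
    unfolding rec_graph_def by (intro exI[of _ "upair \<langle>emp, a\<rangle> \<langle>emp, a\<rangle>"]) auto
qed (auto simp: rec_graph_def)

lemma rec_graph_osucc:
  assumes "n \<in>\<^sub>M omega"
  shows "rec_graph a F (osucc n) y \<longleftrightarrow> (\<exists>r. rec_graph a F n r \<and> y = F n r)"
proof
  assume "rec_graph a F (osucc n) y"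
  then obtain h where h: "\<langle>osucc n, y\<rangle> \<in>\<^sub>M h"
     "\<forall>p. p \<in>\<^sub>M h \<longrightarrow> p = \<langle>emp, a\<rangle> \<or>
        (\<exists>i. i \<in>\<^sub>M omega \<and> (\<exists>r. \<langle>i, r\<rangle> \<in>\<^sub>M h \<and> p = \<langle>osucc i, F i r\<rangle>))"
    unfolding rec_graph_def by blast
  then obtain r where "\<langle>n, r\<rangle> \<in>\<^sub>M h" "y = F n r" by fastforce
  then show "\<exists>r. rec_graph a F n r \<and> y = F n r" using h(2) unfolding rec_graph_def by blast
next
  assume "\<exists>r. rec_graph a F n r \<and> y = F n r"
  then obtain r h where h: "y = F n r" "\<langle>n, r\<rangle> \<in>\<^sub>M h"
     "\<forall>p. p \<in>\<^sub>M h \<longrightarrow> p = \<langle>emp, a\<rangle> \<or>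
        (\<exists>i. i \<in>\<^sub>M omega \<and> (\<exists>r. \<langle>i, r\<rangle> \<in>\<^sub>M h \<and> p = \<langle>osucc i, F i r\<rangle>))"
    unfolding rec_graph_def by blast
  show "rec_graph a F (osucc n) y"
    unfolding rec_graph_def
  proof (intro exI[of _ "un h (upair \<langle>osucc n, y\<rangle> \<langle>osucc n, y\<rangle>)"] conjI allI impI)
    fix p
    assume "p \<in>\<^sub>M un h (upair \<langle>osucc n, y\<rangle> \<langle>osucc n, y\<rangle>)"
    then consider "p \<in>\<^sub>M h" | "p = \<langle>osucc n, F n r\<rangle>" using h(1) by auto
    then show "p = \<langle>emp, a\<rangle> \<or> (\<exists>i. i \<in>\<^sub>M omega \<and>
        (\<exists>r. \<langle>i, r\<rangle> \<in>\<^sub>M un h (upair \<langle>osucc n, y\<rangle> \<langle>osucc n, y\<rangle>) \<and> p = \<langle>osucc i, F i r\<rangle>))"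
      using h(2,3) assms unfolding mem_un by cases blast+
  qed simp
qed

lemma fo_rec_graph:
  assumes "tm a" "tm (\<lambda>s. F (\<lambda>i. s (Suc (Suc i))) (s (Suc 0)) (s 0))" "tm n" "tm y"
  shows "fo (\<lambda>s. rec_graph (a s) (F s) (n s) (y s))"
proof -
  have F: "tm (\<lambda>s. F (\<lambda>i. s (Suc (Suc (Suc (Suc i))))) (s (Suc 0)) (s 0))"
  proof -
    have "inj (\<lambda>i :: nat. if i < 2 then i else i + 2)" by (auto simp: inj_def split: if_splits)
    from tm_rename[OF assms(2) this] show ?thesis by simp
  qed
  show ?thesis
    unfolding rec_graph_def by (intro fos F | intro assms tm_shift)+
qed

lemma ex1_rec_graph:
  assumes "tm (\<lambda>s. F (s (Suc 0)) (s 0))" "n \<in>\<^sub>M omega"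
  shows "\<exists>!y. rec_graph a F n y"
  using assms(2)
proof (induction rule: nat_induct)
  case definable
  show ?case by (intro fo_ex1 fo_rec_graph fos assms(1))
next
  case (osucc n)
  then show ?case by (metis rec_graph_osucc)
qed (simp add: rec_graph_emp)

lemma isset_nrec:
  assumes "tm (\<lambda>s. F (s (Suc 0)) (s 0))"
  shows "isset (\<lambda>z. n \<in>\<^sub>M omega \<and> (\<exists>y. rec_graph a F n y \<and> z \<in>\<^sub>M y))"
proof (cases "n \<in>\<^sub>M omega")
  case True
  then obtain y where "\<And>y'. rec_graph a F n y' \<longleftrightarrow> y' = y"
    using ex1_rec_graph[OF assms] by metis
  then show ?thesis using True isset_mem[of y] by simp
qed (simp add: isset_def exI[of _ emp])

lemma tm_nrec [fos]:
  assumes "tm a" "tm (\<lambda>s. F (\<lambda>i. s (Suc (Suc i))) (s (Suc 0)) (s 0))" "tm n"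
  shows "tm (\<lambda>s. nrec (a s) (F s) (n s))"
  unfolding nrec_def
proof (rule tm_the_setI)
  have F: "tm (\<lambda>s. F (\<lambda>i. s (Suc (Suc (Suc (Suc i))))) (s (Suc 0)) (s 0))"
  proof -
    have "inj (\<lambda>i :: nat. if i < 2 then i else i + 2)" by (auto simp: inj_def split: if_splits)
    from tm_rename[OF assms(2) this] show ?thesis by simp
  qed
  show "fo (\<lambda>s. n (\<lambda>i. s (Suc i)) \<in>\<^sub>M omega \<and>
    (\<exists>y. rec_graph (a (\<lambda>i. s (Suc i))) (F (\<lambda>i. s (Suc i))) (n (\<lambda>i. s (Suc i))) y \<and> s 0 \<in>\<^sub>M y))"
    by (intro fo_rec_graph fo_conj fo_ex fo_mem tm_var tm_const F | intro assms tm_shift)+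
  show "isset (\<lambda>z. n s \<in>\<^sub>M omega \<and> (\<exists>y. rec_graph (a s) (F s) (n s) y \<and> z \<in>\<^sub>M y))" for s
    by (rule isset_nrec, rule tm_inst2, rule assms(2))
qed

lemma nrec_eq:
  assumes "tm (\<lambda>s. F (s (Suc 0)) (s 0))" "n \<in>\<^sub>M omega"
  shows "rec_graph a F n y \<longleftrightarrow> y = nrec a F n"
proof -
  obtain y' where *: "\<And>y. rec_graph a F n y \<longleftrightarrow> y = y'"
    using ex1_rec_graph[OF assms] by metis
  then have "nrec a F n = y'"
    unfolding nrec_def by (intro the_set_eqI) (simp add: assms(2))
  then show ?thesis using * by simp
qed

lemma nrec_emp: "tm (\<lambda>s. F (s (Suc 0)) (s 0)) \<Longrightarrow> nrec a F emp = a"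
  using nrec_eq[of F emp a a] by (simp add: rec_graph_emp)

lemma nrec_osucc:
  "tm (\<lambda>s. F (s (Suc 0)) (s 0)) \<Longrightarrow> n \<in>\<^sub>M omega \<Longrightarrow> nrec a F (osucc n) = F n (nrec a F n)"
  using nrec_eq[of F "osucc n" a] nrec_eq[of F n a] rec_graph_osucc[of n a F] by (metis osucc_omega)

end

section \<open>Natural numbers, pairing and finite sequences\<close>

context set_structure
begin

definition dbl :: "'a \<Rightarrow> 'a" where
  "dbl n = nrec emp (\<lambda>i r. osucc (osucc r)) n"

definition par :: "'a \<Rightarrow> 'a" where
  "par n = nrec emp (\<lambda>i r. if r = emp then one else emp) n"

definition half :: "'a \<Rightarrow> 'a" where
  "half n = nrec emp (\<lambda>i r. if par i = emp then r else osucc r) n"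

definition add :: "'a \<Rightarrow> 'a \<Rightarrow> 'a" where
  "add m n = nrec m (\<lambda>i r. osucc r) n"

definition prd :: "'a \<Rightarrow> 'a" where
  "prd n = nrec emp (\<lambda>i r. i) n"

text \<open>\<open>J m n = 2\<^sup>m (2 n + 1) - 1\<close>\<close>

definition J :: "'a \<Rightarrow> 'a \<Rightarrow> 'a" where
  "J m n = nrec (dbl n) (\<lambda>i r. osucc (dbl r)) m"

text \<open>Once more a union in place of a description: by injectivity of \<open>J\<close> it
  ranges over one pair at most, and it gives \<open>emp\<close> where there is none.\<close>

definition J1 :: "'a \<Rightarrow> 'a" where
  "J1 k = the_set (\<lambda>z. \<exists>a b. a \<in>\<^sub>M omega \<and> b \<in>\<^sub>M omega \<and> k = J a b \<and> z \<in>\<^sub>M a)"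

definition J2 :: "'a \<Rightarrow> 'a" where
  "J2 k = the_set (\<lambda>z. \<exists>a b. a \<in>\<^sub>M omega \<and> b \<in>\<^sub>M omega \<and> k = J a b \<and> z \<in>\<^sub>M b)"

text \<open>The code of the binary string \<open>x\<^sub>0 \<dots> x\<^bsub>n-1\<^esub>\<close> in bijective base 2.\<close>

definition K :: "'a \<Rightarrow> 'a \<Rightarrow> 'a" where
  "K x n = nrec emp (\<lambda>i r. if x \<bullet> i = emp then osucc (dbl r) else osucc (osucc (dbl r))) n"

definition rs :: "'a \<Rightarrow> 'a \<Rightarrow> 'a" where
  "rs x n = lam n (\<lambda>i. x \<bullet> i)"

definition sq :: "'a \<Rightarrow> 'a" where
  "sq Y = Uni (repl omega (\<lambda>n. funs n Y))"

definition len :: "'a \<Rightarrow> 'a" where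
  "len s = the_set (\<lambda>i. \<exists>y. \<langle>i, y\<rangle> \<in>\<^sub>M s)"

text \<open>The length is recorded because the fold does not determine it:
  \<open>J emp emp = emp\<close>, so the empty sequence and a single entry with code 0 have the same
  fold.\<close>

definition sqcode :: "'a \<Rightarrow> 'a \<Rightarrow> 'a" where
  "sqcode c s = J (len s) (nrec emp (\<lambda>i r. J r (c \<bullet> (s \<bullet> i))) (len s))"

text \<open>Countability always comes with the injection as data. It serves both to index families
  of dense sets and to select least elements.\<close>

definition ctb :: "'a \<Rightarrow> 'a \<Rightarrow> bool" where
  "ctb A c \<longleftrightarrow> c \<in>\<^sub>M funs A omega \<and>
     (\<forall>x y. x \<in>\<^sub>M A \<and> y \<in>\<^sub>M A \<and> c \<bullet> x = c \<bullet> y \<longrightarrow> x = y)"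

definition ovr :: "'a \<Rightarrow> 'a \<Rightarrow> 'a" where
  "ovr s w = lam omega (\<lambda>i. if i \<in>\<^sub>M len s then s \<bullet> i else w \<bullet> i)"

end

context ZF_model
begin

lemma one_omega [simp]: "one \<in>\<^sub>M omega" and two_omega [simp]: "two \<in>\<^sub>M omega"
  and one_not_emp [simp]: "one \<noteq> emp" "emp \<noteq> one"
  by (simp_all add: one_def two_def)

lemma mem_one [simp]: "x \<in>\<^sub>M one \<longleftrightarrow> x = emp"
  by (simp add: one_def)

lemma mem_two [simp]: "x \<in>\<^sub>M two \<longleftrightarrow> x = emp \<or> x = one"
  by (simp add: two_def)

lemma tm_dbl [fos]: "tm n \<Longrightarrow> tm (\<lambda>s. dbl (n s))"
  unfolding dbl_def by (intro fos | assumption)+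

lemma dbl_emp [simp]: "dbl emp = emp" and dbl_osucc [simp]: "n \<in>\<^sub>M omega \<Longrightarrow> dbl (osucc n) = osucc (osucc (dbl n))"
  unfolding dbl_def by ((rule nrec_emp nrec_osucc; (intro fos | assumption)+)+)

lemma tm_par [fos]: "tm n \<Longrightarrow> tm (\<lambda>s. par (n s))"
  unfolding par_def by (intro fos | assumption)+

lemma par_emp [simp]: "par emp = emp"
  and par_osucc [simp]: "n \<in>\<^sub>M omega \<Longrightarrow> par (osucc n) = (if par n = emp then one else emp)"
  unfolding par_def by ((rule nrec_emp nrec_osucc; (intro fos | assumption)+)+)

lemma tm_half [fos]: "tm n \<Longrightarrow> tm (\<lambda>s. half (n s))"
  unfolding half_def by (intro fos | assumption)+

lemma half_emp [simp]: "half emp = emp" and half_osucc [simp]: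
  "n \<in>\<^sub>M omega \<Longrightarrow> half (osucc n) = (if par n = emp then half n else osucc (half n))"
  unfolding half_def by ((rule nrec_emp nrec_osucc; (intro fos | assumption)+)+)

lemma tm_add [fos]: "tm m \<Longrightarrow> tm n \<Longrightarrow> tm (\<lambda>s. add (m s) (n s))"
  unfolding add_def by (intro fos | assumption)+

lemma add_emp [simp]: "add m emp = m"
  and add_osucc [simp]: "n \<in>\<^sub>M omega \<Longrightarrow> add m (osucc n) = osucc (add m n)"
  unfolding add_def by ((rule nrec_emp nrec_osucc; (intro fos | assumption)+)+)

lemma tm_prd [fos]: "tm n \<Longrightarrow> tm (\<lambda>s. prd (n s))"
  unfolding prd_def by (intro fos | assumption)+

lemma prd_emp [simp]: "prd emp = emp" and prd_osucc [simp]: "n \<in>\<^sub>M omega \<Longrightarrow> prd (osucc n) = n"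
  unfolding prd_def by ((rule nrec_emp nrec_osucc; (intro fos | assumption)+)+)

lemma tm_J [fos]: "tm m \<Longrightarrow> tm n \<Longrightarrow> tm (\<lambda>s. J (m s) (n s))"
  unfolding J_def by (intro fos | assumption)+

lemma J_emp [simp]: "J emp n = dbl n"
  and J_osucc [simp]: "m \<in>\<^sub>M omega \<Longrightarrow> J (osucc m) n = osucc (dbl (J m n))"
  unfolding J_def by ((rule nrec_emp nrec_osucc; (intro fos | assumption)+)+)

lemma tm_K [fos]: "tm x \<Longrightarrow> tm n \<Longrightarrow> tm (\<lambda>s. K (x s) (n s))"
  unfolding K_def by (intro fos tm_shift | assumption)+

lemma K_emp [simp]: "K x emp = emp" and K_osucc [simp]:
  "n \<in>\<^sub>M omega \<Longrightarrow> K x (osucc n) = (if x \<bullet> n = emp then osucc (dbl (K x n)) else osucc (osucc (dbl (K x n))))"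
  unfolding K_def by ((rule nrec_emp nrec_osucc; (intro fos | assumption)+)+)

lemma dbl_omega [simp]: "n \<in>\<^sub>M omega \<Longrightarrow> dbl n \<in>\<^sub>M omega"
  by (induction rule: nat_induct) ((intro fos)?; simp)+

lemma par_two: "n \<in>\<^sub>M omega \<Longrightarrow> par n = emp \<or> par n = one"
  by (induction rule: nat_induct) ((intro fos)?; simp)+

lemma par_omega [simp]: "n \<in>\<^sub>M omega \<Longrightarrow> par n \<in>\<^sub>M omega"
  using par_two by fastforce

lemma half_omega [simp]: "n \<in>\<^sub>M omega \<Longrightarrow> half n \<in>\<^sub>M omega"
  by (induction rule: nat_induct) ((intro fos)?; simp)+

lemma add_omega [simp]: "n \<in>\<^sub>M omega \<Longrightarrow> m \<in>\<^sub>M omega \<Longrightarrow> add m n \<in>\<^sub>M omega"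
  by (induction rule: nat_induct) ((intro fos)?; simp)+

lemma prd_omega [simp]: "n \<in>\<^sub>M omega \<Longrightarrow> prd n \<in>\<^sub>M omega"
  by (erule nat_cases) simp_all

lemma J_omega [simp]: "m \<in>\<^sub>M omega \<Longrightarrow> n \<in>\<^sub>M omega \<Longrightarrow> J m n \<in>\<^sub>M omega"
  by (induction rule: nat_induct) ((intro fos)?; simp)+

lemma K_omega [simp]: "n \<in>\<^sub>M omega \<Longrightarrow> K x n \<in>\<^sub>M omega"
  by (induction rule: nat_induct) ((intro fos)?; simp)+

lemma par_dbl [simp]: "n \<in>\<^sub>M omega \<Longrightarrow> par (dbl n) = emp"
  by (induction rule: nat_induct) ((intro fos)?; simp)+

lemma half_dbl [simp]: "n \<in>\<^sub>M omega \<Longrightarrow> half (dbl n) = n"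
  by (induction rule: nat_induct) ((intro fos)?; simp)+

lemma dbl_inject [simp]: "m \<in>\<^sub>M omega \<Longrightarrow> n \<in>\<^sub>M omega \<Longrightarrow> dbl m = dbl n \<longleftrightarrow> m = n"
  by (metis half_dbl)

lemma dbl_neq_osucc_dbl [simp]:
  assumes "m \<in>\<^sub>M omega" "n \<in>\<^sub>M omega"
  shows "dbl m \<noteq> osucc (dbl n)" "osucc (dbl n) \<noteq> dbl m"
proof -
  have "par (dbl m) \<noteq> par (osucc (dbl n))" using assms by simp
  then show "dbl m \<noteq> osucc (dbl n)" "osucc (dbl n) \<noteq> dbl m" by metis+
qed

lemma dbl_half:
  assumes "n \<in>\<^sub>M omega"
  shows "par n = emp \<Longrightarrow> dbl (half n) = n" "par n \<noteq> emp \<Longrightarrow> osucc (dbl (half n)) = n"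
proof -
  have "(par n = emp \<longrightarrow> dbl (half n) = n) \<and> (par n \<noteq> emp \<longrightarrow> osucc (dbl (half n)) = n)"
    using assms by (induction rule: nat_induct) ((intro fos)?; simp)+
  then show "par n = emp \<Longrightarrow> dbl (half n) = n" "par n \<noteq> emp \<Longrightarrow> osucc (dbl (half n)) = n"
    by blast+
qed

lemma mem_evens: "n \<in>\<^sub>M evens \<longleftrightarrow> n \<in>\<^sub>M omega \<and> par n = emp"
proof -
  have "isset (\<lambda>n. n \<in>\<^sub>M omega \<and>
     (\<forall>I. emp \<in>\<^sub>M I \<and> (\<forall>m \<in> elts I. osucc (osucc m) \<in>\<^sub>M I) \<longrightarrow> n \<in>\<^sub>M I))"
    by (intro isset_sep fos)
  then have *: "n \<in>\<^sub>M evens \<longleftrightarrow> n \<in>\<^sub>M omega \<and>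
     (\<forall>I. emp \<in>\<^sub>M I \<and> (\<forall>m \<in> elts I. osucc (osucc m) \<in>\<^sub>M I) \<longrightarrow> n \<in>\<^sub>M I)" for n
    unfolding evens_def by (rule mem_the_set)
  have "par n = emp" if "n \<in>\<^sub>M evens"
  proof -
    let ?I = "sep omega (\<lambda>n. par n = emp)"
    have I: "m \<in>\<^sub>M ?I \<longleftrightarrow> m \<in>\<^sub>M omega \<and> par m = emp" for m
      by (rule mem_sep) (intro fos)
    have "emp \<in>\<^sub>M ?I \<and> (\<forall>m \<in> elts ?I. osucc (osucc m) \<in>\<^sub>M ?I)"
      by (auto simp: I)
    then show ?thesis using that * I by blast
  qed
  moreover have "dbl m \<in>\<^sub>M evens" if "m \<in>\<^sub>M omega" for m
    using that
  proof (induction rule: nat_induct)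
    case (osucc n)
    then have "osucc (osucc (dbl n)) \<in>\<^sub>M evens"
      unfolding * by (intro conjI osucc_omega dbl_omega) blast+
    then show ?case using osucc by simp
  qed (intro fos, simp add: *)
  ultimately show ?thesis using * dbl_half(1) half_omega by metis
qed

text \<open>Parity tells whether the first component is 0; if it is not, one application of
  \<open>osucc (dbl _)\<close> is stripped off on both sides.\<close>

lemma J_inject:
  assumes "a \<in>\<^sub>M omega" "b \<in>\<^sub>M omega" "a' \<in>\<^sub>M omega" "b' \<in>\<^sub>M omega" "J a b = J a' b'"
  shows "a = a'" "b = b'"
proof -
  have "\<forall>a'. a' \<in>\<^sub>M omega \<longrightarrow> J a b = J a' b' \<longrightarrow> a = a' \<and> b = b'"
    using assms(1)
  proof (induction rule: nat_induct)
    case emp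
    show ?case
    proof (intro allI impI)
      fix a' assume "a' \<in>\<^sub>M omega" "J emp b = J a' b'"
      then show "emp = a' \<and> b = b'"
        using assms(2,4) dbl_neq_osucc_dbl[OF assms(2) J_omega[OF _ assms(4)]]
        by (cases rule: nat_cases) (simp, metis J_emp J_osucc)
    qed
  next
    case (osucc n)
    show ?case
    proof (intro allI impI)
      fix a' assume "a' \<in>\<^sub>M omega" "J (osucc n) b = J a' b'"
      then show "osucc n = a' \<and> b = b'"
      proof (cases rule: nat_cases)
        case 1
        then show ?thesis
          using \<open>J (osucc n) b = _\<close> osucc(1) dbl_neq_osucc_dbl[OF assms(4) J_omega[OF osucc(1) assms(2)]]
          by simp
      next
        case (2 m)
        then have "J n b = J m b'"
          using \<open>J (osucc n) b = _\<close> osucc(1) assms by simp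
        then show ?thesis using osucc(2) 2 by simp
      qed
    qed
  qed (intro fos)
  then show "a = a'" "b = b'" using assms by blast+
qed

lemma J_eq_iff:
  "a \<in>\<^sub>M omega \<Longrightarrow> b \<in>\<^sub>M omega \<Longrightarrow> a' \<in>\<^sub>M omega \<Longrightarrow> b' \<in>\<^sub>M omega \<Longrightarrow>
    J a b = J a' b' \<longleftrightarrow> a = a' \<and> b = b'"
  using J_inject[of a b a' b'] by metis

lemma isset_J1: "isset (\<lambda>z. \<exists>a b. a \<in>\<^sub>M omega \<and> b \<in>\<^sub>M omega \<and> k = J a b \<and> z \<in>\<^sub>M a)"
  by (rule isset_subset[of _ "Uni omega"]) (intro fos, auto)

lemma isset_J2: "isset (\<lambda>z. \<exists>a b. a \<in>\<^sub>M omega \<and> b \<in>\<^sub>M omega \<and> k = J a b \<and> z \<in>\<^sub>M b)"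
  by (rule isset_subset[of _ "Uni omega"]) (intro fos, auto)

lemma tm_J1 [fos]: "tm k \<Longrightarrow> tm (\<lambda>s. J1 (k s))" and tm_J2 [fos]: "tm k \<Longrightarrow> tm (\<lambda>s. J2 (k s))"
  unfolding J1_def J2_def by ((rule tm_the_setI; (intro fos tm_shift isset_J1 isset_J2 | assumption)+)+)

lemma J1_J [simp]: "a \<in>\<^sub>M omega \<Longrightarrow> b \<in>\<^sub>M omega \<Longrightarrow> J1 (J a b) = a"
  unfolding J1_def by (rule the_set_eqI) (metis J_inject(1))

lemma J2_J [simp]: "a \<in>\<^sub>M omega \<Longrightarrow> b \<in>\<^sub>M omega \<Longrightarrow> J2 (J a b) = b"
  unfolding J2_def by (rule the_set_eqI) (metis J_inject(2))

lemma J1_omega [simp]: "J1 k \<in>\<^sub>M omega" and J2_omega [simp]: "J2 k \<in>\<^sub>M omega"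
proof -
  have "J1 k \<in>\<^sub>M omega \<and> J2 k \<in>\<^sub>M omega"
  proof (cases "\<exists>a b. a \<in>\<^sub>M omega \<and> b \<in>\<^sub>M omega \<and> k = J a b")
    case False
    then have "J1 k = emp" "J2 k = emp"
      unfolding J1_def J2_def by (intro the_set_eqI; auto)+
    then show ?thesis by simp
  qed auto
  then show "J1 k \<in>\<^sub>M omega" "J2 k \<in>\<^sub>M omega" by auto
qed

text \<open>The digits are 1 and 2, never 0. So only the empty string has code 0, and otherwise the
  parity of the code gives the last digit; the length need not be known in advance.\<close>

lemma K_inject:
  assumes "m \<in>\<^sub>M omega" "n \<in>\<^sub>M omega" "x \<in>\<^sub>M cantor" "y \<in>\<^sub>M cantor" "K x m = K y n"
  shows "m = n" "i \<in>\<^sub>M m \<Longrightarrow> x \<bullet> i = y \<bullet> i"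
proof -
  have v: "z \<bullet> i = emp \<or> z \<bullet> i = one" if "z \<in>\<^sub>M cantor" "i \<in>\<^sub>M omega" for z i
    using ap_type[of z omega two i] that unfolding cantor_def by simp
  have "\<forall>n. n \<in>\<^sub>M omega \<longrightarrow> K x m = K y n \<longrightarrow> m = n \<and> (\<forall>i. i \<in>\<^sub>M m \<longrightarrow> x \<bullet> i = y \<bullet> i)"
    using assms(1)
  proof (induction rule: nat_induct)
    case emp
    show ?case
    proof (intro allI impI)
      fix n assume "n \<in>\<^sub>M omega" "K x emp = K y n"
      then show "emp = n \<and> (\<forall>i. i \<in>\<^sub>M emp \<longrightarrow> x \<bullet> i = y \<bullet> i)"
        by (cases rule: nat_cases) (simp_all split: if_splits)
    qed
  next
    case (osucc m)
    show ?case
    proof (intro allI impI)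
      fix n assume "n \<in>\<^sub>M omega" "K x (osucc m) = K y n"
      then show "osucc m = n \<and> (\<forall>i. i \<in>\<^sub>M osucc m \<longrightarrow> x \<bullet> i = y \<bullet> i)"
      proof (cases rule: nat_cases)
        case 1
        then show ?thesis using \<open>K x (osucc m) = _\<close> osucc(1) by (simp split: if_splits)
      next
        case (2 k)
        have "K x m = K y k \<and> x \<bullet> m = y \<bullet> k"
          using \<open>K x (osucc m) = _\<close> osucc(1) 2 v[OF assms(3) osucc(1)] v[OF assms(4) 2(1)]
          by (simp split: if_splits)
        then show ?thesis using osucc(2) 2 by fastforce
      qed
    qed
  qed (intro fos)
  then show "m = n" "i \<in>\<^sub>M m \<Longrightarrow> x \<bullet> i = y \<bullet> i" using assms by blast+
qed

subsection \<open>Sequences\<close>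

lemma cantor_ap [simp]: "x \<in>\<^sub>M cantor \<Longrightarrow> n \<in>\<^sub>M omega \<Longrightarrow> x \<bullet> n \<in>\<^sub>M omega"
  using ap_type[of x omega two n] unfolding cantor_def by auto

lemma cantor_two: "x \<in>\<^sub>M cantor \<Longrightarrow> n \<in>\<^sub>M omega \<Longrightarrow> x \<bullet> n = emp \<or> x \<bullet> n = one"
  using ap_type[of x omega two n] unfolding cantor_def by auto

lemma cantor_ext:
  "x \<in>\<^sub>M cantor \<Longrightarrow> y \<in>\<^sub>M cantor \<Longrightarrow> (\<And>n. n \<in>\<^sub>M omega \<Longrightarrow> x \<bullet> n = y \<bullet> n) \<Longrightarrow> x = y"
  unfolding cantor_def by (rule fun_ext)

lemma lam_cantor:
  assumes "tm (\<lambda>s. t (s 0))" "\<And>n. n \<in>\<^sub>M omega \<Longrightarrow> t n = emp \<or> t n = one"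
  shows "lam omega t \<in>\<^sub>M cantor"
  unfolding cantor_def using assms by (intro lam_funs) auto

lemma tm_rs [fos]: "tm x \<Longrightarrow> tm n \<Longrightarrow> tm (\<lambda>s. rs (x s) (n s))"
  unfolding rs_def by (intro fos tm_shift | assumption)+

lemma rs_ap [simp]: "i \<in>\<^sub>M n \<Longrightarrow> rs x n \<bullet> i = x \<bullet> i"
  unfolding rs_def by (intro ap_lam fos)

lemma rs_funs: "(\<And>i. i \<in>\<^sub>M n \<Longrightarrow> x \<bullet> i \<in>\<^sub>M Y) \<Longrightarrow> rs x n \<in>\<^sub>M funs n Y"
  unfolding rs_def by (intro lam_funs fos)

lemma rs_seq: "x \<in>\<^sub>M funs omega Y \<Longrightarrow> n \<in>\<^sub>M omega \<Longrightarrow> rs x n \<in>\<^sub>M funs n Y"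
  by (rule rs_funs) (blast intro: ap_type nat_trans)

lemma rs_id: "s \<in>\<^sub>M funs n Y \<Longrightarrow> rs s n = s"
  unfolding rs_def by (rule lam_eta)

lemma restr_eq_rs: "x \<in>\<^sub>M funs omega Y \<Longrightarrow> n \<in>\<^sub>M omega \<Longrightarrow> restr x n = rs x n"
proof -
  assume *: "x \<in>\<^sub>M funs omega Y" "n \<in>\<^sub>M omega"
  have "x \<cdot> i = x \<bullet> i" if "i \<in>\<^sub>M n" for i
    using app_eq_ap[OF *(1)] nat_trans(1)[OF *(2) that] by simp
  moreover have "p \<in>\<^sub>M rs x n \<longleftrightarrow> (\<exists>i. i \<in>\<^sub>M n \<and> p = \<langle>i, x \<bullet> i\<rangle>)" for p
    unfolding rs_def by (rule mem_lam) (intro fos)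
  ultimately show ?thesis
    unfolding restr_def by (intro the_set_eqI) auto
qed

lemma tm_sq [fos]: "tm Y \<Longrightarrow> tm (\<lambda>s. sq (Y s))"
  unfolding sq_def by (intro fos tm_shift | assumption)+

lemma mem_sq: "s \<in>\<^sub>M sq Y \<longleftrightarrow> (\<exists>n. n \<in>\<^sub>M omega \<and> s \<in>\<^sub>M funs n Y)"
proof -
  have "z \<in>\<^sub>M repl omega (\<lambda>n. funs n Y) \<longleftrightarrow> (\<exists>n. n \<in>\<^sub>M omega \<and> z = funs n Y)" for z
    by (rule mem_repl) (intro fos)
  then show ?thesis unfolding sq_def by auto
qed

lemma isset_len: "isset (\<lambda>i. \<exists>y. \<langle>i, y\<rangle> \<in>\<^sub>M s)"
proof (rule isset_subset)
  show "i \<in>\<^sub>M Uni (Uni s)" if "\<exists>y. \<langle>i, y\<rangle> \<in>\<^sub>M s" for i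
  proof -
    obtain y where y: "\<langle>i, y\<rangle> \<in>\<^sub>M s" using \<open>\<exists>y. _\<close> by blast
    have "upair i y \<in>\<^sub>M \<langle>i, y\<rangle>" "i \<in>\<^sub>M upair i y" by (simp_all add: opair_def)
    then show ?thesis using y unfolding mem_Uni by blast
  qed
qed (intro fos)

lemma tm_len [fos]: "tm t \<Longrightarrow> tm (\<lambda>s. len (t s))"
  unfolding len_def by (rule tm_the_setI) (intro fos tm_shift isset_len | assumption)+

lemma len_eq: "s \<in>\<^sub>M funs n Y \<Longrightarrow> len s = n"
  unfolding len_def by (rule the_set_eqI) (simp add: pair_in_fun)

lemma sq_len: "s \<in>\<^sub>M sq Y \<Longrightarrow> len s \<in>\<^sub>M omega" "s \<in>\<^sub>M sq Y \<Longrightarrow> s \<in>\<^sub>M funs (len s) Y"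
  by (auto simp: mem_sq len_eq)

lemma tm_sqcode [fos]: "tm c \<Longrightarrow> tm t \<Longrightarrow> tm (\<lambda>s. sqcode (c s) (t s))"
  unfolding sqcode_def by (intro fos tm_shift | assumption)+

lemma sqcode:
  assumes c: "ctb Y c" and "s \<in>\<^sub>M sq Y"
  shows "sqcode c s \<in>\<^sub>M omega" "t \<in>\<^sub>M sq Y \<Longrightarrow> sqcode c s = sqcode c t \<Longrightarrow> s = t"
proof -
  define f where "f s n = nrec emp (\<lambda>i r. J r (c \<bullet> (s \<bullet> i))) n" for s n
  have f: "f s emp = emp" "n \<in>\<^sub>M omega \<Longrightarrow> f s (osucc n) = J (f s n) (c \<bullet> (s \<bullet> n))" for s n
    unfolding f_def by ((rule nrec_emp nrec_osucc; (intro fos | assumption)+)+)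
  have tm_f: "tm (\<lambda>e. f (a e) (b e))" if "tm a" "tm b" for a b
    unfolding f_def by (intro fos tm_shift that)
  have v: "c \<bullet> (s \<bullet> i) \<in>\<^sub>M omega" "s \<bullet> i \<in>\<^sub>M Y" if "s \<in>\<^sub>M funs n Y" "i \<in>\<^sub>M n" for s n i
    using c ap_type[OF that] ap_type[of c Y omega] unfolding ctb_def by auto
  have fo: "n \<in>\<^sub>M omega \<Longrightarrow> \<forall>i. i \<in>\<^sub>M n \<longrightarrow> c \<bullet> (s \<bullet> i) \<in>\<^sub>M omega \<Longrightarrow> f s n \<in>\<^sub>M omega" for s n
    by (induction rule: nat_induct) ((intro fos tm_f)?; simp add: f)+
  have F: "f s (len s) \<in>\<^sub>M omega" if "s \<in>\<^sub>M sq Y" for s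
    using fo[of "len s" s] v[OF sq_len(2)[OF that]] sq_len(1)[OF that] by blast
  show "sqcode c s \<in>\<^sub>M omega"
    unfolding sqcode_def f_def[symmetric] using F[OF assms(2)] sq_len(1)[OF assms(2)] by simp
  assume t: "t \<in>\<^sub>M sq Y" and eq: "sqcode c s = sqcode c t"
  have "J (len s) (f s (len s)) = J (len t) (f t (len t))"
    using eq unfolding sqcode_def f_def .
  then have *: "len s = len t" "f s (len s) = f t (len t)" 
    using J_inject[OF sq_len(1)[OF assms(2)] F[OF assms(2)] sq_len(1)[OF t] F[OF t]] by blast+
  have "\<forall>s t. (\<forall>i. i \<in>\<^sub>M n \<longrightarrow> c \<bullet> (s \<bullet> i) \<in>\<^sub>M omega \<and> c \<bullet> (t \<bullet> i) \<in>\<^sub>M omega) \<longrightarrow>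
    f s n = f t n \<longrightarrow> (\<forall>i. i \<in>\<^sub>M n \<longrightarrow> c \<bullet> (s \<bullet> i) = c \<bullet> (t \<bullet> i))" if "n \<in>\<^sub>M omega" for n
    using that
  proof (induction rule: nat_induct)
    case (osucc n)
    show ?case
    proof (intro allI impI)
      fix s t i
      assume 1: "\<forall>i. i \<in>\<^sub>M osucc n \<longrightarrow> c \<bullet> (s \<bullet> i) \<in>\<^sub>M omega \<and> c \<bullet> (t \<bullet> i) \<in>\<^sub>M omega"
        and 2: "f s (osucc n) = f t (osucc n)" and i: "i \<in>\<^sub>M osucc n"
      have "f s n \<in>\<^sub>M omega" "f t n \<in>\<^sub>M omega" "c \<bullet> (s \<bullet> n) \<in>\<^sub>M omega" "c \<bullet> (t \<bullet> n) \<in>\<^sub>M omega"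
        using fo[OF osucc(1)] 1 unfolding mem_osucc by blast+
      then have "f s n = f t n \<and> c \<bullet> (s \<bullet> n) = c \<bullet> (t \<bullet> n)"
        using 2 unfolding f(2)[OF osucc(1)] by (simp add: J_eq_iff)
      then show "c \<bullet> (s \<bullet> i) = c \<bullet> (t \<bullet> i)" using osucc(2) 1 i unfolding mem_osucc by blast
    qed
  qed ((intro fos tm_f)?; simp)+
  from this[OF sq_len(1)[OF assms(2)]] have "\<forall>i. i \<in>\<^sub>M len s \<longrightarrow> c \<bullet> (s \<bullet> i) = c \<bullet> (t \<bullet> i)"
    using * v(1)[OF sq_len(2)[OF assms(2)]] v(1)[OF sq_len(2)[OF t]] by metis
  then have "s \<bullet> i = t \<bullet> i" if "i \<in>\<^sub>M len s" for i
  proof -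
    have "s \<bullet> i \<in>\<^sub>M Y" "t \<bullet> i \<in>\<^sub>M Y"
      using v(2)[OF sq_len(2)[OF assms(2)] that] v(2)[OF sq_len(2)[OF t]] that *(1) by auto
    then show ?thesis using c that \<open>\<forall>i. _ \<longrightarrow> _\<close> unfolding ctb_def by blast
  qed
  then show "s = t"
    using fun_ext[OF sq_len(2)[OF assms(2)]] sq_len(2)[OF t] *(1) by metis
qed

lemma tm_ovr [fos]: "tm a \<Longrightarrow> tm b \<Longrightarrow> tm (\<lambda>s. ovr (a s) (b s))"
  unfolding ovr_def by (intro fos tm_shift | assumption)+

lemma ovr_ap: "i \<in>\<^sub>M omega \<Longrightarrow> ovr s w \<bullet> i = (if i \<in>\<^sub>M len s then s \<bullet> i else w \<bullet> i)"
  unfolding ovr_def by (rule ap_lam) (intro fos)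

lemma ovr_funs: "s \<in>\<^sub>M sq Y \<Longrightarrow> w \<in>\<^sub>M funs omega Y \<Longrightarrow> ovr s w \<in>\<^sub>M funs omega Y"
  unfolding ovr_def by (intro lam_funs fos) (auto intro: ap_type sq_len)

lemma tm_snoc [fos]: "tm k \<Longrightarrow> tm a \<Longrightarrow> tm v \<Longrightarrow> tm (\<lambda>s. snoc (k s) (a s) (v s))"
proof -
  have "snoc k a v = un a (upair \<langle>k, v\<rangle> \<langle>k, v\<rangle>)" for k a v
    unfolding snoc_def by (rule the_set_eqI) simp
  then show "tm k \<Longrightarrow> tm a \<Longrightarrow> tm v \<Longrightarrow> tm (\<lambda>s. snoc (k s) (a s) (v s))"
    by (simp only:) (intro fos | assumption)+
qed

lemma mem_snoc: "p \<in>\<^sub>M snoc k a v \<longleftrightarrow> p \<in>\<^sub>M a \<or> p = \<langle>k, v\<rangle>"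
  unfolding snoc_def
  by (rule mem_the_set) (auto simp: isset_def intro!: exI[of _ "un a (upair \<langle>k, v\<rangle> \<langle>k, v\<rangle>)"])

lemma snoc_funs:
  assumes "a \<in>\<^sub>M funs k Y" "v \<in>\<^sub>M Y"
  shows "snoc k a v \<in>\<^sub>M funs (osucc k) Y" "snoc k a v \<bullet> k = v"
    "\<And>i. i \<in>\<^sub>M k \<Longrightarrow> snoc k a v \<bullet> i = a \<bullet> i"
proof -
  have *: "\<langle>i, y\<rangle> \<in>\<^sub>M snoc k a v \<longleftrightarrow> (i \<in>\<^sub>M k \<and> y = a \<bullet> i) \<or> (i = k \<and> y = v)" for i y
    using pair_in_fun[OF assms(1)] by (simp add: mem_snoc)
  have **: "\<exists>x y. x \<in>\<^sub>M osucc k \<and> y \<in>\<^sub>M Y \<and> p = \<langle>x, y\<rangle>" if "p \<in>\<^sub>M snoc k a v" for p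
    using that assms unfolding mem_snoc mem_osucc mem_funs by blast
  show "snoc k a v \<in>\<^sub>M funs (osucc k) Y"
    unfolding mem_funs using ** mem_irrefl by (auto simp: *)
  show "snoc k a v \<bullet> k = v" "\<And>i. i \<in>\<^sub>M k \<Longrightarrow> snoc k a v \<bullet> i = a \<bullet> i"
    by (rule ap_eqI; use mem_irrefl in \<open>auto simp: *\<close>)+
qed

end

section \<open>Reals and games with binary moves\<close>

context set_structure
begin

definition zero :: 'a where
  "zero = lam omega (\<lambda>n. emp)"

definition join :: "'a \<Rightarrow> 'a \<Rightarrow> 'a" where
  "join x y = lam omega (\<lambda>n. if par n = emp then x \<bullet> half n else y \<bullet> half n)"

definition evn :: "'a \<Rightarrow> 'a" where
  "evn x = lam omega (\<lambda>n. x \<bullet> dbl n)"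

definition odds :: "'a \<Rightarrow> 'a" where
  "odds x = lam omega (\<lambda>n. x \<bullet> osucc (dbl n))"

definition shift :: "'a \<Rightarrow> 'a" where
  "shift x = lam omega (\<lambda>n. x \<bullet> osucc n)"

text \<open>A strategy becomes a real by looking only at the opponent's moves: the n-th reply is the
  bit of \<open>s\<close> at the code of the first n bits of \<open>x\<close>. The strategy's own
  earlier moves are determined by these bits.\<close>

definition resp :: "'a \<Rightarrow> 'a \<Rightarrow> 'a" where
  "resp s x = lam omega (\<lambda>n. s \<bullet> K x n)"

text \<open>
  The play of a game with binary moves in which one player follows the strategy coded by \<open>s\<close> and the
  other plays \<open>x\<close>.
\<close>

definition playI :: "'a \<Rightarrow> 'a \<Rightarrow> 'a" where
  "playI s x = join (resp s x) x"

text \<open>The second player has already seen n + 1 moves when making its n-th reply, hence the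
  shift.\<close>

definition playII :: "'a \<Rightarrow> 'a \<Rightarrow> 'a" where
  "playII s x = join x (shift (resp s x))"

text \<open>Reads a play of the game on \<omega> as a binary play, which lets AD be applied to games
  with binary moves.\<close>

definition bit :: "'a \<Rightarrow> 'a" where
  "bit z = lam omega (\<lambda>n. if z \<bullet> n = emp then emp else one)"

definition is_run :: "bool \<Rightarrow> 'a \<Rightarrow> 'a \<Rightarrow> 'a \<Rightarrow> bool" where
  "is_run e \<sigma> x z \<longleftrightarrow> z \<in>\<^sub>M funs omega omega \<and>
     (\<forall>n. n \<in>\<^sub>M omega \<longrightarrow> z \<bullet> n = (if (par n = emp) = e then \<sigma> \<bullet> rs z n else x \<bullet> half n))"

end

context ZF_model
begin

lemma zero_cantor [simp]: "zero \<in>\<^sub>M cantor"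
  unfolding zero_def by (intro lam_cantor fos) simp

lemma tm_join [fos]: "tm x \<Longrightarrow> tm y \<Longrightarrow> tm (\<lambda>s. join (x s) (y s))"
  unfolding join_def by (intro fos tm_shift | assumption)+

lemma join_ap: "n \<in>\<^sub>M omega \<Longrightarrow> join x y \<bullet> n = (if par n = emp then x \<bullet> half n else y \<bullet> half n)"
  unfolding join_def by (rule ap_lam) (intro fos)

lemma join_cantor [simp]: "x \<in>\<^sub>M cantor \<Longrightarrow> y \<in>\<^sub>M cantor \<Longrightarrow> join x y \<in>\<^sub>M cantor"
  unfolding join_def by (intro lam_cantor fos) (simp add: cantor_two)

lemma tm_evn [fos]: "tm x \<Longrightarrow> tm (\<lambda>s. evn (x s))"
  unfolding evn_def by (intro fos tm_shift | assumption)+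

lemma evn_ap: "n \<in>\<^sub>M omega \<Longrightarrow> evn x \<bullet> n = x \<bullet> dbl n"
  unfolding evn_def by (rule ap_lam) (intro fos)

lemma evn_cantor [simp]: "x \<in>\<^sub>M cantor \<Longrightarrow> evn x \<in>\<^sub>M cantor"
  unfolding evn_def by (intro lam_cantor fos) (simp add: cantor_two)

lemma tm_odds [fos]: "tm x \<Longrightarrow> tm (\<lambda>s. odds (x s))"
  unfolding odds_def by (intro fos tm_shift | assumption)+

lemma odds_ap: "n \<in>\<^sub>M omega \<Longrightarrow> odds x \<bullet> n = x \<bullet> osucc (dbl n)"
  unfolding odds_def by (rule ap_lam) (intro fos)

lemma odds_cantor [simp]: "x \<in>\<^sub>M cantor \<Longrightarrow> odds x \<in>\<^sub>M cantor"
  unfolding odds_def by (intro lam_cantor fos) (simp add: cantor_two)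

lemma tm_shift_real [fos]: "tm x \<Longrightarrow> tm (\<lambda>s. shift (x s))"
  unfolding shift_def by (intro fos tm_shift | assumption)+

lemma shift_ap: "n \<in>\<^sub>M omega \<Longrightarrow> shift x \<bullet> n = x \<bullet> osucc n"
  unfolding shift_def by (rule ap_lam) (intro fos)

lemma shift_cantor [simp]: "x \<in>\<^sub>M cantor \<Longrightarrow> shift x \<in>\<^sub>M cantor"
  unfolding shift_def by (intro lam_cantor fos) (simp add: cantor_two)

lemma tm_resp [fos]: "tm x \<Longrightarrow> tm y \<Longrightarrow> tm (\<lambda>s. resp (x s) (y s))"
  unfolding resp_def by (intro fos tm_shift | assumption)+

lemma resp_ap: "n \<in>\<^sub>M omega \<Longrightarrow> resp s x \<bullet> n = s \<bullet> K x n"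
  unfolding resp_def by (rule ap_lam) (intro fos)

lemma resp_cantor [simp]: "s \<in>\<^sub>M cantor \<Longrightarrow> resp s x \<in>\<^sub>M cantor"
  unfolding resp_def by (intro lam_cantor fos) (simp add: cantor_two)

lemma tm_playI [fos]: "tm x \<Longrightarrow> tm y \<Longrightarrow> tm (\<lambda>s. playI (x s) (y s))"
  unfolding playI_def by (intro fos | assumption)+

lemma tm_playII [fos]: "tm x \<Longrightarrow> tm y \<Longrightarrow> tm (\<lambda>s. playII (x s) (y s))"
  unfolding playII_def by (intro fos | assumption)+

lemma evn_join [simp]: "x \<in>\<^sub>M cantor \<Longrightarrow> y \<in>\<^sub>M cantor \<Longrightarrow> evn (join x y) = x"
  by (rule cantor_ext) (simp_all add: evn_ap join_ap)

lemma odds_join [simp]: "x \<in>\<^sub>M cantor \<Longrightarrow> y \<in>\<^sub>M cantor \<Longrightarrow> odds (join x y) = y"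
  by (rule cantor_ext) (simp_all add: odds_ap join_ap)

lemma tm_bit [fos]: "tm x \<Longrightarrow> tm (\<lambda>s. bit (x s))"
  unfolding bit_def by (intro fos tm_shift | assumption)+

lemma bit_ap: "n \<in>\<^sub>M omega \<Longrightarrow> bit z \<bullet> n = (if z \<bullet> n = emp then emp else one)"
  unfolding bit_def by (rule ap_lam) (intro fos)

lemma bit_cantor [simp]: "bit z \<in>\<^sub>M cantor"
  unfolding bit_def by (intro lam_cantor fos) simp

lemma rs_eq_iff: "rs x n = rs y n \<longleftrightarrow> (\<forall>i. i \<in>\<^sub>M n \<longrightarrow> x \<bullet> i = y \<bullet> i)"
proof
  assume "rs x n = rs y n"
  then show "\<forall>i. i \<in>\<^sub>M n \<longrightarrow> x \<bullet> i = y \<bullet> i" using rs_ap by metis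
next
  assume *: "\<forall>i. i \<in>\<^sub>M n \<longrightarrow> x \<bullet> i = y \<bullet> i"
  have "p \<in>\<^sub>M rs y n \<longleftrightarrow> (\<exists>i. i \<in>\<^sub>M n \<and> p = \<langle>i, y \<bullet> i\<rangle>)" for p y
    unfolding rs_def by (rule mem_lam) (intro fos)
  then show "rs x n = rs y n" using * by (intro ext) auto
qed

text \<open>Because the next entry is a definable operation of the history, the histories arise by
  recursion and no dependent choice is involved.\<close>

lemma ex_run:
  assumes t: "tm (\<lambda>s. t (s 0))" and ty: "\<And>h. h \<in>\<^sub>M sq Y \<Longrightarrow> t h \<in>\<^sub>M Y"
  obtains z where "z \<in>\<^sub>M funs omega Y" "\<And>n. n \<in>\<^sub>M omega \<Longrightarrow> z \<bullet> n = t (rs z n)"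
proof -
  have t': "tm (\<lambda>s. t (a s))" if "tm a" for a
  proof -
    have "fo (\<lambda>s. \<exists>u. u = a (\<lambda>i. s (Suc i)) \<and> s 0 = t u)"
    proof (intro fo_ex fo_conj)
      have "inj (\<lambda>i::nat. if i = 0 then Suc 0 else if i = Suc 0 then 0 else i)" by (auto simp: inj_on_def)
      from fo_rename[OF t[unfolded tm_def] this] show "fo (\<lambda>s. s (Suc 0) = t (s 0))" by simp
    qed (intro fos tm_shift that)
    then show ?thesis unfolding tm_def by simp
  qed
  define H where "H n = nrec emp (\<lambda>i h. snoc i h (t h)) n" for n
  have H: "H emp = emp" "n \<in>\<^sub>M omega \<Longrightarrow> H (osucc n) = snoc n (H n) (t (H n))" for n
    unfolding H_def by ((rule nrec_emp nrec_osucc; (intro fos t' | assumption)+)+)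
  have tm_H: "tm (\<lambda>s. H (a s))" if "tm a" for a
    unfolding H_def by (intro fos t' that)
  have HY: "H n \<in>\<^sub>M funs n Y" if "n \<in>\<^sub>M omega" for n
    using that
  proof (induction rule: nat_induct)
    case emp
    show ?case by (simp add: H mem_funs)
  next
    case (osucc n)
    then have "H n \<in>\<^sub>M sq Y" by (auto simp: mem_sq)
    then show ?case using osucc by (simp add: H snoc_funs ty)
  qed (intro fos tm_H)
  define z where "z = lam omega (\<lambda>n. t (H n))"
  have z: "z \<bullet> n = t (H n)" if "n \<in>\<^sub>M omega" for n
    unfolding z_def using that by (intro ap_lam t' tm_H fos)
  have "z \<in>\<^sub>M funs omega Y"
    unfolding z_def using HY by (intro lam_funs t' tm_H fos ty) (auto simp: mem_sq)
  moreover have "\<forall>i. i \<in>\<^sub>M n \<longrightarrow> z \<bullet> i = H n \<bullet> i" if "n \<in>\<^sub>M omega" for n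
    using that
  proof (induction rule: nat_induct)
    case (osucc n)
    have "t (H n) \<in>\<^sub>M Y" using HY[OF osucc(1)] osucc(1) by (intro ty) (auto simp: mem_sq)
    then show ?case using osucc snoc_funs[OF HY[OF osucc(1)]] by (auto simp: H z)
  qed ((intro fos tm_H)?; simp)+
  then have "rs z n = H n" if "n \<in>\<^sub>M omega" for n
    using rs_eq_iff[of z n "H n"] rs_id[OF HY[OF that]] that by metis
  ultimately show ?thesis using that z by metis
qed

lemma is_run_ex:
  assumes "\<sigma> \<in>\<^sub>M funs (sq omega) omega" "x \<in>\<^sub>M cantor"
  shows "\<exists>z. is_run e \<sigma> x z"
proof -
  let ?t = "\<lambda>h. if (par (len h) = emp) = e then \<sigma> \<bullet> h else x \<bullet> half (len h)"
  have 1: "tm (\<lambda>s. ?t (s 0))" by (intro fos)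
  have 2: "?t h \<in>\<^sub>M omega" if "h \<in>\<^sub>M sq omega" for h
    using ap_type[OF assms(1) that] sq_len(1)[OF that] assms(2) by simp
  obtain z where z: "z \<in>\<^sub>M funs omega omega" "\<And>n. n \<in>\<^sub>M omega \<Longrightarrow> z \<bullet> n = ?t (rs z n)"
    using ex_run[of ?t omega, OF 1 2] by metis
  moreover have "len (rs z n) = n" if "n \<in>\<^sub>M omega" for n
    using rs_seq[OF z(1) that] by (rule len_eq)
  ultimately show ?thesis unfolding is_run_def by (metis (no_types, lifting))
qed

text \<open>The strategy's moves before \<open>p\<close> are themselves forced by the opposing moves
  before \<open>p\<close>, so by induction the two histories coincide.\<close>

lemma run_agree:
  assumes "is_run e \<sigma> x z" "is_run e \<sigma> x' z'" "p \<in>\<^sub>M omega" "(par p = emp) = e"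
    "\<And>n. n \<in>\<^sub>M p \<Longrightarrow> (par n = emp) \<noteq> e \<Longrightarrow> x \<bullet> half n = x' \<bullet> half n"
  shows "z \<bullet> p = z' \<bullet> p"
proof -
  have "n \<in>\<^sub>M osucc p \<longrightarrow> rs z n = rs z' n" if "n \<in>\<^sub>M omega" for n
    using that
  proof (induction rule: nat_induct)
    case emp
    show ?case by (simp add: rs_eq_iff)
  next
    case (osucc n)
    show ?case
    proof
      assume "osucc n \<in>\<^sub>M osucc p"
      then have n: "n \<in>\<^sub>M p" by (simp only: osucc_mem_osucc[OF assms(3)])
      then have rs: "rs z n = rs z' n" using osucc by simp
      have "z \<bullet> n = z' \<bullet> n"
      proof (cases "(par n = emp) = e")
        case True
        then show ?thesis using assms(1,2) osucc(1) rs unfolding is_run_def by metis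
      next
        case False
        then show ?thesis using assms(1,2) assms(5)[OF n] osucc(1) unfolding is_run_def by metis
      qed
      then show "rs z (osucc n) = rs z' (osucc n)" using rs unfolding rs_eq_iff mem_osucc by blast
    qed
  qed (intro fos)
  then have "rs z p = rs z' p" using assms(3) by simp
  then show ?thesis using assms(1-4) unfolding is_run_def by metis
qed

lemma half_mem_iff:
  assumes "m \<in>\<^sub>M omega" "n \<in>\<^sub>M omega"
  shows "half n \<in>\<^sub>M m \<longleftrightarrow> n \<in>\<^sub>M dbl m"
proof -
  have *: "half n = m \<longleftrightarrow> n = dbl m \<or> n = osucc (dbl m)" if "m \<in>\<^sub>M omega" for m
    using dbl_half[OF assms(2)] that by (metis half_dbl half_osucc par_dbl dbl_omega)
  show ?thesis
    using assms(1) by (induction rule: nat_induct) ((intro fos)?; simp add: *; blast?)+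
qed

text \<open>Here \<open>p m\<close> is the position of the m-th move of \<open>\<sigma>\<close> and
  \<open>g m\<close> the number of opposing moves before it. The bit of \<open>s\<close> at k
  records whether some run with code k makes a nonzero move there. By \<open>K_inject\<close> the
  code determines m and the opposing bits seen so far, and by \<open>run_agree\<close> all runs with
  this code give the same answer.\<close>

lemma strategy_code:
  assumes \<sigma>: "\<sigma> \<in>\<^sub>M funs (sq omega) omega"
    and g: "\<And>a. tm a \<Longrightarrow> tm (\<lambda>s. g (a s))" "\<And>m. m \<in>\<^sub>M omega \<Longrightarrow> g m \<in>\<^sub>M omega"
      "\<And>m n. m \<in>\<^sub>M omega \<Longrightarrow> n \<in>\<^sub>M omega \<Longrightarrow> g m = g n \<Longrightarrow> m = n"
    and p: "\<And>a. tm a \<Longrightarrow> tm (\<lambda>s. p (a s))" "\<And>m. m \<in>\<^sub>M omega \<Longrightarrow> p m \<in>\<^sub>M omega"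
      "\<And>m. m \<in>\<^sub>M omega \<Longrightarrow> (par (p m) = emp) = e"
    and gp: "\<And>m n. m \<in>\<^sub>M omega \<Longrightarrow> n \<in>\<^sub>M p m \<Longrightarrow> (par n = emp) \<noteq> e \<Longrightarrow> half n \<in>\<^sub>M g m"
  obtains s where "s \<in>\<^sub>M cantor"
    "\<And>x z m. x \<in>\<^sub>M cantor \<Longrightarrow> is_run e \<sigma> x z \<Longrightarrow> m \<in>\<^sub>M omega \<Longrightarrow>
      s \<bullet> K x (g m) = (if z \<bullet> p m = emp then emp else one)"
proof -
  define R where "R k \<longleftrightarrow> (\<exists>x z m. x \<in>\<^sub>M cantor \<and> is_run e \<sigma> x z \<and> m \<in>\<^sub>M omega \<and>
     k = K x (g m) \<and> z \<bullet> p m \<noteq> emp)" for k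
  define s where "s = lam omega (\<lambda>k. if R k then one else emp)"
  have tm_s: "tm (\<lambda>s. if R (s 0) then one else emp)"
    unfolding R_def is_run_def by (intro fos g(1) p(1))
  have "s \<in>\<^sub>M cantor" unfolding s_def by (intro lam_cantor tm_s) simp
  moreover have "s \<bullet> K x (g m) = (if z \<bullet> p m = emp then emp else one)"
    if x: "x \<in>\<^sub>M cantor" and z: "is_run e \<sigma> x z" and m: "m \<in>\<^sub>M omega" for x z m
  proof -
    have "R (K x (g m)) \<longleftrightarrow> z \<bullet> p m \<noteq> emp"
    proof
      assume "R (K x (g m))"
      then obtain x' z' m' where *: "x' \<in>\<^sub>M cantor" "is_run e \<sigma> x' z'" "m' \<in>\<^sub>M omega"
        "K x (g m) = K x' (g m')" "z' \<bullet> p m' \<noteq> emp"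
        unfolding R_def by blast
      have gm: "g m = g m'" and agree: "\<And>i. i \<in>\<^sub>M g m \<Longrightarrow> x \<bullet> i = x' \<bullet> i"
        using K_inject[OF g(2)[OF m] g(2)[OF *(3)] x *(1,4)] by blast+
      have "m = m'" using g(3)[OF m *(3) gm] .
      have "z \<bullet> p m = z' \<bullet> p m"
        by (rule run_agree[OF z *(2) p(2)[OF m] p(3)[OF m]]) (rule agree[OF gp[OF m]])
      then show "z \<bullet> p m \<noteq> emp" using *(5) \<open>m = m'\<close> by simp
    next
      assume "z \<bullet> p m \<noteq> emp"
      then show "R (K x (g m))" unfolding R_def using x z m by blast
    qed
    then show ?thesis
      unfolding s_def using ap_lam[OF tm_s K_omega[OF g(2)[OF m]]] by simp
  qed
  ultimately show ?thesis using that by blast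
qed

lemma AD_cases:
  assumes AD "fo (\<lambda>s. P (s 0))"
  obtains (I) \<sigma> where "\<sigma> \<in>\<^sub>M funs (sq omega) omega"
      "\<And>x. x \<in>\<^sub>M funs omega omega \<Longrightarrow>
        (\<And>n. n \<in>\<^sub>M omega \<Longrightarrow> par n = emp \<Longrightarrow> x \<bullet> n = \<sigma> \<bullet> rs x n) \<Longrightarrow> P x"
  | (II) \<tau> where "\<tau> \<in>\<^sub>M funs (sq omega) omega"
      "\<And>x. x \<in>\<^sub>M funs omega omega \<Longrightarrow>
        (\<And>n. n \<in>\<^sub>M omega \<Longrightarrow> par n \<noteq> emp \<Longrightarrow> x \<bullet> n = \<tau> \<bullet> rs x n) \<Longrightarrow> \<not> P x"
proof -
  let ?A = "sep (funs omega omega) P"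
  have A: "x \<in>\<^sub>M ?A \<longleftrightarrow> x \<in>\<^sub>M funs omega omega \<and> P x" for x by (rule mem_sep[OF assms(2)])
  have "strategies = funs (sq omega) omega"
  proof -
    have "the_set (\<lambda>s. \<exists>n \<in> elts omega. s \<in>\<^sub>M funs n omega) = sq omega"
      by (rule the_set_eqI) (auto simp: mem_sq)
    then show ?thesis unfolding strategies_def by simp
  qed
  note state = this
  have conv: "x \<cdot> n = \<sigma> \<cdot> restr x n \<longleftrightarrow> x \<bullet> n = \<sigma> \<bullet> rs x n"
    if "\<sigma> \<in>\<^sub>M funs (sq omega) omega" "x \<in>\<^sub>M funs omega omega" "n \<in>\<^sub>M omega" for \<sigma> x n
  proof -
    have "rs x n \<in>\<^sub>M sq omega" using rs_seq[OF that(2,3)] that(3) by (auto simp: mem_sq)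
    then show ?thesis
      using app_eq_ap[OF that(2,3)] app_eq_ap[OF that(1)] restr_eq_rs[OF that(2,3)] by simp
  qed
  have "?A \<subseteq>\<^sub>M funs omega omega" by (simp add: subset_def A)
  then consider "I_wins ?A" | "II_wins ?A" using assms(1) unfolding AD_def by blast
  then show ?thesis
  proof cases
    case 1
    then obtain \<sigma> where *: "\<sigma> \<in>\<^sub>M funs (sq omega) omega" "\<And>x. x \<in>\<^sub>M funs omega omega \<Longrightarrow>
      (\<And>n. n \<in>\<^sub>M omega \<Longrightarrow> n \<in>\<^sub>M evens \<Longrightarrow> x \<cdot> n = \<sigma> \<cdot> restr x n) \<Longrightarrow> x \<in>\<^sub>M ?A"
      unfolding I_wins_def state by auto
    show ?thesis by (rule I[OF *(1)]) (use *(2) conv[OF *(1)] mem_evens A in blast)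
  next
    case 2
    then obtain \<sigma> where *: "\<sigma> \<in>\<^sub>M funs (sq omega) omega" "\<And>x. x \<in>\<^sub>M funs omega omega \<Longrightarrow>
      (\<And>n. n \<in>\<^sub>M omega \<Longrightarrow> \<not> n \<in>\<^sub>M evens \<Longrightarrow> x \<cdot> n = \<sigma> \<cdot> restr x n) \<Longrightarrow> \<not> x \<in>\<^sub>M ?A"
      unfolding II_wins_def state by auto
    show ?thesis by (rule II[OF *(1)]) (use *(2) conv[OF *(1)] mem_evens A in blast)
  qed
qed

text \<open>AD is applied to the payoff \<open>P (bit z)\<close>. Against an opponent who plays
  bits, only the zero or nonzero behaviour of the winning strategy matters, and this is a function
  of the opposing bits; so the strategy can be replaced by a real.\<close>

lemma binary_AD:
  assumes AD "fo (\<lambda>s. P (s 0))"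
  obtains (I) s where "s \<in>\<^sub>M cantor" "\<And>x. x \<in>\<^sub>M cantor \<Longrightarrow> P (playI s x)"
  | (II) s where "s \<in>\<^sub>M cantor" "\<And>x. x \<in>\<^sub>M cantor \<Longrightarrow> \<not> P (playII s x)"
proof -
  have P': "fo (\<lambda>s. P (bit (s 0)))"
  proof -
    have "fo (\<lambda>s. \<exists>b. b = bit (s 0) \<and> P b)"
      by (intro fos assms(2))
    then show ?thesis by simp
  qed
  show ?thesis
  proof (rule AD_cases[OF assms(1) P'])
    fix \<sigma>
    assume \<sigma>: "\<sigma> \<in>\<^sub>M funs (sq omega) omega" and win: "\<And>x. x \<in>\<^sub>M funs omega omega \<Longrightarrow>
        (\<And>n. n \<in>\<^sub>M omega \<Longrightarrow> par n = emp \<Longrightarrow> x \<bullet> n = \<sigma> \<bullet> rs x n) \<Longrightarrow> P (bit x)"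
    obtain s where s: "s \<in>\<^sub>M cantor"
      "\<And>x z m. x \<in>\<^sub>M cantor \<Longrightarrow> is_run True \<sigma> x z \<Longrightarrow> m \<in>\<^sub>M omega \<Longrightarrow>
        s \<bullet> K x m = (if z \<bullet> dbl m = emp then emp else one)"
    proof (rule strategy_code[OF \<sigma>, of "\<lambda>m. m" dbl True])
      fix m n
      assume "m \<in>\<^sub>M omega" "n \<in>\<^sub>M dbl m"
      then show "half n \<in>\<^sub>M m"
        using half_mem_iff[of m n] nat_trans(1)[of "dbl m" n] by simp
    qed (auto intro: fos)
    have "P (playI s x)" if x: "x \<in>\<^sub>M cantor" for x
    proof -
      obtain z where z: "is_run True \<sigma> x z" using is_run_ex[OF \<sigma> x] by blast
      have "bit z = playI s x"
      proof (rule cantor_ext)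
        fix n assume n: "n \<in>\<^sub>M omega"
        show "bit z \<bullet> n = playI s x \<bullet> n"
        proof (cases "par n = emp")
          case True
          then show ?thesis
            using n s(2)[OF x z, of "half n"] by (simp add: bit_ap playI_def join_ap resp_ap dbl_half)
        next
          case False
          then have "z \<bullet> n = x \<bullet> half n" using z n unfolding is_run_def by simp
          then show ?thesis using False n cantor_two[OF x, of "half n"] by (auto simp: bit_ap playI_def join_ap)
        qed
      qed (use s(1) x in \<open>simp_all add: playI_def\<close>)
      moreover have "P (bit z)" using win z unfolding is_run_def by simp
      ultimately show ?thesis by simp
    qed
    then show ?thesis using I s(1) by blast
  next
    fix \<sigma>
    assume \<sigma>: "\<sigma> \<in>\<^sub>M funs (sq omega) omega" and win: "\<And>x. x \<in>\<^sub>M funs omega omega \<Longrightarrow>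
        (\<And>n. n \<in>\<^sub>M omega \<Longrightarrow> par n \<noteq> emp \<Longrightarrow> x \<bullet> n = \<sigma> \<bullet> rs x n) \<Longrightarrow> \<not> P (bit x)"
    obtain s where s: "s \<in>\<^sub>M cantor"
      "\<And>x z m. x \<in>\<^sub>M cantor \<Longrightarrow> is_run False \<sigma> x z \<Longrightarrow> m \<in>\<^sub>M omega \<Longrightarrow>
        s \<bullet> K x (osucc m) = (if z \<bullet> osucc (dbl m) = emp then emp else one)"
    proof (rule strategy_code[OF \<sigma>, of osucc "\<lambda>m. osucc (dbl m)" False])
      fix m n
      assume m: "m \<in>\<^sub>M omega" and n: "n \<in>\<^sub>M osucc (dbl m)"
      then have "n \<in>\<^sub>M dbl (osucc m)" by auto
      then show "half n \<in>\<^sub>M osucc m"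
        using half_mem_iff[of "osucc m" n] m nat_trans(1)[of "dbl (osucc m)" n] by simp
    qed (auto intro: fos)
    have "\<not> P (playII s x)" if x: "x \<in>\<^sub>M cantor" for x
    proof -
      obtain z where z: "is_run False \<sigma> x z" using is_run_ex[OF \<sigma> x] by blast
      have "bit z = playII s x"
      proof (rule cantor_ext)
        fix n assume n: "n \<in>\<^sub>M omega"
        show "bit z \<bullet> n = playII s x \<bullet> n"
        proof (cases "par n = emp")
          case False
          then show ?thesis
            using n s(2)[OF x z, of "half n"]
            by (simp add: bit_ap playII_def join_ap resp_ap shift_ap dbl_half del: K_osucc)
        next
          case True
          then have "z \<bullet> n = x \<bullet> half n" using z n unfolding is_run_def by simp
          then show ?thesis using True n cantor_two[OF x, of "half n"] by (auto simp: bit_ap playII_def join_ap)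
        qed
      qed (use s(1) x in \<open>simp_all add: playII_def\<close>)
      moreover have "\<not> P (bit z)" using win z unfolding is_run_def by simp
      ultimately show ?thesis by simp
    qed
    then show ?thesis using II s(1) by blast
  qed
qed

end

section \<open>Countability, closures of reals and genericity\<close>

context set_structure
begin

text \<open>The substitute for choice on a set that \<open>c\<close> maps injectively to \<omega>:
  the candidate with the least code. Exactly one q satisfies the condition when there is a
  candidate, so the union returns it.\<close>

definition pick :: "'a \<Rightarrow> 'a \<Rightarrow> ('a \<Rightarrow> bool) \<Rightarrow> 'a" where
  "pick S c P = the_set (\<lambda>z. \<exists>q. q \<in>\<^sub>M S \<and> P q \<and>
     (\<forall>r. r \<in>\<^sub>M S \<longrightarrow> P r \<longrightarrow> \<not> c \<bullet> r \<in>\<^sub>M c \<bullet> q) \<and> z \<in>\<^sub>M q)"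

definition pfst :: "'a \<Rightarrow> 'a" where
  "pfst p = the_set (\<lambda>z. \<exists>a b. p = \<langle>a, b\<rangle> \<and> z \<in>\<^sub>M a)"

definition psnd :: "'a \<Rightarrow> 'a" where
  "psnd p = the_set (\<lambda>z. \<exists>a b. p = \<langle>a, b\<rangle> \<and> z \<in>\<^sub>M b)"

text \<open>A single operation with a numerical index lets the closure be generated by one
  recursion. \<open>evn\<close> and \<open>odds\<close> recover the parts of joins and plays,
  \<open>shift\<close> serves the second player's replies and the removal of a bit,
  \<open>zero\<close> is the initial state. The identity at all further indices makes the stages of
  the closure increase.\<close>

definition oper :: "'a \<Rightarrow> 'a \<Rightarrow> 'a \<Rightarrow> 'a" where
  "oper i x y =
     (if i = emp then join x y
      else if i = one then resp x y
      else if i = two then evn x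
      else if i = osucc two then odds x
      else if i = osucc (osucc two) then shift x
      else if i = osucc (osucc (osucc two)) then zero
      else x)"

definition closed :: "'a \<Rightarrow> bool" where
  "closed E \<longleftrightarrow> E \<subseteq>\<^sub>M cantor \<and>
     (\<forall>i x y. i \<in>\<^sub>M omega \<longrightarrow> x \<in>\<^sub>M E \<longrightarrow> y \<in>\<^sub>M E \<longrightarrow> oper i x y \<in>\<^sub>M E)"

definition clo :: "'a \<Rightarrow> 'a" where
  "clo x = sep cantor (\<lambda>y. \<forall>E. closed E \<longrightarrow> x \<in>\<^sub>M E \<longrightarrow> y \<in>\<^sub>M E)"

text \<open>Inclusion of finite functions is extension of sequences. So \<open>U\<close> presents a
  dense open subset of the space of infinite sequences over \<open>Y\<close> by a set of finite
  sequences closed under extension.\<close>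

definition dense_open :: "'a \<Rightarrow> 'a \<Rightarrow> bool" where
  "dense_open Y U \<longleftrightarrow> U \<subseteq>\<^sub>M sq Y \<and>
     (\<forall>p. p \<in>\<^sub>M sq Y \<longrightarrow> (\<exists>q. q \<in>\<^sub>M U \<and> p \<subseteq>\<^sub>M q)) \<and>
     (\<forall>p q. p \<in>\<^sub>M U \<longrightarrow> q \<in>\<^sub>M sq Y \<longrightarrow> p \<subseteq>\<^sub>M q \<longrightarrow> q \<in>\<^sub>M U)"

definition dense_family :: "'a \<Rightarrow> 'a \<Rightarrow> bool" where
  "dense_family Y \<O> \<longleftrightarrow> (\<forall>k. k \<in>\<^sub>M omega \<longrightarrow> dense_open Y (\<O> \<bullet> k))"

definition generic :: "'a \<Rightarrow> 'a \<Rightarrow> 'a \<Rightarrow> bool" where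
  "generic Y \<O> w \<longleftrightarrow> w \<in>\<^sub>M funs omega Y \<and>
     (\<forall>k. k \<in>\<^sub>M omega \<longrightarrow> (\<exists>n. n \<in>\<^sub>M omega \<and> rs w n \<in>\<^sub>M \<O> \<bullet> k))"

end

context ZF_model
begin

subsection \<open>Countable sets\<close>

lemma isset_pick:
  assumes "fo (\<lambda>s. P (s 0))"
  shows "isset (\<lambda>z. \<exists>q. q \<in>\<^sub>M S \<and> P q \<and> (\<forall>r. r \<in>\<^sub>M S \<longrightarrow> P r \<longrightarrow> \<not> c \<bullet> r \<in>\<^sub>M c \<bullet> q) \<and> z \<in>\<^sub>M q)"
proof (rule isset_subset[of _ "Uni S"])
  have 1: "fo (\<lambda>s. P (s n))" for n
    using fo_rename[OF assms, of "\<lambda>i. n + i"] by (simp add: inj_on_def)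
  show "fo (\<lambda>s. \<exists>q. q \<in>\<^sub>M S \<and> P q \<and> (\<forall>r. r \<in>\<^sub>M S \<longrightarrow> P r \<longrightarrow> \<not> c \<bullet> r \<in>\<^sub>M c \<bullet> q) \<and> s 0 \<in>\<^sub>M q)"
    by (intro fos 1)
qed auto

lemma tm_pick [fos]:
  assumes "tm S" "tm c" "fo (\<lambda>s. P (\<lambda>i. s (Suc i)) (s 0))"
  shows "tm (\<lambda>s. pick (S s) (c s) (P s))"
  unfolding pick_def
proof (rule tm_the_setI)
  have 1: "fo (\<lambda>s. P (\<lambda>i. s (Suc (Suc i))) (s 0))"
    by (rule fo_shift1[OF assms(3)])
  have 2: "fo (\<lambda>s. P (\<lambda>i. s (Suc (Suc (Suc i)))) (s 0))"
    by (rule fo_shift1[OF 1])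
  show "fo (\<lambda>s. \<exists>q. q \<in>\<^sub>M S (\<lambda>i. s (Suc i)) \<and> P (\<lambda>i. s (Suc i)) q \<and>
     (\<forall>r. r \<in>\<^sub>M S (\<lambda>i. s (Suc i)) \<longrightarrow> P (\<lambda>i. s (Suc i)) r \<longrightarrow> \<not> c (\<lambda>i. s (Suc i)) \<bullet> r \<in>\<^sub>M c (\<lambda>i. s (Suc i)) \<bullet> q) \<and>
     s 0 \<in>\<^sub>M q)"
    by (intro fo_ex fo_all fo_conj fo_imp fo_not fo_mem tm_ap tm_var 1 2
        tm_shift[OF tm_shift[OF assms(1)]] tm_shift[OF tm_shift[OF tm_shift[OF assms(1)]]]
        tm_shift[OF tm_shift[OF tm_shift[OF assms(2)]]])
  show "isset (\<lambda>z. \<exists>q. q \<in>\<^sub>M S s \<and> P s q \<and> (\<forall>r. r \<in>\<^sub>M S s \<longrightarrow> P s r \<longrightarrow> \<not> c s \<bullet> r \<in>\<^sub>M c s \<bullet> q) \<and> z \<in>\<^sub>M q)" for s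
    by (rule isset_pick) (rule fo_inst[OF assms(3)])
qed

lemma pick:
  assumes c: "ctb S c" and P: "fo (\<lambda>s. P (s 0))" and q: "q \<in>\<^sub>M S" "P q"
  shows "pick S c P \<in>\<^sub>M S" "P (pick S c P)"
    "\<And>r. r \<in>\<^sub>M S \<Longrightarrow> P r \<Longrightarrow> \<not> c \<bullet> r \<in>\<^sub>M c \<bullet> pick S c P"
proof -
  have ty: "c \<bullet> r \<in>\<^sub>M omega" if "r \<in>\<^sub>M S" for r
    using c that ap_type[of c S omega r] unfolding ctb_def by blast
  have "fo (\<lambda>s. \<exists>r. r \<in>\<^sub>M S \<and> P r \<and> s 0 = c \<bullet> r)"
    by (intro fos) (use P fo_shift1[of "\<lambda>x s. P x"] in simp)
  then obtain m where m: "\<exists>r. r \<in>\<^sub>M S \<and> P r \<and> m = c \<bullet> r"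
    "\<And>k. k \<in>\<^sub>M m \<Longrightarrow> \<not> (\<exists>r. r \<in>\<^sub>M S \<and> P r \<and> k = c \<bullet> r)"
    by (rule nat_least[of "\<lambda>m. \<exists>r. r \<in>\<^sub>M S \<and> P r \<and> m = c \<bullet> r" "c \<bullet> q"]) (use q ty in blast)+
  then obtain r where r: "r \<in>\<^sub>M S" "P r" "\<And>r'. r' \<in>\<^sub>M S \<Longrightarrow> P r' \<Longrightarrow> \<not> c \<bullet> r' \<in>\<^sub>M c \<bullet> r" by blast
  have uniq: "r' = r" if "r' \<in>\<^sub>M S" "P r'" "\<And>u. u \<in>\<^sub>M S \<Longrightarrow> P u \<Longrightarrow> \<not> c \<bullet> u \<in>\<^sub>M c \<bullet> r'" for r'
  proof -
    have "c \<bullet> r' = c \<bullet> r"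
      using nat_trichotomy[OF ty[OF that(1)] ty[OF r(1)]] r that by blast
    then show ?thesis using c that(1) r(1) unfolding ctb_def by blast
  qed
  have "pick S c P = r"
    unfolding pick_def by (rule the_set_eqI) (use r uniq in blast)
  then show "pick S c P \<in>\<^sub>M S" "P (pick S c P)"
    "\<And>r. r \<in>\<^sub>M S \<Longrightarrow> P r \<Longrightarrow> \<not> c \<bullet> r \<in>\<^sub>M c \<bullet> pick S c P" using r by auto
qed

lemma ctb_lam:
  assumes "tm (\<lambda>s. t (s 0))" "\<And>x. x \<in>\<^sub>M A \<Longrightarrow> t x \<in>\<^sub>M omega"
    "\<And>x y. x \<in>\<^sub>M A \<Longrightarrow> y \<in>\<^sub>M A \<Longrightarrow> t x = t y \<Longrightarrow> x = y"
  shows "ctb A (lam A t)"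
  unfolding ctb_def using lam_funs[OF assms(1,2), of A] ap_lam[OF assms(1), of _ A] assms(3) by metis

lemma ctb_subset: "ctb A c \<Longrightarrow> B \<subseteq>\<^sub>M A \<Longrightarrow> \<exists>c. ctb B c"
proof -
  assume *: "ctb A c" "B \<subseteq>\<^sub>M A"
  have "ctb B (lam B (\<lambda>x. c \<bullet> x))"
    using * ap_type[of c A omega] by (intro ctb_lam fos) (auto simp: ctb_def subset_def)
  then show ?thesis by blast
qed

lemma ctb_omega: "ctb omega (lam omega (\<lambda>n. n))"
  by (intro ctb_lam fos)

lemma ctb_surj:
  assumes f: "tm (\<lambda>s. f (s 0))" and E: "\<And>z. z \<in>\<^sub>M E \<Longrightarrow> \<exists>q. q \<in>\<^sub>M omega \<and> z = f q"
  shows "\<exists>c. ctb E c"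
proof -
  let ?c = "\<lambda>z. pick omega (lam omega (\<lambda>n. n)) (\<lambda>q. z = f q)"
  have 1: "?c z \<in>\<^sub>M omega" "z = f (?c z)" if z: "z \<in>\<^sub>M E" for z
  proof -
    obtain q where q: "q \<in>\<^sub>M omega" "z = f q" using E[OF z] by blast
    have "fo (\<lambda>s. z = f (s 0))" by (intro fos f)
    from pick[OF ctb_omega this q] show "?c z \<in>\<^sub>M omega" "z = f (?c z)" by blast+
  qed
  have "tm (\<lambda>s. ?c (s 0))" by (intro fos f)
  then have "ctb E (lam E ?c)"
    using 1 by (intro ctb_lam) metis+
  then show ?thesis by blast
qed

lemma ctb_sq: "ctb Y c \<Longrightarrow> ctb (sq Y) (lam (sq Y) (\<lambda>s. sqcode c s))"
  by (intro ctb_lam fos) (auto intro: sqcode)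

lemma isset_pfst: "isset (\<lambda>z. \<exists>a b. p = \<langle>a, b\<rangle> \<and> z \<in>\<^sub>M a)"
  and isset_psnd: "isset (\<lambda>z. \<exists>a b. p = \<langle>a, b\<rangle> \<and> z \<in>\<^sub>M b)"
proof -
  have "isset (\<lambda>z. \<exists>a b. p = \<langle>a, b\<rangle> \<and> z \<in>\<^sub>M a) \<and> isset (\<lambda>z. \<exists>a b. p = \<langle>a, b\<rangle> \<and> z \<in>\<^sub>M b)"
  proof (cases "\<exists>a b. p = \<langle>a, b\<rangle>")
    case True
    then obtain a b where p: "p = \<langle>a, b\<rangle>" by blast
    show ?thesis using isset_mem[of a] isset_mem[of b] unfolding p by simp
  qed (auto simp: isset_def intro!: exI[of _ emp])
  then show "isset (\<lambda>z. \<exists>a b. p = \<langle>a, b\<rangle> \<and> z \<in>\<^sub>M a)" "isset (\<lambda>z. \<exists>a b. p = \<langle>a, b\<rangle> \<and> z \<in>\<^sub>M b)" by auto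
qed

lemma tm_pfst [fos]: "tm k \<Longrightarrow> tm (\<lambda>s. pfst (k s))" and tm_psnd [fos]: "tm k \<Longrightarrow> tm (\<lambda>s. psnd (k s))"
  unfolding pfst_def psnd_def
  by ((rule tm_the_setI; (intro fos tm_shift isset_pfst isset_psnd | assumption)+)+)

lemma pfst_opair [simp]: "pfst \<langle>a, b\<rangle> = a" and psnd_opair [simp]: "psnd \<langle>a, b\<rangle> = b"
  unfolding pfst_def psnd_def by (auto intro: the_set_eqI)

lemma ctb_cart:
  assumes "ctb B c"
  shows "\<exists>d. ctb (cart omega B) d"
proof -
  have "ctb (cart omega B) (lam (cart omega B) (\<lambda>p. J (pfst p) (c \<bullet> psnd p)))"
  proof (intro ctb_lam fos)
    show "J (pfst p) (c \<bullet> psnd p) \<in>\<^sub>M omega" if "p \<in>\<^sub>M cart omega B" for p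
      using that assms ap_type[of c B omega] unfolding ctb_def by auto
    show "p = q" if p: "p \<in>\<^sub>M cart omega B" and q: "q \<in>\<^sub>M cart omega B"
      and eq: "J (pfst p) (c \<bullet> psnd p) = J (pfst q) (c \<bullet> psnd q)" for p q
    proof -
      obtain a b where p: "p = \<langle>a, b\<rangle>" "a \<in>\<^sub>M omega" "b \<in>\<^sub>M B" using p by auto
      obtain a' b' where q: "q = \<langle>a', b'\<rangle>" "a' \<in>\<^sub>M omega" "b' \<in>\<^sub>M B" using q by auto
      have "c \<bullet> b \<in>\<^sub>M omega" "c \<bullet> b' \<in>\<^sub>M omega"
        using assms p q ap_type[of c B omega] unfolding ctb_def by auto
      then have "a = a'" "c \<bullet> b = c \<bullet> b'" using eq p q J_inject[of a "c \<bullet> b" a' "c \<bullet> b'"] by simp_all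
      then show ?thesis using assms p q unfolding ctb_def by simp
    qed
  qed
  then show ?thesis by blast
qed

subsection \<open>Countable closed sets of reals\<close>

lemma tm_oper [fos]: "tm i \<Longrightarrow> tm x \<Longrightarrow> tm y \<Longrightarrow> tm (\<lambda>s. oper (i s) (x s) (y s))"
  unfolding oper_def by (intro fos | assumption)+

lemma fo_closed [fos]: "tm E \<Longrightarrow> fo (\<lambda>s. closed (E s))"
  unfolding closed_def by (intro fos tm_shift | assumption)+

lemma tm_clo [fos]: "tm x \<Longrightarrow> tm (\<lambda>s. clo (x s))"
  unfolding clo_def by (intro fos tm_shift | assumption)+

lemma oper_cantor: "x \<in>\<^sub>M cantor \<Longrightarrow> y \<in>\<^sub>M cantor \<Longrightarrow> oper i x y \<in>\<^sub>M cantor"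
  unfolding oper_def by simp

lemma closedD:
  assumes "closed E" "x \<in>\<^sub>M E"
  shows "x \<in>\<^sub>M cantor" "y \<in>\<^sub>M E \<Longrightarrow> join x y \<in>\<^sub>M E" "y \<in>\<^sub>M E \<Longrightarrow> resp x y \<in>\<^sub>M E"
    "evn x \<in>\<^sub>M E" "odds x \<in>\<^sub>M E" "shift x \<in>\<^sub>M E" "zero \<in>\<^sub>M E"
proof -
  have op: "oper i x y \<in>\<^sub>M E" if "i \<in>\<^sub>M omega" "y \<in>\<^sub>M E" for i y
    using assms that unfolding closed_def by blast
  show "x \<in>\<^sub>M cantor" using assms unfolding closed_def subset_def by blast
  show "join x y \<in>\<^sub>M E" "resp x y \<in>\<^sub>M E" if "y \<in>\<^sub>M E"
    using op[of emp, OF _ that] op[of one, OF _ that] by (simp_all add: oper_def)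
  show "evn x \<in>\<^sub>M E" "odds x \<in>\<^sub>M E" "shift x \<in>\<^sub>M E" "zero \<in>\<^sub>M E"
    using op[of two, OF _ assms(2)] op[of "osucc two", OF _ assms(2)]
      op[of "osucc (osucc two)", OF _ assms(2)] op[of "osucc (osucc (osucc two))", OF _ assms(2)]
    by (simp_all add: oper_def two_def one_def)
qed

lemma mem_clo: "y \<in>\<^sub>M clo x \<longleftrightarrow> y \<in>\<^sub>M cantor \<and> (\<forall>E. closed E \<longrightarrow> x \<in>\<^sub>M E \<longrightarrow> y \<in>\<^sub>M E)"
  unfolding clo_def by (rule mem_sep) (intro fos)

lemma clo_self: "x \<in>\<^sub>M cantor \<Longrightarrow> x \<in>\<^sub>M clo x"
  by (simp add: mem_clo)

lemma closed_clo: "closed (clo x)"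
  unfolding closed_def
proof (intro conjI allI impI)
  show "clo x \<subseteq>\<^sub>M cantor" by (simp add: subset_def mem_clo)
  fix i y z
  assume "i \<in>\<^sub>M omega" "y \<in>\<^sub>M clo x" "z \<in>\<^sub>M clo x"
  then show "oper i y z \<in>\<^sub>M clo x"
    by (auto simp: mem_clo closed_def intro: oper_cantor)
qed

lemma clo_mono: "x \<in>\<^sub>M clo y \<Longrightarrow> z \<in>\<^sub>M clo x \<Longrightarrow> z \<in>\<^sub>M clo y"
  using closed_clo[of y] unfolding mem_clo[of z x] by blast

lemma clo_eqI: "x \<in>\<^sub>M clo y \<Longrightarrow> y \<in>\<^sub>M clo x \<Longrightarrow> clo x = clo y"
  by (rule ext) (blast intro: clo_mono)

text \<open>The play is a join formed from \<open>resp s x\<close> and \<open>x\<close>, and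
  \<open>x\<close> is its odd half. Closures thus take the place that Turing degrees have in
  Martin's cone theorem.\<close>

lemma playI_clo: "s \<in>\<^sub>M clo x \<Longrightarrow> x \<in>\<^sub>M cantor \<Longrightarrow> clo (playI s x) = clo x"
proof (rule clo_eqI)
  assume *: "s \<in>\<^sub>M clo x" "x \<in>\<^sub>M cantor"
  then have s: "s \<in>\<^sub>M cantor" by (simp add: mem_clo)
  show "playI s x \<in>\<^sub>M clo x"
    unfolding playI_def by (intro closedD(2,3)[OF closed_clo] clo_self *)
  have "playI s x \<in>\<^sub>M cantor" using s * by (simp add: playI_def)
  then have "odds (playI s x) \<in>\<^sub>M clo (playI s x)"
    using closedD(5)[OF closed_clo clo_self] by blast
  then show "x \<in>\<^sub>M clo (playI s x)" using s * by (simp add: playI_def)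
qed

lemma playII_clo: "s \<in>\<^sub>M clo x \<Longrightarrow> x \<in>\<^sub>M cantor \<Longrightarrow> clo (playII s x) = clo x"
proof (rule clo_eqI)
  assume *: "s \<in>\<^sub>M clo x" "x \<in>\<^sub>M cantor"
  then have s: "s \<in>\<^sub>M cantor" by (simp add: mem_clo)
  show "playII s x \<in>\<^sub>M clo x"
    unfolding playII_def by (intro closedD(2,3,6)[OF closed_clo] clo_self *)
  have "playII s x \<in>\<^sub>M cantor" using s * by (simp add: playII_def)
  then have "evn (playII s x) \<in>\<^sub>M clo (playII s x)"
    using closedD(4)[OF closed_clo clo_self] by blast
  then show "x \<in>\<^sub>M clo (playII s x)" using s * by (simp add: playII_def)
qed

text \<open>A countable union of countable sets would require choosing enumerations. Here the
  enumeration \<open>G n\<close> of the n-th stage is itself the value of a recursion: entry k of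
  the next stage applies the operation with index \<open>J1 k\<close> to two entries of the present
  one, whose places are coded in \<open>J2 k\<close>.\<close>

lemma ctb_clo:
  assumes x: "x \<in>\<^sub>M cantor"
  shows "\<exists>c. ctb (clo x) c"
proof -
  define F where "F g = lam omega (\<lambda>k. oper (J1 k) (g \<bullet> J1 (J2 k)) (g \<bullet> J2 (J2 k)))" for g
  define G where "G n = nrec (lam omega (\<lambda>k. x)) (\<lambda>i g. F g) n" for n
  have tm_F: "tm (\<lambda>s. F (a s))" if "tm a" for a
    unfolding F_def by (intro fos tm_shift that)
  have tm_G: "tm (\<lambda>s. G (a s))" if "tm a" for a
    unfolding G_def by (intro fos tm_F that)
  have G: "G emp = lam omega (\<lambda>k. x)" "n \<in>\<^sub>M omega \<Longrightarrow> G (osucc n) = F (G n)" for n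
    unfolding G_def by ((rule nrec_emp nrec_osucc; (intro fos tm_F | assumption)+)+)
  have F: "F g \<bullet> k = oper (J1 k) (g \<bullet> J1 (J2 k)) (g \<bullet> J2 (J2 k))" if "k \<in>\<^sub>M omega" for g k
    unfolding F_def using that by (intro ap_lam fos)
  have GC: "G n \<bullet> k \<in>\<^sub>M cantor" if "n \<in>\<^sub>M omega" "k \<in>\<^sub>M omega" for n k
  proof -
    have "\<forall>k. k \<in>\<^sub>M omega \<longrightarrow> G n \<bullet> k \<in>\<^sub>M cantor"
      using that(1)
    proof (induction rule: nat_induct)
      case emp
      have "lam omega (\<lambda>k. x) \<bullet> k = x" if "k \<in>\<^sub>M omega" for k
        using that by (intro ap_lam fos)
      then show ?case using x by (simp add: G)
    next
      case (osucc n)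
      then show ?case by (simp add: G F oper_cantor)
    qed (intro fos tm_G)
    then show ?thesis using that(2) by blast
  qed
  define sub where "sub m n \<longleftrightarrow> (\<forall>k. k \<in>\<^sub>M omega \<longrightarrow> (\<exists>l. l \<in>\<^sub>M omega \<and> G n \<bullet> l = G m \<bullet> k))" for m n
  have step: "sub n (osucc n)" if n: "n \<in>\<^sub>M omega" for n
    unfolding sub_def
  proof (intro allI impI)
    fix k assume k: "k \<in>\<^sub>M omega"
    \<comment> \<open>The number 6, the first index at which \<open>oper\<close> returns its first
      argument.\<close>
    define i where "i = osucc (osucc (osucc (osucc two)))"
    have "oper i u v = u" for u v unfolding oper_def i_def by (simp add: two_def one_def)
    moreover have "i \<in>\<^sub>M omega" by (simp add: i_def)
    ultimately have "J i (J k k) \<in>\<^sub>M omega \<and> G (osucc n) \<bullet> J i (J k k) = G n \<bullet> k"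
      using k n by (simp add: G F)
    then show "\<exists>l. l \<in>\<^sub>M omega \<and> G (osucc n) \<bullet> l = G n \<bullet> k" by blast
  qed
  have sub: "\<forall>m. m \<in>\<^sub>M osucc n \<longrightarrow> sub m n" if "n \<in>\<^sub>M omega" for n
    using that
  proof (induction rule: nat_induct)
    case emp
    show ?case by (auto simp: sub_def)
  next
    case (osucc n)
    have "sub m (osucc n)" if "sub m n" for m
      using that step[OF osucc(1)] unfolding sub_def by metis
    moreover have "sub (osucc n) (osucc n)" by (auto simp: sub_def)
    ultimately show ?case using osucc(2) by auto
  qed (unfold sub_def, intro fos tm_G)
  define E where "E = sep cantor (\<lambda>z. \<exists>q. q \<in>\<^sub>M omega \<and> z = G (J1 q) \<bullet> J2 q)"
  have E: "z \<in>\<^sub>M E \<longleftrightarrow> z \<in>\<^sub>M cantor \<and> (\<exists>q. q \<in>\<^sub>M omega \<and> z = G (J1 q) \<bullet> J2 q)" for z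
    unfolding E_def by (rule mem_sep) (intro fos tm_G)
  have EI: "G n \<bullet> k \<in>\<^sub>M E" if "n \<in>\<^sub>M omega" "k \<in>\<^sub>M omega" for n k
    unfolding E using that GC[OF that] by (intro conjI exI[of _ "J n k"]) auto
  have ED: "\<exists>n k. n \<in>\<^sub>M omega \<and> k \<in>\<^sub>M omega \<and> z = G n \<bullet> k" if "z \<in>\<^sub>M E" for z
    using that unfolding E by (metis J1_omega J2_omega)
  have "closed E"
    unfolding closed_def
  proof (intro conjI allI impI)
    show "E \<subseteq>\<^sub>M cantor" by (simp add: subset_def E)
    fix i y z
    assume i: "i \<in>\<^sub>M omega" and "y \<in>\<^sub>M E" "z \<in>\<^sub>M E"
    then obtain n k m l where *: "n \<in>\<^sub>M omega" "k \<in>\<^sub>M omega" "y = G n \<bullet> k"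
      "m \<in>\<^sub>M omega" "l \<in>\<^sub>M omega" "z = G m \<bullet> l" using ED by metis
    have "\<exists>p. p \<in>\<^sub>M omega \<and> sub n p \<and> sub m p"
      using nat_trichotomy[OF *(1,4)] sub[OF *(1)] sub[OF *(4)] *(1,4) unfolding mem_osucc by metis
    then obtain p k' l' where p: "p \<in>\<^sub>M omega" "k' \<in>\<^sub>M omega" "y = G p \<bullet> k'" "l' \<in>\<^sub>M omega" "z = G p \<bullet> l'"
      unfolding sub_def using * by metis
    have "oper i y z = G (osucc p) \<bullet> J i (J k' l')"
      using p i by (simp add: G F)
    then show "oper i y z \<in>\<^sub>M E" using EI[of "osucc p" "J i (J k' l')"] p i by simp
  qed
  moreover have "x \<in>\<^sub>M E"
  proof -
    have "G emp \<bullet> emp = x" unfolding G by (intro ap_lam fos) simp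
    then show ?thesis using EI[of emp emp] by simp
  qed
  ultimately have "clo x \<subseteq>\<^sub>M E" by (auto simp: subset_def mem_clo)
  moreover have "\<exists>c. ctb E c"
    by (rule ctb_surj[of "\<lambda>q. G (J1 q) \<bullet> J2 q"]) (intro fos tm_G, simp add: E)
  ultimately show ?thesis using ctb_subset by blast
qed

end

context ZF_model
begin

subsection \<open>Finite sequences and generic sequences\<close>

lemma nat_subset_iff: "m \<in>\<^sub>M omega \<Longrightarrow> n \<in>\<^sub>M omega \<Longrightarrow> m \<subseteq>\<^sub>M n \<longleftrightarrow> m \<in>\<^sub>M osucc n"
  using nat_trichotomy[of m n] nat_trans(2)[of n m] mem_irrefl unfolding subset_def mem_osucc by blast

lemma subset_trans: "a \<subseteq>\<^sub>M b \<Longrightarrow> b \<subseteq>\<^sub>M c \<Longrightarrow> a \<subseteq>\<^sub>M c"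
  and subset_refl [simp]: "a \<subseteq>\<^sub>M a" and emp_subset [simp]: "emp \<subseteq>\<^sub>M a"
  by (auto simp: subset_def)

lemma fun_subset_iff:
  assumes "p \<in>\<^sub>M funs m Y" "q \<in>\<^sub>M funs n Z"
  shows "p \<subseteq>\<^sub>M q \<longleftrightarrow> m \<subseteq>\<^sub>M n \<and> (\<forall>i. i \<in>\<^sub>M m \<longrightarrow> p \<bullet> i = q \<bullet> i)"
proof
  assume *: "p \<subseteq>\<^sub>M q"
  have "\<langle>i, p \<bullet> i\<rangle> \<in>\<^sub>M q" if "i \<in>\<^sub>M m" for i
    using * pair_in_fun[OF assms(1)] that unfolding subset_def by blast
  then show "m \<subseteq>\<^sub>M n \<and> (\<forall>i. i \<in>\<^sub>M m \<longrightarrow> p \<bullet> i = q \<bullet> i)"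
    unfolding pair_in_fun[OF assms(2)] subset_def by blast
next
  assume *: "m \<subseteq>\<^sub>M n \<and> (\<forall>i. i \<in>\<^sub>M m \<longrightarrow> p \<bullet> i = q \<bullet> i)"
  show "p \<subseteq>\<^sub>M q"
    unfolding subset_def
  proof (intro allI impI)
    fix x assume x: "x \<in>\<^sub>M p"
    then obtain i y where "x = \<langle>i, y\<rangle>" using assms(1) unfolding mem_funs by blast
    then show "x \<in>\<^sub>M q"
      using x * pair_in_fun[OF assms(1)] pair_in_fun[OF assms(2)] unfolding subset_def by metis
  qed
qed

lemma prefix_iff_rs:
  assumes "p \<in>\<^sub>M funs m Y" "w \<in>\<^sub>M funs n Z" "m \<subseteq>\<^sub>M n"
  shows "p \<subseteq>\<^sub>M w \<longleftrightarrow> rs w m = p"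
proof -
  have "rs p m = p" by (rule rs_id[OF assms(1)])
  then show ?thesis
    using fun_subset_iff[OF assms(1,2)] assms(3) rs_eq_iff[of p m w] by metis
qed

lemma omega_subset: "m \<in>\<^sub>M omega \<Longrightarrow> m \<subseteq>\<^sub>M omega"
  unfolding subset_def using nat_trans(1) by blast

lemma rs_prefix: "w \<in>\<^sub>M funs omega Y \<Longrightarrow> n \<in>\<^sub>M omega \<Longrightarrow> rs w n \<subseteq>\<^sub>M w"
  using prefix_iff_rs[OF rs_seq _ omega_subset] by blast

lemma rs_sq: "w \<in>\<^sub>M funs omega Y \<Longrightarrow> n \<in>\<^sub>M omega \<Longrightarrow> rs w n \<in>\<^sub>M sq Y"
  using rs_seq by (auto simp: mem_sq)

lemma len_rs [simp]: "w \<in>\<^sub>M funs omega Y \<Longrightarrow> n \<in>\<^sub>M omega \<Longrightarrow> len (rs w n) = n"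
  using rs_seq len_eq by blast

lemma len_emp [simp]: "len emp = emp"
  unfolding len_def by (rule the_set_eqI) simp

lemma emp_sq [simp]: "emp \<in>\<^sub>M sq Y"
  unfolding mem_sq by (rule exI[of _ emp]) (simp add: mem_funs)

lemma prefix_len: "p \<in>\<^sub>M sq Y \<Longrightarrow> q \<in>\<^sub>M sq Z \<Longrightarrow> p \<subseteq>\<^sub>M q \<Longrightarrow> len p \<subseteq>\<^sub>M len q"
  using fun_subset_iff[OF sq_len(2) sq_len(2)] by blast

lemma prefix_ap: "p \<in>\<^sub>M sq Y \<Longrightarrow> q \<in>\<^sub>M funs n Z \<Longrightarrow> p \<subseteq>\<^sub>M q \<Longrightarrow> i \<in>\<^sub>M len p \<Longrightarrow> q \<bullet> i = p \<bullet> i"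
  using fun_subset_iff[OF sq_len(2)] by metis

lemma prefix_comparable:
  assumes "p \<in>\<^sub>M sq Y" "q \<in>\<^sub>M sq Y" "p \<subseteq>\<^sub>M w" "q \<subseteq>\<^sub>M w" "w \<in>\<^sub>M funs n Z"
  shows "p \<subseteq>\<^sub>M q \<or> q \<subseteq>\<^sub>M p"
proof -
  have "len p \<subseteq>\<^sub>M len q \<or> len q \<subseteq>\<^sub>M len p"
    using nat_trichotomy[OF sq_len(1)[OF assms(1)] sq_len(1)[OF assms(2)]]
      nat_subset_iff[OF sq_len(1)[OF assms(1)] sq_len(1)[OF assms(2)]]
      nat_subset_iff[OF sq_len(1)[OF assms(2)] sq_len(1)[OF assms(1)]] by auto
  moreover have "p \<bullet> i = w \<bullet> i" if "i \<in>\<^sub>M len p" for i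
    using fun_subset_iff[OF sq_len(2)[OF assms(1)] assms(5)] assms(3) that by blast
  moreover have "q \<bullet> i = w \<bullet> i" if "i \<in>\<^sub>M len q" for i
    using fun_subset_iff[OF sq_len(2)[OF assms(2)] assms(5)] assms(4) that by blast
  ultimately show ?thesis
    unfolding fun_subset_iff[OF sq_len(2)[OF assms(1)] sq_len(2)[OF assms(2)]]
      fun_subset_iff[OF sq_len(2)[OF assms(2)] sq_len(2)[OF assms(1)]]
    by (metis subset_def)
qed

lemma ovr_prefix:
  assumes "s \<in>\<^sub>M sq Y" "w \<in>\<^sub>M funs omega Y"
  shows "s \<subseteq>\<^sub>M ovr s w"
  unfolding fun_subset_iff[OF sq_len(2)[OF assms(1)] ovr_funs[OF assms]]
  using omega_subset[OF sq_len(1)[OF assms(1)]] by (auto simp: ovr_ap subset_def)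

lemma rs_mono:
  assumes "w \<in>\<^sub>M funs omega Y" "m \<in>\<^sub>M omega" "n \<in>\<^sub>M omega" "m \<subseteq>\<^sub>M n"
  shows "rs w m \<subseteq>\<^sub>M rs w n"
  unfolding fun_subset_iff[OF rs_seq[OF assms(1,2)] rs_seq[OF assms(1,3)]]
  using assms(4) by (auto simp: subset_def)

lemma prefix_rs:
  assumes "s \<in>\<^sub>M sq Y" "w \<in>\<^sub>M funs omega Y" "s \<subseteq>\<^sub>M w" "n \<in>\<^sub>M omega" "len s \<subseteq>\<^sub>M n"
  shows "s \<subseteq>\<^sub>M rs w n"
proof -
  have "rs w (len s) = s"
    using prefix_iff_rs[OF sq_len(2)[OF assms(1)] assms(2) omega_subset] assms(1,3) sq_len(1) by simp
  then show ?thesis using rs_mono[OF assms(2) sq_len(1)[OF assms(1)] assms(4,5)] by simp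
qed

lemma nat_common_bound:
  assumes "m \<in>\<^sub>M omega" "n \<in>\<^sub>M omega"
  obtains k where "k \<in>\<^sub>M omega" "m \<in>\<^sub>M osucc k" "n \<in>\<^sub>M osucc k"
  using nat_trichotomy[OF assms] assms mem_osucc by metis

lemma extend_length:
  assumes "p \<in>\<^sub>M sq Y" "y \<in>\<^sub>M Y" "n \<in>\<^sub>M omega"
  obtains q where "q \<in>\<^sub>M sq Y" "p \<subseteq>\<^sub>M q" "n \<in>\<^sub>M len q" "len p \<in>\<^sub>M len q"
proof -
  obtain k where k: "k \<in>\<^sub>M omega" "len p \<in>\<^sub>M osucc k" "n \<in>\<^sub>M osucc k"
    using nat_common_bound[OF sq_len(1)[OF assms(1)] assms(3)] .
  define w where "w = ovr p (lam omega (\<lambda>_. y))"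
  have "lam omega (\<lambda>_. y) \<in>\<^sub>M funs omega Y" by (intro lam_funs fos assms)
  then have w: "w \<in>\<^sub>M funs omega Y" "p \<subseteq>\<^sub>M w"
    unfolding w_def using assms(1) ovr_funs ovr_prefix by blast+
  have "len p \<subseteq>\<^sub>M osucc k"
    using nat_subset_iff[OF sq_len(1)[OF assms(1)], of "osucc k"] k by auto
  then have "p \<subseteq>\<^sub>M rs w (osucc k)"
    using prefix_rs[OF assms(1) w] k(1) by simp
  then show ?thesis using that[of "rs w (osucc k)"] rs_sq[OF w(1)] w(1) k by simp
qed

text \<open>Entry i is read off at stage i + 1, where the length is known to exceed i; monotonicity
  makes every other stage that has an entry i agree with it.\<close>

lemma chain_limit:
  assumes p: "tm (\<lambda>s. p (s 0))" "\<And>n. n \<in>\<^sub>M omega \<Longrightarrow> p n \<in>\<^sub>M sq Y"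
    "\<And>n. n \<in>\<^sub>M omega \<Longrightarrow> p n \<subseteq>\<^sub>M p (osucc n)" "\<And>n. n \<in>\<^sub>M omega \<Longrightarrow> n \<in>\<^sub>M len (p (osucc n))"
    and w: "w = lam omega (\<lambda>i. p (osucc i) \<bullet> i)"
  shows "w \<in>\<^sub>M funs omega Y" "n \<in>\<^sub>M omega \<Longrightarrow> p n \<subseteq>\<^sub>M w"
proof -
  have p': "tm (\<lambda>s. p (a s))" if "tm a" for a
  proof -
    have "fo (\<lambda>s. \<exists>u. u = a (\<lambda>i. s (Suc i)) \<and> s 0 = p u)"
      by (intro fos tm_shift that p(1))
    then show ?thesis unfolding tm_def by simp
  qed
  have tw: "tm (\<lambda>s. p (osucc (s 0)) \<bullet> s 0)" by (intro fos p')
  have w_ap: "w \<bullet> i = p (osucc i) \<bullet> i" if "i \<in>\<^sub>M omega" for i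
    unfolding w by (rule ap_lam[OF tw that])
  have mono: "\<forall>m. m \<in>\<^sub>M osucc n \<longrightarrow> p m \<subseteq>\<^sub>M p n" if "n \<in>\<^sub>M omega" for n
    using that
  proof (induction rule: nat_induct)
    case (osucc n)
    have "p m \<subseteq>\<^sub>M p (osucc n)" if "m \<in>\<^sub>M osucc n" for m
      using osucc(2) p(3)[OF osucc(1)] that subset_trans by blast
    then show ?case by (simp only: mem_osucc[of _ "osucc n"]) auto
  qed ((intro fos p')?; simp)+
  show wY: "w \<in>\<^sub>M funs omega Y"
    unfolding w using p(2,4) by (intro lam_funs tw ap_type[OF sq_len(2)]) auto
  assume n: "n \<in>\<^sub>M omega"
  have "w \<bullet> i = p n \<bullet> i" if i: "i \<in>\<^sub>M len (p n)" for i
  proof -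
    have iw: "i \<in>\<^sub>M omega" using nat_trans(1)[OF sq_len(1)[OF p(2)[OF n]] i] .
    have "osucc i \<in>\<^sub>M osucc n \<or> n \<in>\<^sub>M osucc (osucc i)"
      using nat_trichotomy[of "osucc i" n] iw n by auto
    then have "p (osucc i) \<bullet> i = p n \<bullet> i"
      using mono[OF n] mono[OF osucc_omega[OF iw]] p(2)[OF n] p(2)[OF osucc_omega[OF iw]] p(4)[OF iw] i
        prefix_ap[OF _ sq_len(2)] by metis
    then show ?thesis using w_ap[OF iw] by simp
  qed
  then show "p n \<subseteq>\<^sub>M w"
    unfolding fun_subset_iff[OF sq_len(2)[OF p(2)[OF n]] wY]
    using omega_subset[OF sq_len(1)[OF p(2)[OF n]]] by simp
qed

lemma fo_dense_open [fos]: "tm Y \<Longrightarrow> tm U \<Longrightarrow> fo (\<lambda>s. dense_open (Y s) (U s))"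
  unfolding dense_open_def by (intro fos tm_shift | assumption)+

lemma fo_dense_family [fos]: "tm Y \<Longrightarrow> tm U \<Longrightarrow> fo (\<lambda>s. dense_family (Y s) (U s))"
  unfolding dense_family_def by (intro fos tm_shift | assumption)+

lemma fo_generic [fos]: "tm Y \<Longrightarrow> tm U \<Longrightarrow> tm w \<Longrightarrow> fo (\<lambda>s. generic (Y s) (U s) (w s))"
  unfolding generic_def by (intro fos tm_shift | assumption)+

text \<open>Countability of \<open>Y\<close> passes to its finite sequences, so an extension into
  the next dense set can be selected by \<open>pick\<close>. The required length makes the limit
  infinite.\<close>

lemma ex_generic:
  assumes c: "ctb Y c" and y: "y \<in>\<^sub>M Y" and \<O>: "dense_family Y \<O>"
  shows "\<exists>w. generic Y \<O> w"
proof -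
  define d where "d = lam (sq Y) (\<lambda>s. sqcode c s)"
  have d: "ctb (sq Y) d" unfolding d_def by (rule ctb_sq[OF c])
  let ?P = "\<lambda>k p q. p \<subseteq>\<^sub>M q \<and> q \<in>\<^sub>M \<O> \<bullet> k \<and> k \<in>\<^sub>M len q"
  define p where "p n = nrec emp (\<lambda>k p. pick (sq Y) d (?P k p)) n" for n
  have p: "p emp = emp" "n \<in>\<^sub>M omega \<Longrightarrow> p (osucc n) = pick (sq Y) d (?P n (p n))" for n
    unfolding p_def by ((rule nrec_emp nrec_osucc; (intro fos | assumption)+)+)
  have tm_p: "tm (\<lambda>s. p (a s))" if "tm a" for a
    unfolding p_def by (intro fos that)
  have ex: "\<exists>q. q \<in>\<^sub>M sq Y \<and> ?P n r q" if n: "n \<in>\<^sub>M omega" and r: "r \<in>\<^sub>M sq Y" for n r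
  proof -
    obtain r' where r': "r' \<in>\<^sub>M sq Y" "r \<subseteq>\<^sub>M r'" "n \<in>\<^sub>M len r'" using extend_length[OF r y n] .
    have "dense_open Y (\<O> \<bullet> n)" using \<O> n unfolding dense_family_def by blast
    then obtain q where q: "q \<in>\<^sub>M \<O> \<bullet> n" "r' \<subseteq>\<^sub>M q" "q \<in>\<^sub>M sq Y"
      using r' unfolding dense_open_def subset_def by blast
    have "len r' \<subseteq>\<^sub>M len q" by (rule prefix_len[OF r'(1) q(3,2)])
    then have "n \<in>\<^sub>M len q" using r'(3) unfolding subset_def by blast
    then show ?thesis using q r' subset_trans by blast
  qed
  have step: "p (osucc n) \<in>\<^sub>M sq Y \<and> ?P n (p n) (p (osucc n))" if n: "n \<in>\<^sub>M omega" and "p n \<in>\<^sub>M sq Y" for n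
  proof -
    have "fo (\<lambda>s. ?P n (p n) (s 0))" by (intro fos)
    from pick[OF d this] ex[OF n \<open>p n \<in>\<^sub>M sq Y\<close>] show ?thesis unfolding p(2)[OF n] by blast
  qed
  have sq: "p n \<in>\<^sub>M sq Y" if "n \<in>\<^sub>M omega" for n
    using that by (induction rule: nat_induct) ((intro fos tm_p)?; simp add: p(1) step)+
  define w where "w = lam omega (\<lambda>i. p (osucc i) \<bullet> i)"
  have w: "w \<in>\<^sub>M funs omega Y" "\<And>n. n \<in>\<^sub>M omega \<Longrightarrow> p n \<subseteq>\<^sub>M w"
    using chain_limit[OF tm_p[OF tm_var] sq _ _ w_def] step sq by blast+
  have "\<exists>n. n \<in>\<^sub>M omega \<and> rs w n \<in>\<^sub>M \<O> \<bullet> k" if k: "k \<in>\<^sub>M omega" for k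
  proof (intro exI conjI)
    let ?q = "p (osucc k)"
    have q: "?q \<in>\<^sub>M sq Y" using sq k by simp
    show "len ?q \<in>\<^sub>M omega" using sq_len(1)[OF q] .
    have "rs w (len ?q) = ?q"
      using prefix_iff_rs[OF sq_len(2)[OF q] w(1) omega_subset] w(2) k q sq_len(1) by simp
    then show "rs w (len ?q) \<in>\<^sub>M \<O> \<bullet> k" using step[OF k sq[OF k]] by simp
  qed
  then show ?thesis using w(1) unfolding generic_def by blast
qed

end

section \<open>The Banach-Mazur game\<close>

context ZF_model
begin

lemma rs_osucc:
  assumes "z \<in>\<^sub>M funs omega Y" "n \<in>\<^sub>M omega"
  shows "snoc n (rs z n) (z \<bullet> n) = rs z (osucc n)"
proof (rule fun_ext)
  show "snoc n (rs z n) (z \<bullet> n) \<in>\<^sub>M funs (osucc n) Y"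
    by (intro snoc_funs rs_seq assms ap_type[OF assms])
  show "rs z (osucc n) \<in>\<^sub>M funs (osucc n) Y" using assms by (simp add: rs_seq)
  show "snoc n (rs z n) (z \<bullet> n) \<bullet> i = rs z (osucc n) \<bullet> i" if "i \<in>\<^sub>M osucc n" for i
    using that snoc_funs(2,3)[OF rs_seq[OF assms] ap_type[OF assms]] by auto
qed

lemma snoc_sq: "t \<in>\<^sub>M sq Y \<Longrightarrow> v \<in>\<^sub>M Y \<Longrightarrow> snoc (len t) t v \<in>\<^sub>M sq Y"
  and len_snoc: "t \<in>\<^sub>M sq Y \<Longrightarrow> v \<in>\<^sub>M Y \<Longrightarrow> len (snoc (len t) t v) = osucc (len t)"
  using snoc_funs(1)[OF sq_len(2)] sq_len(1) len_eq unfolding mem_sq[of "snoc _ _ _"] by (blast intro: osucc_omega)+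

text \<open>
  In the Banach-Mazur game both players extend a common finite sequence over \<open>Y\<close>; a move is the code of
  an extension. Against a winning strategy, the opponent can steer the play along any sequence
  that is sufficiently generic and begins with the first move of the strategy (if it moves first).
\<close>

lemma banach_mazur:
  assumes AD: AD and c: "ctb Y c" and y: "y \<in>\<^sub>M Y" and P: "fo (\<lambda>s. P (s 0))"
  shows "\<exists>\<O> p b. dense_family Y \<O> \<and> p \<in>\<^sub>M sq Y \<and> (\<forall>w. generic Y \<O> w \<longrightarrow> p \<subseteq>\<^sub>M w \<longrightarrow> P w = b)"
proof -
  define S where "S = sq Y"
  define d where "d = lam S (\<lambda>s. sqcode c s)"
  have d: "ctb S d" unfolding d_def S_def by (rule ctb_sq[OF c])
  let ?D = "lam omega (\<lambda>n. n)"
  define dd where "dd = lam (sq omega) (\<lambda>s. sqcode ?D s)"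
  have dd: "ctb (sq omega) dd" unfolding dd_def by (rule ctb_sq[OF ctb_omega])
  let ?proper = "\<lambda>q r. q \<subseteq>\<^sub>M r \<and> len q \<in>\<^sub>M len r"
  \<comment> \<open>Every number is a legal move: one that is not the code of a proper extension of
    q stands for the proper extension with the least code. Properness forces the play to be
    infinite.\<close>
  define ext where "ext q m = pick S d (\<lambda>r. ?proper q r \<and>
    (d \<bullet> r = m \<or> \<not> (\<exists>u. u \<in>\<^sub>M S \<and> ?proper q u \<and> d \<bullet> u = m)))" for q m
  have tm_ext: "tm (\<lambda>s. ext (a s) (b s))" if "tm a" "tm b" for a b
    unfolding ext_def by (intro fos tm_shift that)
  have ext: "ext q m \<in>\<^sub>M S" "?proper q (ext q m)" "r \<in>\<^sub>M S \<Longrightarrow> ?proper q r \<Longrightarrow> ext q (d \<bullet> r) = r"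
    if q: "q \<in>\<^sub>M S" for q m r
  proof -
    define X where "X m r \<longleftrightarrow> ?proper q r \<and> (d \<bullet> r = m \<or> \<not> (\<exists>u. u \<in>\<^sub>M S \<and> ?proper q u \<and> d \<bullet> u = m))" for m r
    have fo: "fo (\<lambda>s. X m (s 0))" for m
      unfolding X_def by (intro fos)
    have ex: "\<exists>r. r \<in>\<^sub>M S \<and> X m r" for m
    proof (cases "\<exists>u. u \<in>\<^sub>M S \<and> ?proper q u \<and> d \<bullet> u = m")
      case False
      obtain r where "r \<in>\<^sub>M sq Y" "q \<subseteq>\<^sub>M r" "emp \<in>\<^sub>M len r" "len q \<in>\<^sub>M len r"
        using extend_length[OF q[unfolded S_def] y emp_omega] .
      then show ?thesis using False unfolding X_def S_def by blast
    qed (auto simp: X_def)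
    have "ext q m \<in>\<^sub>M S \<and> X m (ext q m)" for m
    proof -
      obtain r where r: "r \<in>\<^sub>M S" "X m r" using ex by blast
      have "ext q m = pick S d (X m)" unfolding ext_def X_def ..
      then show ?thesis using pick[OF d fo r] by simp
    qed
    then have *: "ext q m \<in>\<^sub>M S" "?proper q (ext q m)"
      "d \<bullet> ext q m = m \<or> \<not> (\<exists>u. u \<in>\<^sub>M S \<and> ?proper q u \<and> d \<bullet> u = m)" for m
      unfolding X_def by blast+
    show "ext q m \<in>\<^sub>M S" "?proper q (ext q m)" using *(1,2) by blast+
    assume "r \<in>\<^sub>M S" "?proper q r"
    then have "d \<bullet> ext q (d \<bullet> r) = d \<bullet> r" using *(3)[of "d \<bullet> r"] by blast
    then show "ext q (d \<bullet> r) = r" using *(1)[of "d \<bullet> r"] \<open>r \<in>\<^sub>M S\<close> d unfolding ctb_def by blast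
  qed
  \<comment> \<open>The finite sequence built by the first n moves of \<open>h\<close>;
    \<open>W h\<close> below is the outcome of the whole play.\<close>
  define Q where "Q h n = nrec emp (\<lambda>i q. ext q (h \<bullet> i)) n" for h n
  have tm_Q: "tm (\<lambda>s. Q (a s) (b s))" if "tm a" "tm b" for a b
    unfolding Q_def by (intro fos tm_ext tm_shift that)
  have Q: "Q h emp = emp" "n \<in>\<^sub>M omega \<Longrightarrow> Q h (osucc n) = ext (Q h n) (h \<bullet> n)" for h n
    unfolding Q_def by ((rule nrec_emp nrec_osucc; (intro fos tm_ext | assumption)+)+)
  have QS: "Q h n \<in>\<^sub>M S" if "n \<in>\<^sub>M omega" for h n
    using that by (induction rule: nat_induct) ((intro fos tm_Q)?; simp add: Q ext S_def ext[unfolded S_def])+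
  have Qstep: "Q h n \<subseteq>\<^sub>M Q h (osucc n)" "len (Q h n) \<in>\<^sub>M len (Q h (osucc n))" if "n \<in>\<^sub>M omega" for h n
    using ext(2)[OF QS[OF that]] unfolding Q(2)[OF that] by blast+
  have Qlen: "n \<in>\<^sub>M osucc (len (Q h n))" if "n \<in>\<^sub>M omega" for h n
    using that
  proof (induction rule: nat_induct)
    case (osucc n)
    have "n \<in>\<^sub>M len (Q h (osucc n))"
      using osucc(2) Qstep(2)[OF osucc(1), of h] nat_trans(2)[OF sq_len(1)[OF QS[OF osucc_omega[OF osucc(1)], unfolded S_def]]]
      unfolding mem_osucc by metis
    then show ?case
      using osucc_mem_osucc[OF sq_len(1)[OF QS[OF osucc_omega[OF osucc(1)], unfolded S_def]]] by blast
  next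
    case emp
    show ?case by (simp add: Q)
  qed (intro fos tm_Q)
  have Qlen': "n \<in>\<^sub>M len (Q h (osucc n))" if "n \<in>\<^sub>M omega" for h n
    using Qlen[OF osucc_omega[OF that], of h]
      osucc_mem_osucc[OF sq_len(1)[OF QS[OF osucc_omega[OF that], unfolded S_def]]] by blast
  have Qcong: "Q h n = Q h' n" if "n \<in>\<^sub>M omega" "\<And>i. i \<in>\<^sub>M n \<Longrightarrow> h \<bullet> i = h' \<bullet> i" for h h' n
  proof -
    have "m \<in>\<^sub>M osucc n \<longrightarrow> Q h m = Q h' m" if "m \<in>\<^sub>M omega" for m
      using that
    proof (induction rule: nat_induct)
      case (osucc m)
      show ?case
      proof
        assume "osucc m \<in>\<^sub>M osucc n"
        then have "m \<in>\<^sub>M n" using osucc_mem_osucc[OF \<open>n \<in>\<^sub>M omega\<close>] by blast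
        then show "Q h (osucc m) = Q h' (osucc m)"
          using osucc \<open>\<And>i. i \<in>\<^sub>M n \<Longrightarrow> h \<bullet> i = h' \<bullet> i\<close> by (simp add: Q)
      qed
    qed ((intro fos tm_Q)?; simp add: Q)+
    then show ?thesis using \<open>n \<in>\<^sub>M omega\<close> by simp
  qed
  define W where "W h = lam omega (\<lambda>i. Q h (osucc i) \<bullet> i)" for h
  have tm_W: "tm (\<lambda>s. W (a s))" if "tm a" for a
    unfolding W_def by (intro fos tm_Q tm_shift that)
  have W: "W h \<in>\<^sub>M funs omega Y" "n \<in>\<^sub>M omega \<Longrightarrow> Q h n \<subseteq>\<^sub>M W h" for h n
    using chain_limit[OF tm_Q[OF tm_const tm_var] QS[unfolded S_def] Qstep(1) Qlen' W_def] by blast+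
  have "fo (\<lambda>s. P (W (s 0)))"
  proof -
    have "fo (\<lambda>s. \<exists>u. u = W (s 0) \<and> P u)"
      by (intro fos tm_W P)
    then show ?thesis by simp
  qed
  \<comment> \<open>The two cases of determinacy are treated together: \<open>b\<close> tells
    whether the winning strategy belongs to the player who moves first, and also which truth value
    it enforces.\<close>
  then obtain \<sigma> b where \<sigma>: "\<sigma> \<in>\<^sub>M funs (sq omega) omega"
    and win: "\<And>h. h \<in>\<^sub>M funs omega omega \<Longrightarrow>
      (\<And>n. n \<in>\<^sub>M omega \<Longrightarrow> (par n = emp) = b \<Longrightarrow> h \<bullet> n = \<sigma> \<bullet> rs h n) \<Longrightarrow> P (W h) = b"
  proof (rule AD_cases[OF AD])
    fix \<sigma>
    assume "\<sigma> \<in>\<^sub>M funs (sq omega) omega" "\<And>x. x \<in>\<^sub>M funs omega omega \<Longrightarrow>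
        (\<And>n. n \<in>\<^sub>M omega \<Longrightarrow> par n = emp \<Longrightarrow> x \<bullet> n = \<sigma> \<bullet> rs x n) \<Longrightarrow> P (W x)"
    then show thesis using that[of \<sigma> True] by simp
  next
    fix \<sigma>
    assume "\<sigma> \<in>\<^sub>M funs (sq omega) omega" "\<And>x. x \<in>\<^sub>M funs omega omega \<Longrightarrow>
        (\<And>n. n \<in>\<^sub>M omega \<Longrightarrow> par n \<noteq> emp \<Longrightarrow> x \<bullet> n = \<sigma> \<bullet> rs x n) \<Longrightarrow> \<not> P (W x)"
    then show thesis using that[of \<sigma> False] by simp
  qed
  \<comment> \<open>One round from the point of view of the strategy's opponent: the move
    \<open>m\<close> followed by the reply of \<open>\<sigma>\<close>.\<close>
  define nxt where "nxt t m = (let u = snoc (len t) t m in snoc (osucc (len t)) u (\<sigma> \<bullet> u))" for t m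
  have nxt: "nxt t m \<in>\<^sub>M sq omega" "len (nxt t m) = osucc (osucc (len t))"
    "\<And>i. i \<in>\<^sub>M len t \<Longrightarrow> nxt t m \<bullet> i = t \<bullet> i" "nxt t m \<bullet> len t = m"
    if "t \<in>\<^sub>M sq omega" "m \<in>\<^sub>M omega" for t m
  proof -
    define u where "u = snoc (len t) t m"
    have u: "u \<in>\<^sub>M sq omega" "len u = osucc (len t)" unfolding u_def using that snoc_sq len_snoc by blast+
    have n: "nxt t m = snoc (len u) u (\<sigma> \<bullet> u)" unfolding nxt_def u_def[symmetric] u(2) Let_def ..
    have su: "\<sigma> \<bullet> u \<in>\<^sub>M omega" using ap_type[OF \<sigma> u(1)] .
    show "nxt t m \<in>\<^sub>M sq omega" "len (nxt t m) = osucc (osucc (len t))"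
      unfolding n using snoc_sq[OF u(1) su] len_snoc[OF u(1) su] u(2) by simp_all
    have 1: "nxt t m \<bullet> i = u \<bullet> i" if "i \<in>\<^sub>M osucc (len t)" for i
      unfolding n using snoc_funs(3)[OF sq_len(2)[OF u(1)] su] that u(2) by simp
    show "nxt t m \<bullet> i = t \<bullet> i" if "i \<in>\<^sub>M len t" for i
      using 1[of i] that snoc_funs(3)[OF sq_len(2)[OF \<open>t \<in>\<^sub>M sq omega\<close>] \<open>m \<in>\<^sub>M omega\<close>] unfolding u_def by simp
    show "nxt t m \<bullet> len t = m"
      using 1[of "len t"] snoc_funs(2)[OF sq_len(2)[OF \<open>t \<in>\<^sub>M sq omega\<close>] \<open>m \<in>\<^sub>M omega\<close>] unfolding u_def by simp
  qed
  have tm_nxt: "tm (\<lambda>s. nxt (a s) (b s))" if "tm a" "tm b" for a b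
    unfolding nxt_def Let_def by (intro fos that)
  define qq where "qq t = Q t (len t)" for t
  have tm_qq: "tm (\<lambda>s. qq (a s))" if "tm a" for a
    unfolding qq_def by (intro fos tm_Q that)
  \<comment> \<open>What a sufficiently long part of a generic sequence has to settle about the
    position after \<open>t\<close>: either it is incompatible with that position, or it extends the
    position that results from some move and its reply.\<close>
  define U where "U t p \<longleftrightarrow> (\<not> p \<subseteq>\<^sub>M qq t \<and> \<not> qq t \<subseteq>\<^sub>M p) \<or>
    (\<exists>m. m \<in>\<^sub>M omega \<and> qq (nxt t m) \<subseteq>\<^sub>M p)" for t p
  have fo_U: "fo (\<lambda>s. U (a s) (b s))" if "tm a" "tm b" for a b
    unfolding U_def by (intro fos tm_qq tm_nxt tm_shift that)
  have qqS: "qq t \<in>\<^sub>M S" if "t \<in>\<^sub>M sq omega" for t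
    unfolding qq_def using QS sq_len(1)[OF that] .
  have U_dense: "\<exists>q. q \<in>\<^sub>M S \<and> p \<subseteq>\<^sub>M q \<and> U t q" if t: "t \<in>\<^sub>M sq omega" and p: "p \<in>\<^sub>M S" for t p
  proof (cases "p \<subseteq>\<^sub>M qq t \<or> qq t \<subseteq>\<^sub>M p")
    case False
    then show ?thesis using p unfolding U_def by (intro exI[of _ p]) simp
  next
    case True
    then obtain r0 where r0: "r0 \<in>\<^sub>M S" "p \<subseteq>\<^sub>M r0" "qq t \<subseteq>\<^sub>M r0" using p qqS[OF t] subset_refl by metis
    obtain r where r: "r \<in>\<^sub>M S" "r0 \<subseteq>\<^sub>M r" "len (qq t) \<in>\<^sub>M len r" "len r0 \<in>\<^sub>M len r"
      using extend_length[OF r0(1)[unfolded S_def] y sq_len(1)[OF qqS[OF t, unfolded S_def]]] unfolding S_def .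
    \<comment> \<open>The opponent moves at once to a common extension r of p and the position.
      Whatever \<open>\<sigma>\<close> replies then extends p as well.\<close>
    let ?m = "d \<bullet> r"
    have m: "?m \<in>\<^sub>M omega" using d r(1) ap_type[of d S omega] unfolding ctb_def by blast
    have "qq t \<subseteq>\<^sub>M r" using r0(3) r(2) subset_trans by blast
    then have e: "ext (qq t) ?m = r" using ext(3)[OF qqS[OF t] r(1)] r(3) by blast
    have lt: "len t \<in>\<^sub>M omega" using sq_len(1)[OF t] .
    have "Q (nxt t ?m) (len t) = qq t"
      unfolding qq_def by (rule Qcong[OF lt]) (rule nxt(3)[OF t m])
    then have "Q (nxt t ?m) (osucc (len t)) = r"
      using Q(2)[OF lt, of "nxt t ?m"] nxt(4)[OF t m] e by simp
    then have "r \<subseteq>\<^sub>M qq (nxt t ?m)"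
      using Qstep(1)[OF osucc_omega[OF lt], of "nxt t ?m"] unfolding qq_def nxt(2)[OF t m] by simp
    then have "p \<subseteq>\<^sub>M qq (nxt t ?m)" using r0(2) r(2) subset_trans by blast
    moreover have "U t (qq (nxt t ?m))" unfolding U_def using m subset_refl by blast
    ultimately show ?thesis using qqS[OF nxt(1)[OF t m]] by blast
  qed
  have U_open: "U t q" if t: "t \<in>\<^sub>M sq omega" and p: "p \<in>\<^sub>M S" "U t p" and q: "q \<in>\<^sub>M S" "p \<subseteq>\<^sub>M q" for t p q
  proof (cases "\<exists>m. m \<in>\<^sub>M omega \<and> qq (nxt t m) \<subseteq>\<^sub>M p")
    case True
    then show ?thesis using q(2) subset_trans unfolding U_def by blast
  next
    case False
    then have inc: "\<not> p \<subseteq>\<^sub>M qq t" "\<not> qq t \<subseteq>\<^sub>M p" using p(2) unfolding U_def by blast+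
    have "\<not> q \<subseteq>\<^sub>M qq t" using inc(1) q(2) subset_trans by blast
    moreover have "\<not> qq t \<subseteq>\<^sub>M q"
      using prefix_comparable[OF p(1)[unfolded S_def] qqS[OF t, unfolded S_def] q(2) _ sq_len(2)[OF q(1)[unfolded S_def]]] inc
      by blast
    ultimately show ?thesis unfolding U_def by blast
  qed
  \<comment> \<open>One dense set for each of the countably many histories, indexed by its
    code.\<close>
  define \<O> where "\<O> = lam omega (\<lambda>k. sep S (\<lambda>p. \<forall>t. t \<in>\<^sub>M sq omega \<longrightarrow> dd \<bullet> t = k \<longrightarrow> U t p))"
  have \<O>: "p \<in>\<^sub>M \<O> \<bullet> k \<longleftrightarrow> p \<in>\<^sub>M S \<and> (\<forall>t. t \<in>\<^sub>M sq omega \<longrightarrow> dd \<bullet> t = k \<longrightarrow> U t p)"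
    if "k \<in>\<^sub>M omega" for k p
  proof -
    have "\<O> \<bullet> k = sep S (\<lambda>p. \<forall>t. t \<in>\<^sub>M sq omega \<longrightarrow> dd \<bullet> t = k \<longrightarrow> U t p)"
      unfolding \<O>_def using that by (intro ap_lam fos fo_U)
    then show ?thesis by (simp add: mem_sep fos fo_U)
  qed
  have fam: "dense_family Y \<O>"
    unfolding dense_family_def dense_open_def S_def[symmetric]
  proof (intro allI impI conjI)
    fix k assume k: "k \<in>\<^sub>M omega"
    show "\<O> \<bullet> k \<subseteq>\<^sub>M S" by (simp add: subset_def \<O>[OF k])
    show "q \<in>\<^sub>M \<O> \<bullet> k" if "p \<in>\<^sub>M \<O> \<bullet> k" "q \<in>\<^sub>M S" "p \<subseteq>\<^sub>M q" for p q
      using that U_open unfolding \<O>[OF k] by blast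
    fix p assume p: "p \<in>\<^sub>M S"
    show "\<exists>q. q \<in>\<^sub>M \<O> \<bullet> k \<and> p \<subseteq>\<^sub>M q"
    proof (cases "\<exists>t. t \<in>\<^sub>M sq omega \<and> dd \<bullet> t = k")
      case True
      then obtain t where t: "t \<in>\<^sub>M sq omega" "dd \<bullet> t = k" by blast
      have "t' = t" if "t' \<in>\<^sub>M sq omega" "dd \<bullet> t' = k" for t'
        using dd t that unfolding ctb_def by blast
      then show ?thesis using U_dense[OF t(1) p] unfolding \<O>[OF k] by metis
    next
      case False
      then show ?thesis using p unfolding \<O>[OF k] by (intro exI[of _ p]) auto
    qed
  qed
  \<comment> \<open>If the strategy moves first, its opening move constrains the sequence; otherwise
    the opponent may begin anywhere.\<close>
  define p where "p = (if b then ext emp (\<sigma> \<bullet> emp) else emp)"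
  have pS: "p \<in>\<^sub>M S" unfolding p_def using ext(1)[of emp] by (simp add: S_def)
  have "P w = b" if w: "generic Y \<O> w" and pw: "p \<subseteq>\<^sub>M w" for w
  proof -
    have wY: "w \<in>\<^sub>M funs omega Y" using w unfolding generic_def by blast
    let ?R = "\<lambda>t m. qq (nxt t m) \<subseteq>\<^sub>M w"
    have goodU: "\<exists>m. m \<in>\<^sub>M omega \<and> ?R t m" if t: "t \<in>\<^sub>M sq omega" and q: "qq t \<subseteq>\<^sub>M w" for t
    proof -
      have k: "dd \<bullet> t \<in>\<^sub>M omega" using dd t ap_type[of dd "sq omega" omega] unfolding ctb_def by blast
      then obtain n where n: "n \<in>\<^sub>M omega" "rs w n \<in>\<^sub>M \<O> \<bullet> (dd \<bullet> t)" using w unfolding generic_def by blast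
      then have "U t (rs w n)" using t \<O>[OF k] by blast
      \<comment> \<open>Both are initial parts of w, which rules out the first alternative in
        \<open>U\<close>.\<close>
      moreover have "rs w n \<subseteq>\<^sub>M qq t \<or> qq t \<subseteq>\<^sub>M rs w n"
        using prefix_comparable[OF rs_sq[OF wY n(1)] qqS[OF t, unfolded S_def] rs_prefix[OF wY n(1)] q wY] .
      ultimately obtain m where "m \<in>\<^sub>M omega" "qq (nxt t m) \<subseteq>\<^sub>M rs w n" unfolding U_def by blast
      then show ?thesis using rs_prefix[OF wY n(1)] subset_trans by blast
    qed
    \<comment> \<open>The second alternative makes the selection of a move total. At positions that
      lie on w it does not occur, by \<open>goodU\<close>.\<close>
    define X where "X t m \<longleftrightarrow> ?R t m \<or> \<not> (\<exists>m. m \<in>\<^sub>M omega \<and> ?R t m)" for t m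
    have fo_X: "fo (\<lambda>s. X (a s) (c s))" if "tm a" "tm c" for a c
      unfolding X_def by (intro fos tm_qq tm_nxt tm_shift that)
    define mv where "mv t = pick omega ?D (X t)" for t
    have mv: "mv t \<in>\<^sub>M omega" "m \<in>\<^sub>M omega \<Longrightarrow> ?R t m \<Longrightarrow> ?R t (mv t)" for t m
    proof -
      have "\<exists>m. m \<in>\<^sub>M omega \<and> X t m" unfolding X_def using emp_omega by blast
      then obtain m' where "m' \<in>\<^sub>M omega" "X t m'" by blast
      then have *: "mv t \<in>\<^sub>M omega" "X t (mv t)"
        unfolding mv_def using pick[OF ctb_omega fo_X[OF tm_const tm_var]] by blast+
      show "mv t \<in>\<^sub>M omega" "m \<in>\<^sub>M omega \<Longrightarrow> ?R t m \<Longrightarrow> ?R t (mv t)"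
        using * unfolding X_def by blast+
    qed
    let ?t = "\<lambda>t. if (par (len t) = emp) = b then \<sigma> \<bullet> t else mv t"
    have 1: "tm (\<lambda>s. ?t (s 0))" unfolding mv_def by (intro fos fo_X)
    have 2: "?t t \<in>\<^sub>M omega" if "t \<in>\<^sub>M sq omega" for t
      using ap_type[OF \<sigma> that] mv(1)[of t] by simp
    obtain h where h: "h \<in>\<^sub>M funs omega omega" and h': "\<And>n. n \<in>\<^sub>M omega \<Longrightarrow> h \<bullet> n = ?t (rs h n)"
      using ex_run[of ?t omega, OF 1 2] by metis
    have hI: "h \<bullet> n = \<sigma> \<bullet> rs h n" if "n \<in>\<^sub>M omega" "(par n = emp) = b" for n
      using h'[OF that(1)] len_rs[OF h that(1)] that(2) by simp
    have hII: "h \<bullet> n = mv (rs h n)" if "n \<in>\<^sub>M omega" "(par n = emp) \<noteq> b" for n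
      using h'[OF that(1)] len_rs[OF h that(1)] that(2) by simp
    have qqh: "qq (rs h n) = Q h n" if "n \<in>\<^sub>M omega" for n
      unfolding qq_def len_rs[OF h that] by (rule Qcong[OF that]) simp
    \<comment> \<open>At the opponent's turn the present position lies on w. At the strategy's turn
      the claim concerns the position after its reply, because the opponent's move was selected so
      that this reply stays on w.\<close>
    have inv: "((par n = emp) \<noteq> b \<longrightarrow> Q h n \<subseteq>\<^sub>M w) \<and> ((par n = emp) = b \<longrightarrow> Q h (osucc n) \<subseteq>\<^sub>M w)"
      if "n \<in>\<^sub>M omega" for n
      using that
    proof (induction rule: nat_induct)
      case emp
      have "rs h emp = emp" using len_rs[OF h emp_omega] rs_seq[OF h emp_omega]
        by (intro emp_eqI) (auto simp: mem_funs)
      then show ?case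
        using pw hI[OF emp_omega] by (cases b) (simp_all add: Q p_def)
    next
      case (osucc n)
      show ?case
      proof (cases "(par n = emp) = b")
        case True
        then have "(par (osucc n) = emp) \<noteq> b" using osucc(1) by auto
        then show ?thesis using True osucc(2) by blast
      next
        case False
        have turn: "(par (osucc n) = emp) = b" using False osucc(1) by auto
        have t: "rs h n \<in>\<^sub>M sq omega" by (rule rs_sq[OF h osucc(1)])
        have "qq (rs h n) \<subseteq>\<^sub>M w" using False osucc(2) qqh[OF osucc(1)] by simp
        then have "?R (rs h n) (h \<bullet> n)" using mv(2) goodU[OF t] hII[OF osucc(1) False] by metis
        moreover have "nxt (rs h n) (h \<bullet> n) = rs h (osucc (osucc n))"
          unfolding nxt_def len_rs[OF h osucc(1)] Let_def rs_osucc[OF h osucc(1)]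
          using rs_osucc[OF h osucc_omega[OF osucc(1)]] hI[OF osucc_omega[OF osucc(1)] turn] by simp
        ultimately have "Q h (osucc (osucc n)) \<subseteq>\<^sub>M w" using qqh[of "osucc (osucc n)"] osucc(1) by simp
        then show ?thesis using turn by blast
      qed
    qed (intro fos tm_Q)
    have Qw: "Q h n \<subseteq>\<^sub>M w" if n: "n \<in>\<^sub>M omega" for n
      using inv[OF n] Qstep(1)[OF n, of h] subset_trans by blast
    have "W h = w"
    proof (rule fun_ext[OF W(1) wY])
      fix i assume i: "i \<in>\<^sub>M omega"
      have q: "Q h (osucc i) \<in>\<^sub>M sq Y" using QS[OF osucc_omega[OF i]] unfolding S_def .
      show "W h \<bullet> i = w \<bullet> i"
        using prefix_ap[OF q W(1) W(2)[OF osucc_omega[OF i]] Qlen'[OF i]]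
          prefix_ap[OF q wY Qw[OF osucc_omega[OF i]] Qlen'[OF i]] by simp
    qed
    then show ?thesis using win[OF h hI] by simp
  qed
  then show ?thesis using fam pS unfolding S_def by blast
qed

end

section \<open>Generic chains of reals\<close>

context set_structure
begin

text \<open>
  A letter \<open>\<langle>i, u\<rangle>\<close> acts on a real \<open>r\<close> (the state): \<open>i = 0\<close> removes the first bit of \<open>r\<close>, other \<open>i\<close> join
  \<open>r\<close> with \<open>u\<close>, where \<open>r\<close> becomes the even half if \<open>i = 1\<close> and the odd half otherwise. Two bits are
  emitted: the first tells whether a bit was removed, the second is the removed bit or the half in
  which \<open>r\<close> is found. From the emitted bits one can recover every bit of every state that is
  eventually removed.
\<close>

definition next_state :: "'a \<Rightarrow> 'a \<Rightarrow> 'a" where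
  "next_state r l = (if pfst l = emp then shift r
     else if pfst l = one then join r (psnd l) else join (psnd l) r)"

definition state :: "'a \<Rightarrow> 'a \<Rightarrow> 'a" where
  "state w t = nrec zero (\<lambda>i r. next_state r (w \<bullet> i)) t"

definition emit_tag :: "'a \<Rightarrow> 'a" where
  "emit_tag l = (if pfst l = emp then emp else one)"

definition emit_bit :: "'a \<Rightarrow> 'a \<Rightarrow> 'a" where
  "emit_bit r l = (if pfst l = emp then r \<bullet> emp else if pfst l = one then emp else one)"

definition emission :: "'a \<Rightarrow> 'a" where
  "emission w = lam omega (\<lambda>n. if par n = emp then emit_tag (w \<bullet> half n) else emit_bit (state w (half n)) (w \<bullet> half n))"

definition letters :: "'a \<Rightarrow> 'a" where
  "letters D = cart omega D"

definition E0r :: "'a \<Rightarrow> 'a \<Rightarrow> bool" where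
  "E0r x y \<longleftrightarrow> (\<exists>m. m \<in>\<^sub>M omega \<and> (\<forall>n. n \<in>\<^sub>M omega \<longrightarrow> \<not> n \<in>\<^sub>M m \<longrightarrow> x \<bullet> n = y \<bullet> n))"

text \<open>Comeagrely many sequences have their emission in \<open>A\<close>. This is the filter
  U_D of the overview; the dense family is bound by a quantifier, so that only \<open>D\<close>
  enters, and the notion is definable with \<open>D\<close> as a variable.\<close>

definition large :: "'a \<Rightarrow> 'a \<Rightarrow> bool" where
  "large D A \<longleftrightarrow> (\<exists>\<O>. dense_family (letters D) \<O> \<and> (\<forall>w. generic (letters D) \<O> w \<longrightarrow> emission w \<in>\<^sub>M A))"

end

context ZF_model
begin

lemma tm_next_state [fos]: "tm a \<Longrightarrow> tm b \<Longrightarrow> tm (\<lambda>s. next_state (a s) (b s))"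
  unfolding next_state_def by (intro fos | assumption)+

lemma tm_state [fos]: "tm a \<Longrightarrow> tm b \<Longrightarrow> tm (\<lambda>s. state (a s) (b s))"
  unfolding state_def by (intro fos tm_shift | assumption)+

lemma tm_emit_tag [fos]: "tm a \<Longrightarrow> tm (\<lambda>s. emit_tag (a s))"
  unfolding emit_tag_def by (intro fos | assumption)+

lemma tm_emit_bit [fos]: "tm a \<Longrightarrow> tm b \<Longrightarrow> tm (\<lambda>s. emit_bit (a s) (b s))"
  unfolding emit_bit_def by (intro fos | assumption)+

lemma tm_emission [fos]: "tm a \<Longrightarrow> tm (\<lambda>s. emission (a s))"
  unfolding emission_def by (intro fos tm_shift | assumption)+

lemma tm_letters [fos]: "tm a \<Longrightarrow> tm (\<lambda>s. letters (a s))"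
  unfolding letters_def by (intro fos | assumption)+

lemma fo_E0r [fos]: "tm a \<Longrightarrow> tm b \<Longrightarrow> fo (\<lambda>s. E0r (a s) (b s))"
  unfolding E0r_def by (intro fos tm_shift | assumption)+

lemma fo_large [fos]: "tm a \<Longrightarrow> tm b \<Longrightarrow> fo (\<lambda>s. large (a s) (b s))"
  unfolding large_def by (intro fos tm_shift | assumption)+

lemma state_emp: "state w emp = zero" and state_osucc: "t \<in>\<^sub>M omega \<Longrightarrow> state w (osucc t) = next_state (state w t) (w \<bullet> t)"
  unfolding state_def by ((rule nrec_emp nrec_osucc; (intro fos | assumption)+)+)

lemma mem_letters: "l \<in>\<^sub>M letters D \<longleftrightarrow> (\<exists>i u. i \<in>\<^sub>M omega \<and> u \<in>\<^sub>M D \<and> l = \<langle>i, u\<rangle>)"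
  unfolding letters_def by simp

lemma next_state_closed: "closed D \<Longrightarrow> r \<in>\<^sub>M D \<Longrightarrow> l \<in>\<^sub>M letters D \<Longrightarrow> next_state r l \<in>\<^sub>M D"
  unfolding mem_letters next_state_def using closedD(2,6) by auto

lemma state_closed:
  assumes D: "closed D" "zero \<in>\<^sub>M D" and t: "t \<in>\<^sub>M omega" and w: "\<And>i. i \<in>\<^sub>M t \<Longrightarrow> w \<bullet> i \<in>\<^sub>M letters D"
  shows "state w t \<in>\<^sub>M D"
proof -
  have "n \<in>\<^sub>M osucc t \<longrightarrow> state w n \<in>\<^sub>M D" if "n \<in>\<^sub>M omega" for n
    using that
  proof (induction rule: nat_induct)
    case (osucc n)
    show ?case
    proof
      assume "osucc n \<in>\<^sub>M osucc t"
      then have n: "n \<in>\<^sub>M t" using osucc_mem_osucc[OF t] by blast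
      then show "state w (osucc n) \<in>\<^sub>M D"
        using osucc next_state_closed[OF D(1) _ w[OF n]] by (simp add: state_osucc)
    qed
  qed ((intro fos)?; simp add: state_emp D)+
  then show ?thesis using t by simp
qed

lemma state_cong:
  assumes t: "t \<in>\<^sub>M omega" and w: "\<And>i. i \<in>\<^sub>M t \<Longrightarrow> w \<bullet> i = w' \<bullet> i"
  shows "state w t = state w' t"
proof -
  have "n \<in>\<^sub>M osucc t \<longrightarrow> state w n = state w' n" if "n \<in>\<^sub>M omega" for n
    using that
  proof (induction rule: nat_induct)
    case (osucc n)
    show ?case
    proof
      assume "osucc n \<in>\<^sub>M osucc t"
      then have n: "n \<in>\<^sub>M t" using osucc_mem_osucc[OF t] by blast
      then show "state w (osucc n) = state w' (osucc n)"
        using osucc w[OF n] by (simp add: state_osucc)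
    qed
  qed ((intro fos)?; simp add: state_emp)+
  then show ?thesis using t by simp
qed

lemma state_merge:
  assumes N: "N \<in>\<^sub>M omega" "state w N = state w' N"
    and w: "\<And>i. i \<in>\<^sub>M omega \<Longrightarrow> \<not> i \<in>\<^sub>M N \<Longrightarrow> w \<bullet> i = w' \<bullet> i"
    and t: "t \<in>\<^sub>M omega" "\<not> t \<in>\<^sub>M N"
  shows "state w t = state w' t"
proof -
  have "\<not> t \<in>\<^sub>M N \<longrightarrow> state w t = state w' t"
    using t(1)
  proof (induction rule: nat_induct)
    case (osucc t)
    show ?case
    proof
      assume *: "\<not> osucc t \<in>\<^sub>M N"
      show "state w (osucc t) = state w' (osucc t)"
      proof (cases "t \<in>\<^sub>M N")
        case True
        then have "osucc t = N" using * osucc_mem_osucc[OF N(1), of t] by simp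
        then show ?thesis using N(2) by simp
      next
        case False
        then show ?thesis using osucc w[OF osucc(1) False] by (simp add: state_osucc)
      qed
    qed
  qed ((intro fos)?; simp add: state_emp)+
  then show ?thesis using t(2) by blast
qed

lemma emission_ap: "n \<in>\<^sub>M omega \<Longrightarrow>
  emission w \<bullet> n = (if par n = emp then emit_tag (w \<bullet> half n) else emit_bit (state w (half n)) (w \<bullet> half n))"
  unfolding emission_def by (rule ap_lam) (intro fos)

lemma emission_cantor:
  assumes D: "closed D" "zero \<in>\<^sub>M D" and w: "w \<in>\<^sub>M funs omega (letters D)"
  shows "emission w \<in>\<^sub>M cantor"
  unfolding emission_def
proof (rule lam_cantor)
  show "tm (\<lambda>s. if par (s 0) = emp then emit_tag (w \<bullet> half (s 0)) else emit_bit (state w (half (s 0))) (w \<bullet> half (s 0)))"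
    by (intro fos)
  fix n assume n: "n \<in>\<^sub>M omega"
  have "state w (half n) \<in>\<^sub>M D"
    by (rule state_closed[OF D half_omega[OF n]]) (rule ap_type[OF w nat_trans(1)[OF half_omega[OF n]]])
  then have "state w (half n) \<bullet> emp = emp \<or> state w (half n) \<bullet> emp = one"
    using closedD(1)[OF D(1)] cantor_two by simp
  then show "(if par n = emp then emit_tag (w \<bullet> half n) else emit_bit (state w (half n)) (w \<bullet> half n)) = emp \<or>
      (if par n = emp then emit_tag (w \<bullet> half n) else emit_bit (state w (half n)) (w \<bullet> half n)) = one"
    by (simp add: emit_tag_def emit_bit_def)
qed

text \<open>The bits emitted at time t occupy the places 2 t and 2 t + 1. Since states depend on the
  past only through the state at \<open>N\<close>, agreement from time \<open>N\<close> on means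
  agreement from place \<open>dbl N\<close> on.\<close>

lemma emission_merge:
  assumes N: "N \<in>\<^sub>M omega" "state w N = state w' N"
    and w: "\<And>i. i \<in>\<^sub>M omega \<Longrightarrow> \<not> i \<in>\<^sub>M N \<Longrightarrow> w \<bullet> i = w' \<bullet> i"
  shows "E0r (emission w) (emission w')"
  unfolding E0r_def
proof (intro exI[of _ "dbl N"] conjI allI impI)
  fix n assume n: "n \<in>\<^sub>M omega" "\<not> n \<in>\<^sub>M dbl N"
  then have h: "half n \<in>\<^sub>M omega" "\<not> half n \<in>\<^sub>M N" using half_mem_iff[OF N(1)] by simp_all
  show "emission w \<bullet> n = emission w' \<bullet> n"
    using w[OF h] state_merge[OF N w h] by (simp add: emission_ap n(1))
qed (simp add: N)

subsection \<open>The zero-one law\<close>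

lemma E0r_sym: "E0r x y \<Longrightarrow> E0r y x"
  unfolding E0r_def by metis

lemma large_mono: "large D A \<Longrightarrow> A \<subseteq>\<^sub>M B \<Longrightarrow> large D B"
  unfolding large_def subset_def by blast

lemma large_inter:
  assumes "large D A" "large D B"
  shows "large D (inter A B)"
proof -
  obtain \<O> \<O>' where o: "dense_family (letters D) \<O>" "\<And>w. generic (letters D) \<O> w \<Longrightarrow> emission w \<in>\<^sub>M A"
    "dense_family (letters D) \<O>'" "\<And>w. generic (letters D) \<O>' w \<Longrightarrow> emission w \<in>\<^sub>M B"
    using assms unfolding large_def by blast
  define \<P> where "\<P> = lam omega (\<lambda>k. inter (\<O> \<bullet> k) (\<O>' \<bullet> k))"
  have P: "\<P> \<bullet> k = inter (\<O> \<bullet> k) (\<O>' \<bullet> k)" if "k \<in>\<^sub>M omega" for k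
    unfolding \<P>_def using that by (intro ap_lam fos)
  have "dense_open Y (inter U V)" if U: "dense_open Y U" and V: "dense_open Y V" for Y U V
    unfolding dense_open_def
  proof (intro conjI allI impI)
    show "inter U V \<subseteq>\<^sub>M sq Y" using U unfolding dense_open_def subset_def by simp
    show "q \<in>\<^sub>M inter U V" if "p \<in>\<^sub>M inter U V" "q \<in>\<^sub>M sq Y" "p \<subseteq>\<^sub>M q" for p q
      using that U V unfolding dense_open_def mem_inter by blast
    fix p assume "p \<in>\<^sub>M sq Y"
    then obtain q where q: "q \<in>\<^sub>M U" "p \<subseteq>\<^sub>M q" "q \<in>\<^sub>M sq Y"
      using U unfolding dense_open_def subset_def[of U] by blast
    then obtain r where r: "r \<in>\<^sub>M V" "q \<subseteq>\<^sub>M r" "r \<in>\<^sub>M sq Y"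
      using V q(3) unfolding dense_open_def subset_def[of V] by blast
    have "r \<in>\<^sub>M U" using U q r unfolding dense_open_def by blast
    then show "\<exists>q. q \<in>\<^sub>M inter U V \<and> p \<subseteq>\<^sub>M q"
      using r q subset_trans unfolding mem_inter by blast
  qed
  then have "dense_family (letters D) \<P>"
    using o(1,3) unfolding dense_family_def by (simp add: P)
  moreover have "generic (letters D) \<O> w" "generic (letters D) \<O>' w" if "generic (letters D) \<P> w" for w
    using that unfolding generic_def by (auto simp: P)
  ultimately show ?thesis using o unfolding large_def by (metis mem_inter)
qed

lemma large_not_emp:
  assumes "ctb D c" "zero \<in>\<^sub>M D"
  shows "\<not> large D emp"
proof
  assume "large D emp"
  then obtain \<O> where \<O>: "dense_family (letters D) \<O>" "\<And>w. \<not> generic (letters D) \<O> w"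
    unfolding large_def by auto
  obtain d where "ctb (letters D) d" using ctb_cart[OF assms(1)] unfolding letters_def by blast
  moreover have "\<langle>emp, zero\<rangle> \<in>\<^sub>M letters D" using assms(2) by (simp add: mem_letters)
  ultimately show False using ex_generic \<O> by blast
qed

text \<open>Both sequences are padded to the same length n, so that no later index is displaced.
  Then the first joins \<open>state q1 n\<close> on the right and the second joins
  \<open>state p1 n\<close> on the left, and both reach the join of the two states. The states
  qualify as parts of letters because \<open>D\<close> is closed.\<close>

lemma merge_dense:
  assumes D: "closed D" "zero \<in>\<^sub>M D" and p: "p \<in>\<^sub>M sq (letters D)" and q: "q \<in>\<^sub>M sq (letters D)"
  obtains q' n s where "q' \<in>\<^sub>M sq (letters D)" "q \<subseteq>\<^sub>M q'" "n \<in>\<^sub>M osucc (len q')" "s \<in>\<^sub>M funs n (letters D)"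
    "p \<subseteq>\<^sub>M s" "state s n = state q' n"
proof -
  let ?Y = "letters D"
  obtain n where n: "n \<in>\<^sub>M omega" "len p \<in>\<^sub>M osucc n" "len q \<in>\<^sub>M osucc n"
    using nat_common_bound[OF sq_len(1)[OF p] sq_len(1)[OF q]] .
  define w0 where "w0 = lam omega (\<lambda>_. \<langle>emp, zero\<rangle>)"
  have w0: "w0 \<in>\<^sub>M funs omega ?Y" unfolding w0_def by (intro lam_funs fos) (simp add: mem_letters D)
  have pad: "\<exists>r'. r' \<in>\<^sub>M funs n ?Y \<and> r \<subseteq>\<^sub>M r'" if r: "r \<in>\<^sub>M sq ?Y" "len r \<in>\<^sub>M osucc n" for r
  proof -
    have "len r \<subseteq>\<^sub>M n" using nat_subset_iff[OF sq_len(1)[OF r(1)] n(1)] r(2) by blast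
    then show ?thesis
      using prefix_rs[OF r(1) ovr_funs[OF r(1) w0] ovr_prefix[OF r(1) w0] n(1)]
        rs_seq[OF ovr_funs[OF r(1) w0] n(1)] by blast
  qed
  obtain q1 where q1: "q1 \<in>\<^sub>M funs n ?Y" "q \<subseteq>\<^sub>M q1" using pad[OF q n(3)] by blast
  obtain p1 where p1: "p1 \<in>\<^sub>M funs n ?Y" "p \<subseteq>\<^sub>M p1" using pad[OF p n(2)] by blast
  have a: "state q1 n \<in>\<^sub>M D" and b: "state p1 n \<in>\<^sub>M D"
    using state_closed[OF D n(1)] ap_type[OF q1(1)] ap_type[OF p1(1)] by blast+
  let ?q = "snoc n q1 \<langle>two, state p1 n\<rangle>" and ?p = "snoc n p1 \<langle>one, state q1 n\<rangle>"
  have l: "\<langle>two, state p1 n\<rangle> \<in>\<^sub>M ?Y" "\<langle>one, state q1 n\<rangle> \<in>\<^sub>M ?Y" using a b by (simp_all add: mem_letters)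
  note q2 = snoc_funs[OF q1(1) l(1)] and p2 = snoc_funs[OF p1(1) l(2)]
  have "state ?q (osucc n) = next_state (state q1 n) \<langle>two, state p1 n\<rangle>"
    using state_osucc[OF n(1)] q2(2) state_cong[OF n(1) q2(3)] by simp
  moreover have "state ?p (osucc n) = next_state (state p1 n) \<langle>one, state q1 n\<rangle>"
    using state_osucc[OF n(1)] p2(2) state_cong[OF n(1) p2(3)] by simp
  ultimately have "state ?p (osucc n) = state ?q (osucc n)" by (simp add: next_state_def two_def one_def)
  moreover have "q \<subseteq>\<^sub>M ?q" "p \<subseteq>\<^sub>M ?p"
    using q1(2) p1(2) by (auto simp: subset_def mem_snoc)
  moreover have "?q \<in>\<^sub>M sq ?Y" "len ?q = osucc n"
    using q2(1) n(1) len_eq unfolding mem_sq by (blast intro: osucc_omega)+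
  ultimately show ?thesis using that[of ?q "osucc n" ?p] p2(1) by simp
qed

lemma rs_ovr:
  assumes "s \<in>\<^sub>M sq Y" "b \<in>\<^sub>M sq Y"
  shows "rs (ovr s b) (len b) \<in>\<^sub>M funs (len b) Y"
    "i \<in>\<^sub>M len b \<Longrightarrow> rs (ovr s b) (len b) \<bullet> i = (if i \<in>\<^sub>M len s then s \<bullet> i else b \<bullet> i)"
proof -
  have *: "ovr s b \<bullet> i = (if i \<in>\<^sub>M len s then s \<bullet> i else b \<bullet> i)" if "i \<in>\<^sub>M len b" for i
    using ovr_ap nat_trans(1)[OF sq_len(1)[OF assms(2)] that] by blast
  show "i \<in>\<^sub>M len b \<Longrightarrow> rs (ovr s b) (len b) \<bullet> i = (if i \<in>\<^sub>M len s then s \<bullet> i else b \<bullet> i)"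
    using * by simp
  show "rs (ovr s b) (len b) \<in>\<^sub>M funs (len b) Y"
    by (rule rs_funs) (simp add: * ap_type[OF sq_len(2)[OF assms(1)]] ap_type[OF sq_len(2)[OF assms(2)]])
qed

text \<open>Overwriting by \<open>s\<close> affects a fixed initial part only. So q is lengthened
  beyond \<open>s\<close>, overwritten, extended into \<open>U\<close>, and finally given back its
  original initial part; overwriting the result by \<open>s\<close> leads again to the member of
  \<open>U\<close>.\<close>

lemma override_dense:
  assumes U: "dense_open Y U" and s: "s \<in>\<^sub>M sq Y" and y: "y \<in>\<^sub>M Y" and q: "q \<in>\<^sub>M sq Y"
  obtains r where "r \<in>\<^sub>M sq Y" "q \<subseteq>\<^sub>M r" "len s \<in>\<^sub>M len r" "rs (ovr s r) (len r) \<in>\<^sub>M U"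
proof -
  note ov = rs_ovr
  obtain q1 where q1: "q1 \<in>\<^sub>M sq Y" "q \<subseteq>\<^sub>M q1" "len s \<in>\<^sub>M len q1" "len q \<in>\<^sub>M len q1"
    using extend_length[OF q y sq_len(1)[OF s]] .
  let ?s = "rs (ovr s q1) (len q1)"
  have s1: "?s \<in>\<^sub>M funs (len q1) Y" using ov(1)[OF s q1(1)] .
  then have "?s \<in>\<^sub>M sq Y" using sq_len(1)[OF q1(1)] by (auto simp: mem_sq)
  then obtain r where r: "r \<in>\<^sub>M U" "?s \<subseteq>\<^sub>M r" "r \<in>\<^sub>M sq Y"
    using U unfolding dense_open_def subset_def[of U] by blast
  have sr: "len q1 \<subseteq>\<^sub>M len r" "\<And>i. i \<in>\<^sub>M len q1 \<Longrightarrow> ?s \<bullet> i = r \<bullet> i"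
    using r(2) unfolding fun_subset_iff[OF s1 sq_len(2)[OF r(3)]] by blast+
  let ?r = "rs (ovr q1 r) (len r)"
  have r2: "?r \<in>\<^sub>M funs (len r) Y" using ov(1)[OF q1(1) r(3)] .
  have len: "len ?r = len r" using len_eq[OF r2] .
  have rsq: "?r \<in>\<^sub>M sq Y" using r2 sq_len(1)[OF r(3)] by (auto simp: mem_sq)
  have "q1 \<subseteq>\<^sub>M ?r"
    unfolding fun_subset_iff[OF sq_len(2)[OF q1(1)] r2]
    using sr(1) ov(2)[OF q1(1) r(3)] unfolding subset_def by simp
  then have "q \<subseteq>\<^sub>M ?r" using q1(2) subset_trans by blast
  moreover have "len s \<in>\<^sub>M len ?r" using q1(3) sr(1) unfolding len subset_def by blast
  moreover have "rs (ovr s ?r) (len ?r) = r"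
  proof (rule fun_ext)
    show "rs (ovr s ?r) (len ?r) \<in>\<^sub>M funs (len r) Y" using ov(1)[OF s rsq] len by simp
    show "r \<in>\<^sub>M funs (len r) Y" using sq_len(2)[OF r(3)] .
    fix i assume i: "i \<in>\<^sub>M len r"
    show "rs (ovr s ?r) (len ?r) \<bullet> i = r \<bullet> i"
      using ov(2)[OF s rsq, of i] ov(2)[OF q1(1) r(3) i] ov(2)[OF s q1(1), of i] sr(2)[of i]
        nat_trans(2)[OF sq_len(1)[OF q1(1)] q1(3), of i] i len by (auto split: if_splits)
  qed
  ultimately show ?thesis using that[OF rsq] r(1) by simp
qed

text \<open>The Banach-Mazur game decides \<open>A\<close> only for generic sequences that begin
  with a certain p. An arbitrary generic w is compared with a sequence v that begins with p, reaches
  the state of w at some time and copies w from then on; their emissions differ in finitely many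
  bits. For v to be generic, w has to meet the pullbacks of the dense sets under all finite
  overwrites, of which there are countably many.\<close>

lemma zero_one:
  assumes AD: AD and D: "closed D" "zero \<in>\<^sub>M D" and c: "ctb D c"
    and A: "\<And>x y. x \<in>\<^sub>M A \<Longrightarrow> y \<in>\<^sub>M cantor \<Longrightarrow> E0r x y \<Longrightarrow> y \<in>\<^sub>M A"
  shows "large D A \<or> large D (diff cantor A)"
proof -
  define Y where "Y = letters D"
  obtain c' where c': "ctb Y c'" using ctb_cart[OF c] unfolding Y_def letters_def by blast
  have y: "\<langle>emp, zero\<rangle> \<in>\<^sub>M Y" using D(2) by (simp add: mem_letters Y_def)
  define d where "d = lam (sq Y) (\<lambda>s. sqcode c' s)"
  have d: "ctb (sq Y) d" unfolding d_def by (rule ctb_sq[OF c'])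
  have dw: "d \<bullet> s \<in>\<^sub>M omega" if "s \<in>\<^sub>M sq Y" for s
    using d that ap_type[of d "sq Y" omega] unfolding ctb_def by blast
  have "fo (\<lambda>s. emission (s 0) \<in>\<^sub>M A)" by (intro fos)
  from banach_mazur[OF AD c' y this] obtain \<O> p b where \<O>: "dense_family Y \<O>" and p: "p \<in>\<^sub>M sq Y"
    and bm: "\<And>w. generic Y \<O> w \<Longrightarrow> p \<subseteq>\<^sub>M w \<Longrightarrow> (emission w \<in>\<^sub>M A) = b"
    by blast
  \<comment> \<open>The merging condition: some history through p arrives at the same state as q at
    the same time.\<close>
  define M where "M q \<longleftrightarrow> (\<exists>n s. n \<in>\<^sub>M osucc (len q) \<and> s \<in>\<^sub>M funs n Y \<and> p \<subseteq>\<^sub>M s \<and> state s n = state q n)" for q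
  define R where "R a s q \<longleftrightarrow> len s \<in>\<^sub>M len q \<and> rs (ovr s q) (len q) \<in>\<^sub>M \<O> \<bullet> a" for a s q
  \<comment> \<open>An index codes a pair of a given dense set and an overwrite. Merging is demanded
    at every index, so that the index \<open>emp\<close> can be used for it later.\<close>
  define \<P> where "\<P> = lam omega (\<lambda>k. sep (sq Y) (\<lambda>q. M q \<and>
    (\<forall>a s. a \<in>\<^sub>M omega \<longrightarrow> s \<in>\<^sub>M sq Y \<longrightarrow> k = J a (d \<bullet> s) \<longrightarrow> R a s q)))"
  have P: "q \<in>\<^sub>M \<P> \<bullet> k \<longleftrightarrow> q \<in>\<^sub>M sq Y \<and> M q \<and>
    (\<forall>a s. a \<in>\<^sub>M omega \<longrightarrow> s \<in>\<^sub>M sq Y \<longrightarrow> k = J a (d \<bullet> s) \<longrightarrow> R a s q)" if k: "k \<in>\<^sub>M omega" for k q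
  proof -
    have "\<P> \<bullet> k = sep (sq Y) (\<lambda>q. M q \<and>
      (\<forall>a s. a \<in>\<^sub>M omega \<longrightarrow> s \<in>\<^sub>M sq Y \<longrightarrow> k = J a (d \<bullet> s) \<longrightarrow> R a s q))"
      unfolding \<P>_def M_def R_def using k by (intro ap_lam fos)
    moreover have "fo (\<lambda>e. M (e 0) \<and>
      (\<forall>a s. a \<in>\<^sub>M omega \<longrightarrow> s \<in>\<^sub>M sq Y \<longrightarrow> k = J a (d \<bullet> s) \<longrightarrow> R a s (e 0)))"
      unfolding M_def R_def by (intro fos)
    ultimately show ?thesis by (simp only: mem_sep)
  qed
  have M_open: "M q'" if q: "q \<in>\<^sub>M sq Y" "M q" and q': "q' \<in>\<^sub>M sq Y" "q \<subseteq>\<^sub>M q'" for q q'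
  proof -
    obtain n s where n: "n \<in>\<^sub>M osucc (len q)" "s \<in>\<^sub>M funs n Y" "p \<subseteq>\<^sub>M s" "state s n = state q n"
      using q(2) unfolding M_def by blast
    have nw: "n \<in>\<^sub>M omega" using n(1) nat_trans(1)[OF osucc_omega[OF sq_len(1)[OF q(1)]]] by blast
    have nq: "n \<subseteq>\<^sub>M len q" using n(1) nat_subset_iff[OF nw sq_len(1)[OF q(1)]] by blast
    have "n \<subseteq>\<^sub>M len q'" using nq prefix_len[OF q(1) q'] subset_trans by blast
    then have "n \<in>\<^sub>M osucc (len q')" using nat_subset_iff[OF nw sq_len(1)[OF q'(1)]] by blast
    moreover have "q \<bullet> i = q' \<bullet> i" if "i \<in>\<^sub>M n" for i
      using prefix_ap[OF q(1) sq_len(2)[OF q'(1)] q'(2), of i] nq that unfolding subset_def by simp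
    then have "state q n = state q' n" using state_cong[OF nw] by blast
    ultimately show ?thesis using n unfolding M_def by metis
  qed
  have R_open: "R a s q'" if a: "a \<in>\<^sub>M omega" "s \<in>\<^sub>M sq Y" and q: "q \<in>\<^sub>M sq Y" "R a s q"
    and q': "q' \<in>\<^sub>M sq Y" "q \<subseteq>\<^sub>M q'" for a s q q'
  proof -
    note ov = rs_ovr[OF a(2)]
    have ls: "len q \<subseteq>\<^sub>M len q'" by (rule prefix_len[OF q(1) q'])
    have "rs (ovr s q) (len q) \<subseteq>\<^sub>M rs (ovr s q') (len q')"
      unfolding fun_subset_iff[OF ov(1)[OF q(1)] ov(1)[OF q'(1)]]
      using ls ov(2)[OF q(1)] ov(2)[OF q'(1)] prefix_ap[OF q(1) sq_len(2)[OF q'(1)] q'(2)]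
      unfolding subset_def by simp
    moreover have "rs (ovr s q') (len q') \<in>\<^sub>M sq Y"
      using ov(1)[OF q'(1)] sq_len(1)[OF q'(1)] by (auto simp: mem_sq)
    moreover have "dense_open Y (\<O> \<bullet> a)" using \<O> a unfolding dense_family_def by blast
    ultimately have "rs (ovr s q') (len q') \<in>\<^sub>M \<O> \<bullet> a"
      using q(2) unfolding dense_open_def R_def by blast
    then show ?thesis using q(2) ls unfolding R_def subset_def by blast
  qed
  have fam: "dense_family Y \<P>"
    unfolding dense_family_def dense_open_def
  proof (intro allI impI conjI)
    fix k assume k: "k \<in>\<^sub>M omega"
    show "\<P> \<bullet> k \<subseteq>\<^sub>M sq Y" by (simp add: subset_def P[OF k])
    show "q \<in>\<^sub>M \<P> \<bullet> k" if "r \<in>\<^sub>M \<P> \<bullet> k" "q \<in>\<^sub>M sq Y" "r \<subseteq>\<^sub>M q" for r q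
      using that M_open R_open unfolding P[OF k] by blast
    fix q assume q: "q \<in>\<^sub>M sq Y"
    obtain q' n s where q': "q' \<in>\<^sub>M sq Y" "q \<subseteq>\<^sub>M q'" and "n \<in>\<^sub>M osucc (len q')" "s \<in>\<^sub>M funs n Y"
      "p \<subseteq>\<^sub>M s" "state s n = state q' n"
      using merge_dense[OF D p[unfolded Y_def] q[unfolded Y_def]] unfolding Y_def .
    then have Mq': "M q'" unfolding M_def by blast
    show "\<exists>r. r \<in>\<^sub>M \<P> \<bullet> k \<and> q \<subseteq>\<^sub>M r"
    proof (cases "\<exists>a s. a \<in>\<^sub>M omega \<and> s \<in>\<^sub>M sq Y \<and> k = J a (d \<bullet> s)")
      case True
      then obtain a s where a: "a \<in>\<^sub>M omega" "s \<in>\<^sub>M sq Y" "k = J a (d \<bullet> s)" by blast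
      have "dense_open Y (\<O> \<bullet> a)" using \<O> a unfolding dense_family_def by blast
      from override_dense[OF this a(2) y q'(1)] obtain r where
        r: "r \<in>\<^sub>M sq Y" "q' \<subseteq>\<^sub>M r" "len s \<in>\<^sub>M len r" "rs (ovr s r) (len r) \<in>\<^sub>M \<O> \<bullet> a" .
      have "a' = a \<and> s' = s" if "a' \<in>\<^sub>M omega" "s' \<in>\<^sub>M sq Y" "k = J a' (d \<bullet> s')" for a' s'
      proof -
        have "a' = a" "d \<bullet> s' = d \<bullet> s"
          using J_inject[OF that(1) dw[OF that(2)] a(1) dw[OF a(2)]] that(3) a(3) by auto
        then show ?thesis using d that(2) a(2) unfolding ctb_def by blast
      qed
      moreover have "M r" using M_open[OF q'(1) Mq' r(1,2)] .
      ultimately have "r \<in>\<^sub>M \<P> \<bullet> k" using r unfolding P[OF k] R_def by blast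
      then show ?thesis using q'(2) r(2) subset_trans by blast
    next
      case False
      then have "q' \<in>\<^sub>M \<P> \<bullet> k" using q'(1) Mq' unfolding P[OF k] by blast
      then show ?thesis using q'(2) by blast
    qed
  qed
  have main: "(emission w \<in>\<^sub>M A) = b" "emission w \<in>\<^sub>M cantor" if w: "generic Y \<P> w" for w
  proof -
    have wY: "w \<in>\<^sub>M funs omega Y" using w unfolding generic_def by blast
    obtain N where N: "N \<in>\<^sub>M omega" "rs w N \<in>\<^sub>M \<P> \<bullet> emp"
      using w emp_omega unfolding generic_def by blast
    then have "M (rs w N)" using P[OF emp_omega] by blast
    then obtain n s where n: "n \<in>\<^sub>M osucc N" "s \<in>\<^sub>M funs n Y" "p \<subseteq>\<^sub>M s" "state s n = state (rs w N) n"
      unfolding M_def len_rs[OF wY N(1)] by blast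
    have nw: "n \<in>\<^sub>M omega" using n(1) nat_trans(1)[OF osucc_omega[OF N(1)]] by blast
    have nN: "n \<subseteq>\<^sub>M N" using n(1) nat_subset_iff[OF nw N(1)] by blast
    have s: "s \<in>\<^sub>M sq Y" "len s = n" using n(2) nw len_eq by (auto simp: mem_sq)
    define v where "v = ovr s w"
    have vY: "v \<in>\<^sub>M funs omega Y" "s \<subseteq>\<^sub>M v"
      unfolding v_def using ovr_funs[OF s(1) wY] ovr_prefix[OF s(1) wY] by blast+
    have v_ap: "v \<bullet> i = (if i \<in>\<^sub>M n then s \<bullet> i else w \<bullet> i)" if "i \<in>\<^sub>M omega" for i
      unfolding v_def using ovr_ap[OF that, of s w] s(2) by simp
    have "generic Y \<O> v"
      unfolding generic_def
    proof (intro conjI allI impI vY(1))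
      fix a assume a: "a \<in>\<^sub>M omega"
      let ?k = "J a (d \<bullet> s)"
      have k: "?k \<in>\<^sub>M omega" using a dw[OF s(1)] by simp
      then obtain m where m: "m \<in>\<^sub>M omega" "rs w m \<in>\<^sub>M \<P> \<bullet> ?k" using w unfolding generic_def by blast
      then have "R a s (rs w m)" using P[OF k] a s(1) by blast
      then have "rs (ovr s (rs w m)) m \<in>\<^sub>M \<O> \<bullet> a" unfolding R_def len_rs[OF wY m(1)] by blast
      moreover have "rs (ovr s (rs w m)) m = rs v m"
        unfolding rs_eq_iff
      proof (intro allI impI)
        fix i assume i: "i \<in>\<^sub>M m"
        then have "i \<in>\<^sub>M omega" using nat_trans(1)[OF m(1)] by blast
        then show "ovr s (rs w m) \<bullet> i = v \<bullet> i" unfolding v_def using i by (simp add: ovr_ap)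
      qed
      ultimately show "\<exists>m. m \<in>\<^sub>M omega \<and> rs v m \<in>\<^sub>M \<O> \<bullet> a" using m(1) by auto
    qed
    then have b: "(emission v \<in>\<^sub>M A) = b" using bm n(3) vY(2) subset_trans by blast
    have "state v n = state s n" using v_ap nat_trans(1)[OF nw] by (intro state_cong[OF nw]) simp
    also have "\<dots> = state w n"
      unfolding n(4) using nN by (intro state_cong[OF nw]) (simp add: subset_def)
    finally have "E0r (emission v) (emission w)"
      by (intro emission_merge[OF nw]) (simp_all add: v_ap)
    moreover have cw: "emission w \<in>\<^sub>M cantor" and "emission v \<in>\<^sub>M cantor"
      using emission_cantor[OF D] wY vY(1) unfolding Y_def by blast+
    ultimately have "emission v \<in>\<^sub>M A \<longleftrightarrow> emission w \<in>\<^sub>M A" using A E0r_sym by blast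
    then show "(emission w \<in>\<^sub>M A) = b" "emission w \<in>\<^sub>M cantor" using b cw by auto
  qed
  show ?thesis
  proof (cases b)
    case True
    then have "large D A" unfolding large_def Y_def[symmetric] using fam main by blast
    then show ?thesis ..
  next
    case False
    then have "large D (diff cantor A)" unfolding large_def Y_def[symmetric] mem_diff using fam main by blast
    then show ?thesis ..
  qed
qed

end

section \<open>Relative computability\<close>

context set_structure
begin

text \<open>\<open>rec_closed\<close> and \<open>\<le>\<^sub>T\<close> with the total application, to which the definability rules apply.\<close>

definition rec_closed' :: "'a \<Rightarrow> 'a \<Rightarrow> bool" where
  "rec_closed' z C \<longleftrightarrow>
     (\<forall>k \<in> elts omega. \<forall>f \<in> elts (ops k). (\<forall>a \<in> elts (tuples k). f \<bullet> a = emp) \<longrightarrow> f \<in>\<^sub>M C) \<and>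
     (\<forall>f \<in> elts (ops one). (\<forall>a \<in> elts (tuples one). f \<bullet> a = osucc (a \<bullet> emp)) \<longrightarrow> f \<in>\<^sub>M C) \<and>
     (\<forall>k \<in> elts omega. \<forall>i \<in> elts k. \<forall>f \<in> elts (ops k).
        (\<forall>a \<in> elts (tuples k). f \<bullet> a = a \<bullet> i) \<longrightarrow> f \<in>\<^sub>M C) \<and>
     (\<forall>f \<in> elts (ops one). (\<forall>a \<in> elts (tuples one). f \<bullet> a = z \<bullet> (a \<bullet> emp)) \<longrightarrow> f \<in>\<^sub>M C) \<and>
     (\<forall>k \<in> elts omega. \<forall>m \<in> elts omega. \<forall>f \<in> elts (ops k).
        \<forall>h \<in> elts (inter C (ops m)). \<forall>G \<in> elts (funs m (inter C (ops k))).
        (\<forall>a \<in> elts (tuples k). \<forall>b \<in> elts (tuples m).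
           (\<forall>i \<in> elts m. b \<bullet> i = (G \<bullet> i) \<bullet> a) \<longrightarrow> f \<bullet> a = h \<bullet> b) \<longrightarrow> f \<in>\<^sub>M C) \<and>
     (\<forall>k \<in> elts omega. \<forall>f \<in> elts (ops (osucc k)).
        \<forall>g \<in> elts (inter C (ops k)). \<forall>h \<in> elts (inter C (ops (osucc (osucc k)))).
        (\<forall>a \<in> elts (tuples k). f \<bullet> snoc k a emp = g \<bullet> a \<and>
           (\<forall>n \<in> elts omega.
              f \<bullet> snoc k a (osucc n) = h \<bullet> snoc (osucc k) (snoc k a n) (f \<bullet> snoc k a n)))
        \<longrightarrow> f \<in>\<^sub>M C) \<and>
     (\<forall>k \<in> elts omega. \<forall>f \<in> elts (ops k). \<forall>g \<in> elts (inter C (ops (osucc k))).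
        (\<forall>a \<in> elts (tuples k). g \<bullet> snoc k a (f \<bullet> a) = emp \<and>
           (\<forall>n \<in> elts (f \<bullet> a). g \<bullet> snoc k a n \<noteq> emp)) \<longrightarrow> f \<in>\<^sub>M C)"

definition turing_le' :: "'a \<Rightarrow> 'a \<Rightarrow> bool" where
  "turing_le' x z \<longleftrightarrow> (\<forall>C. rec_closed' z C \<longrightarrow>
     (\<exists>f. f \<in>\<^sub>M C \<and> f \<in>\<^sub>M ops one \<and> (\<forall>a \<in> elts (tuples one). f \<bullet> a = x \<bullet> (a \<bullet> emp))))"

text \<open>The case distinction as a ternary operation on numbers. The tested number comes last
  because it is the recursion variable when \<open>ifz\<close> is derived by primitive
  recursion.\<close>

definition ifz :: "'a \<Rightarrow> 'a \<Rightarrow> 'a \<Rightarrow> 'a" where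
  "ifz u v n = (if n = emp then u else v)"

text \<open>A recursive function is handled as an operation \<open>F\<close> of HOL, so that
  composite expressions can be written down directly. Definability of \<open>F\<close> is what turns
  it into an element of the structure.\<close>

definition RK :: "'a \<Rightarrow> 'a \<Rightarrow> ('a \<Rightarrow> 'a) \<Rightarrow> bool" where
  "RK C k F \<longleftrightarrow> (\<forall>a. tm a \<longrightarrow> tm (\<lambda>s. F (a s))) \<and>
     (\<forall>a. a \<in>\<^sub>M tuples k \<longrightarrow> F a \<in>\<^sub>M omega) \<and> lam (tuples k) F \<in>\<^sub>M C"

end

context ZF_model
begin

lemma tm_tuples [fos]: "tm k \<Longrightarrow> tm (\<lambda>s. tuples (k s))"
  unfolding tuples_def by (intro fos | assumption)+

lemma tm_ops [fos]: "tm k \<Longrightarrow> tm (\<lambda>s. ops (k s))"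
  unfolding ops_def by (intro fos | assumption)+

lemma fo_rec_closed' [fos]: "tm z \<Longrightarrow> tm c \<Longrightarrow> fo (\<lambda>s. rec_closed' (z s) (c s))"
  unfolding rec_closed'_def by (intro fos tm_shift | assumption)+

lemma fo_turing_le' [fos]: "tm x \<Longrightarrow> tm z \<Longrightarrow> fo (\<lambda>s. turing_le' (x s) (z s))"
  unfolding turing_le'_def by (intro fos tm_shift | assumption)+

lemma tm_ifz [fos]: "tm a \<Longrightarrow> tm b \<Longrightarrow> tm c \<Longrightarrow> tm (\<lambda>s. ifz (a s) (b s) (c s))"
  unfolding ifz_def by (intro fos | assumption)+

lemma tuples_ap: "a \<in>\<^sub>M tuples k \<Longrightarrow> i \<in>\<^sub>M k \<Longrightarrow> a \<bullet> i \<in>\<^sub>M omega"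
  and tuples_app: "a \<in>\<^sub>M tuples k \<Longrightarrow> i \<in>\<^sub>M k \<Longrightarrow> a \<cdot> i = a \<bullet> i"
  unfolding tuples_def by (auto simp: app_eq_ap intro: ap_type)

lemma ops_ap: "f \<in>\<^sub>M ops k \<Longrightarrow> a \<in>\<^sub>M tuples k \<Longrightarrow> f \<bullet> a \<in>\<^sub>M omega"
  and ops_app: "f \<in>\<^sub>M ops k \<Longrightarrow> a \<in>\<^sub>M tuples k \<Longrightarrow> f \<cdot> a = f \<bullet> a"
  unfolding ops_def by (auto simp: app_eq_ap intro: ap_type)

lemma snoc_tuples:
  assumes "a \<in>\<^sub>M tuples k" "n \<in>\<^sub>M omega"
  shows "snoc k a n \<in>\<^sub>M tuples (osucc k)" "snoc k a n \<bullet> k = n" "i \<in>\<^sub>M k \<Longrightarrow> snoc k a n \<bullet> i = a \<bullet> i"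
  using snoc_funs[of a k omega n] assms unfolding tuples_def by blast+

lemma cantor_funs: "x \<in>\<^sub>M cantor \<Longrightarrow> x \<in>\<^sub>M funs omega omega"
  unfolding cantor_def by (erule funs_mono) (auto simp: subset_def)

lemma cantor_app: "x \<in>\<^sub>M cantor \<Longrightarrow> n \<in>\<^sub>M omega \<Longrightarrow> x \<cdot> n = x \<bullet> n"
  by (rule app_eq_ap[OF cantor_funs])

text \<open>With an oracle in Cantor space, every application in the definition has its argument in
  the domain of the function, and there the two kinds of application agree.\<close>

lemma rec_closed_iff:
  assumes z: "z \<in>\<^sub>M cantor"
  shows "rec_closed z C \<longleftrightarrow> rec_closed' z C"
proof -
  have G: "G \<cdot> i = G \<bullet> i" "G \<bullet> i \<in>\<^sub>M ops k" if "G \<in>\<^sub>M funs m (inter C (ops k))" "i \<in>\<^sub>M m" for G m k i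
    using app_eq_ap[OF that] ap_type[OF that] by simp_all
  have 5: "(G \<cdot> i) \<cdot> a = (G \<bullet> i) \<bullet> a"
    if "G \<in>\<^sub>M funs m (inter C (ops k))" "i \<in>\<^sub>M m" "a \<in>\<^sub>M tuples k" for G m k i a
    using G[OF that(1,2)] ops_app that(3) by simp
  have s1: "f \<cdot> snoc k a n = f \<bullet> snoc k a n" "f \<bullet> snoc k a n \<in>\<^sub>M omega"
    if "f \<in>\<^sub>M ops (osucc k)" "a \<in>\<^sub>M tuples k" "n \<in>\<^sub>M omega" for f k a n
    using ops_app[OF that(1)] ops_ap[OF that(1)] snoc_tuples(1)[OF that(2,3)] by blast+
  have s2: "h \<cdot> snoc (osucc k) (snoc k a n) m = h \<bullet> snoc (osucc k) (snoc k a n) m"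
    if "h \<in>\<^sub>M C \<and> h \<in>\<^sub>M ops (osucc (osucc k))" "a \<in>\<^sub>M tuples k" "n \<in>\<^sub>M omega" "m \<in>\<^sub>M omega" for h k a n m
    using ops_app[OF that(1)[THEN conjunct2]] snoc_tuples(1)[OF snoc_tuples(1)[OF that(2,3)] that(4)] by blast
  have s3: "g \<cdot> snoc k a n = g \<bullet> snoc k a n"
    if "g \<in>\<^sub>M C \<and> g \<in>\<^sub>M ops (osucc k)" "f \<in>\<^sub>M ops k" "a \<in>\<^sub>M tuples k" "n \<in>\<^sub>M f \<bullet> a" for g f k a n
    using s1(1)[OF that(1)[THEN conjunct2] that(3)] nat_trans(1)[OF ops_ap[OF that(2,3)] that(4)] by blast
  have s4: "g \<cdot> snoc k a n = g \<bullet> snoc k a n"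
    if "g \<in>\<^sub>M C \<and> g \<in>\<^sub>M ops (osucc k)" "a \<in>\<^sub>M tuples k" "n \<in>\<^sub>M omega" for g k a n
    using s1(1)[OF that(1)[THEN conjunct2] that(2,3)] .
  have 4: "z \<cdot> (a \<bullet> emp) = z \<bullet> (a \<bullet> emp)" if "a \<in>\<^sub>M tuples one" for a
    using tuples_ap[OF that, of emp] cantor_app[OF z] by simp
  show ?thesis
    unfolding rec_closed_def rec_closed'_def
    by (intro arg_cong2[of _ _ _ _ "(\<and>)"] ball_cong imp_cong refl; (simp only: mem_Collect_eq mem_inter)?; (elim conjE)?;
        simp only: mem_Collect_eq mem_inter ops_app ops_ap tuples_app 4 5 s1 s2 s3 s4 mem_one emp_omega osucc_omega)
qed

lemma turing_le_iff:
  assumes "x \<in>\<^sub>M cantor" "z \<in>\<^sub>M cantor"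
  shows "x \<le>\<^sub>T z \<longleftrightarrow> turing_le' x z"
proof -
  have "x \<cdot> (a \<cdot> emp) = x \<bullet> (a \<bullet> emp)" if "a \<in>\<^sub>M tuples one" for a
    using tuples_app[OF that, of emp] tuples_ap[OF that, of emp] cantor_app[OF assms(1)] by simp
  then show ?thesis
    unfolding turing_le_def turing_le'_def rec_closed_iff[OF assms(2)]
    using ops_app by (metis (no_types, lifting) mem_Collect_eq)
qed

lemma RK_lam:
  assumes "RK C k F"
  shows "tm (\<lambda>s. F (s 0))" "lam (tuples k) F \<in>\<^sub>M ops k" "lam (tuples k) F \<in>\<^sub>M C"
    "a \<in>\<^sub>M tuples k \<Longrightarrow> lam (tuples k) F \<bullet> a = F a" "a \<in>\<^sub>M tuples k \<Longrightarrow> F a \<in>\<^sub>M omega"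
proof -
  show 1: "tm (\<lambda>s. F (s 0))" using assms tm_var unfolding RK_def by blast
  show 2: "a \<in>\<^sub>M tuples k \<Longrightarrow> F a \<in>\<^sub>M omega" for a using assms unfolding RK_def by blast
  show "lam (tuples k) F \<in>\<^sub>M ops k" unfolding ops_def by (rule lam_funs[OF 1 2])
  show "lam (tuples k) F \<in>\<^sub>M C" using assms unfolding RK_def by blast
  show "a \<in>\<^sub>M tuples k \<Longrightarrow> lam (tuples k) F \<bullet> a = F a" by (rule ap_lam[OF 1])
qed

lemma turing_le_iff_RK:
  assumes x: "x \<in>\<^sub>M cantor" and z: "z \<in>\<^sub>M cantor"
  shows "x \<le>\<^sub>T z \<longleftrightarrow> (\<forall>C. rec_closed' z C \<longrightarrow> RK C one (\<lambda>a. x \<bullet> (a \<bullet> emp)))"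
proof -
  have t: "\<forall>a. tm a \<longrightarrow> tm (\<lambda>s. x \<bullet> (a s \<bullet> emp))" by (intro allI impI fos)
  have w: "x \<bullet> (a \<bullet> emp) \<in>\<^sub>M omega" if "a \<in>\<^sub>M tuples one" for a
    using tuples_ap[OF that, of emp] x by simp
  let ?F = "lam (tuples one) (\<lambda>a. x \<bullet> (a \<bullet> emp))"
  have F: "?F \<in>\<^sub>M ops one" "\<And>a. a \<in>\<^sub>M tuples one \<Longrightarrow> ?F \<bullet> a = x \<bullet> (a \<bullet> emp)"
    unfolding ops_def by (intro lam_funs ap_lam fos w | assumption)+
  have "(\<exists>f. f \<in>\<^sub>M C \<and> f \<in>\<^sub>M ops one \<and> (\<forall>a \<in> elts (tuples one). f \<bullet> a = x \<bullet> (a \<bullet> emp))) \<longleftrightarrow> ?F \<in>\<^sub>M C" for C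
  proof
    assume "\<exists>f. f \<in>\<^sub>M C \<and> f \<in>\<^sub>M ops one \<and> (\<forall>a \<in> elts (tuples one). f \<bullet> a = x \<bullet> (a \<bullet> emp))"
    then obtain f where f: "f \<in>\<^sub>M C" "f \<in>\<^sub>M ops one" "\<forall>a \<in> elts (tuples one). f \<bullet> a = x \<bullet> (a \<bullet> emp)" by blast
    have "f = ?F"
    proof (rule fun_ext)
      show "f \<in>\<^sub>M funs (tuples one) omega" "?F \<in>\<^sub>M funs (tuples one) omega"
        using f(2) F(1) unfolding ops_def by blast+
      show "f \<bullet> a = ?F \<bullet> a" if "a \<in>\<^sub>M tuples one" for a
        using f(3) that unfolding F(2)[OF that] by blast
    qed
    then show "?F \<in>\<^sub>M C" using f(1) by simp
  qed (use F in blast)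
  then show ?thesis
    unfolding turing_le_iff[OF x z] turing_le'_def RK_def using t w by simp
qed

text \<open>Only the oracle clause mentions the real, and it asks for the function that
  \<open>C\<close> is assumed to contain. Transitivity of Turing reducibility is an immediate
  consequence.\<close>

lemma rec_closed'_oracle:
  assumes C: "rec_closed' z C" and y: "RK C one (\<lambda>a. y \<bullet> (a \<bullet> emp))"
  shows "rec_closed' y C"
proof -
  have "\<forall>f \<in> elts (ops one). (\<forall>a \<in> elts (tuples one). f \<bullet> a = y \<bullet> (a \<bullet> emp)) \<longrightarrow> f \<in>\<^sub>M C"
  proof (intro ballI impI)
    fix f assume f: "f \<in> elts (ops one)" "\<forall>a \<in> elts (tuples one). f \<bullet> a = y \<bullet> (a \<bullet> emp)"
    have "f = lam (tuples one) (\<lambda>a. y \<bullet> (a \<bullet> emp))"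
    proof (rule fun_ext)
      show "f \<in>\<^sub>M funs (tuples one) omega" "lam (tuples one) (\<lambda>a. y \<bullet> (a \<bullet> emp)) \<in>\<^sub>M funs (tuples one) omega"
        using f(1) RK_lam(2)[OF y] unfolding ops_def by blast+
      show "f \<bullet> a = lam (tuples one) (\<lambda>a. y \<bullet> (a \<bullet> emp)) \<bullet> a" if "a \<in>\<^sub>M tuples one" for a
        using f(2) that unfolding RK_lam(4)[OF y that] by blast
    qed
    then show "f \<in>\<^sub>M C" using RK_lam(3)[OF y] by simp
  qed
  then show ?thesis
    using C unfolding rec_closed'_def by (elim conjE) (intro conjI; assumption)
qed

lemma turing_le_trans:
  assumes "x \<in>\<^sub>M cantor" "y \<in>\<^sub>M cantor" "z \<in>\<^sub>M cantor" "x \<le>\<^sub>T y" "y \<le>\<^sub>T z"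
  shows "x \<le>\<^sub>T z"
  using assms rec_closed'_oracle by (simp add: turing_le_iff_RK)

subsection \<open>Recursive functions\<close>

context
  fixes C z
  assumes C: "rec_closed' z C"
begin

lemmas C_unfolded = C[unfolded rec_closed'_def]
lemmas C_zero = C_unfolded[THEN conjunct1, rule_format, unfolded mem_Collect_eq]
lemmas C_succ = C_unfolded[THEN conjunct2, THEN conjunct1, rule_format, unfolded mem_Collect_eq]
lemmas C_proj = C_unfolded[THEN conjunct2, THEN conjunct2, THEN conjunct1,
    rule_format, unfolded mem_Collect_eq]
lemmas C_oracle = C_unfolded[THEN conjunct2, THEN conjunct2, THEN conjunct2, THEN conjunct1,
    rule_format, unfolded mem_Collect_eq]
lemmas C_comp = C_unfolded[THEN conjunct2, THEN conjunct2, THEN conjunct2, THEN conjunct2,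
    THEN conjunct1, rule_format, unfolded mem_Collect_eq]
lemmas C_primrec = C_unfolded[THEN conjunct2, THEN conjunct2, THEN conjunct2, THEN conjunct2,
    THEN conjunct2, THEN conjunct1, rule_format, unfolded mem_Collect_eq]
lemmas C_mu = C_unfolded[THEN conjunct2, THEN conjunct2, THEN conjunct2, THEN conjunct2,
    THEN conjunct2, THEN conjunct2, rule_format, unfolded mem_Collect_eq]

lemma RK_zero: "k \<in>\<^sub>M omega \<Longrightarrow> RK C k (\<lambda>a. emp)"
proof -
  assume k: "k \<in>\<^sub>M omega"
  have "lam (tuples k) (\<lambda>a. emp) \<in>\<^sub>M ops k" "\<And>a. a \<in>\<^sub>M tuples k \<Longrightarrow> lam (tuples k) (\<lambda>a. emp) \<bullet> a = emp"
    unfolding ops_def by (intro lam_funs ap_lam fos emp_omega | assumption)+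
  then have "lam (tuples k) (\<lambda>a. emp) \<in>\<^sub>M C" by (rule C_zero[OF k])
  then show ?thesis unfolding RK_def by (auto intro: fos)
qed

lemma RK_succ: "RK C one (\<lambda>a. osucc (a \<bullet> emp))"
proof -
  have "lam (tuples one) (\<lambda>a. osucc (a \<bullet> emp)) \<in>\<^sub>M ops one"
    "\<And>a. a \<in>\<^sub>M tuples one \<Longrightarrow> lam (tuples one) (\<lambda>a. osucc (a \<bullet> emp)) \<bullet> a = osucc (a \<bullet> emp)"
    unfolding ops_def by (intro lam_funs ap_lam fos osucc_omega | simp add: tuples_ap)+
  then have "lam (tuples one) (\<lambda>a. osucc (a \<bullet> emp)) \<in>\<^sub>M C" by (rule C_succ)
  then show ?thesis unfolding RK_def by (auto intro!: fos osucc_omega tuples_ap[of _ one emp])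
qed

lemma RK_oracle:
  assumes "z \<in>\<^sub>M cantor"
  shows "RK C one (\<lambda>a. z \<bullet> (a \<bullet> emp))"
proof -
  have "lam (tuples one) (\<lambda>a. z \<bullet> (a \<bullet> emp)) \<in>\<^sub>M ops one"
    "\<And>a. a \<in>\<^sub>M tuples one \<Longrightarrow> lam (tuples one) (\<lambda>a. z \<bullet> (a \<bullet> emp)) \<bullet> a = z \<bullet> (a \<bullet> emp)"
    unfolding ops_def by (intro lam_funs ap_lam fos | simp add: tuples_ap[of _ one emp] assms)+
  then have "lam (tuples one) (\<lambda>a. z \<bullet> (a \<bullet> emp)) \<in>\<^sub>M C" by (rule C_oracle)
  then show ?thesis unfolding RK_def by (auto intro!: fos cantor_ap[OF assms] tuples_ap[of _ one emp])
qed

lemma RK_proj: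
  assumes "k \<in>\<^sub>M omega" "i \<in>\<^sub>M k"
  shows "RK C k (\<lambda>a. a \<bullet> i)"
proof -
  have "lam (tuples k) (\<lambda>a. a \<bullet> i) \<in>\<^sub>M ops k"
    "\<And>a. a \<in>\<^sub>M tuples k \<Longrightarrow> lam (tuples k) (\<lambda>a. a \<bullet> i) \<bullet> a = a \<bullet> i"
    unfolding ops_def by (intro lam_funs ap_lam fos | simp add: tuples_ap[OF _ assms(2)])+
  then have "lam (tuples k) (\<lambda>a. a \<bullet> i) \<in>\<^sub>M C" by (rule C_proj[OF assms])
  then show ?thesis unfolding RK_def by (auto intro!: fos tuples_ap[OF _ assms(2)])
qed

text \<open>The inner functions are indexed by an internal number \<open>m\<close>, possibly
  nonstandard. They are therefore given by a definable operation \<open>G\<close>, not by a list in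
  HOL.\<close>

lemma RK_comp:
  assumes k: "k \<in>\<^sub>M omega" and m: "m \<in>\<^sub>M omega" and h: "RK C m h"
    and G: "tm (\<lambda>s. G (s 0))" "\<And>i. i \<in>\<^sub>M m \<Longrightarrow> G i \<in>\<^sub>M C" "\<And>i. i \<in>\<^sub>M m \<Longrightarrow> G i \<in>\<^sub>M ops k"
    and F: "\<And>a. tm a \<Longrightarrow> tm (\<lambda>s. F (a s))"
      "\<And>a. a \<in>\<^sub>M tuples k \<Longrightarrow> \<exists>b. b \<in>\<^sub>M tuples m \<and> (\<forall>i. i \<in>\<^sub>M m \<longrightarrow> b \<bullet> i = G i \<bullet> a) \<and> F a = h b"
  shows "RK C k F"
proof -
  have F0: "tm (\<lambda>s. F (s 0))" by (rule F(1)[OF tm_var])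
  have Fw: "F a \<in>\<^sub>M omega" if "a \<in>\<^sub>M tuples k" for a
    using F(2)[OF that] RK_lam(5)[OF h] by metis
  have f: "lam (tuples k) F \<in>\<^sub>M ops k" unfolding ops_def by (rule lam_funs[OF F0 Fw])
  let ?G = "lam m G"
  have G': "?G \<in>\<^sub>M funs m (inter C (ops k))" using G by (intro lam_funs) simp_all
  have Gi: "lam m G \<bullet> i = G i" if "i \<in>\<^sub>M m" for i using G(1) that by (rule ap_lam)
  have "lam (tuples k) F \<in>\<^sub>M C"
  proof (rule C_comp[OF k m f _ G'])
    show "lam (tuples m) h \<in>\<^sub>M inter C (ops m)" using RK_lam(2,3)[OF h] by simp
    fix a b
    assume a: "a \<in>\<^sub>M tuples k" and b: "b \<in>\<^sub>M tuples m" "\<And>i. i \<in>\<^sub>M m \<Longrightarrow> b \<bullet> i = (?G \<bullet> i) \<bullet> a"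
    obtain b' where b': "b' \<in>\<^sub>M tuples m" "\<And>i. i \<in>\<^sub>M m \<Longrightarrow> b' \<bullet> i = G i \<bullet> a" "F a = h b'"
      using F(2)[OF a] by blast
    have "b' = b"
      by (rule fun_ext[OF b'(1)[unfolded tuples_def] b(1)[unfolded tuples_def]]) (simp add: b b' Gi)
    then show "lam (tuples k) F \<bullet> a = lam (tuples m) h \<bullet> b"
      using b'(3) ap_lam[OF F0 a] RK_lam(4)[OF h b(1)] by simp
  qed
  then show ?thesis unfolding RK_def using F(1) Fw by blast
qed

lemma RK_primrec:
  assumes k: "k \<in>\<^sub>M omega" and G: "RK C k G" and H: "RK C (osucc (osucc k)) H"
    and F: "\<And>a. tm a \<Longrightarrow> tm (\<lambda>s. F (a s))" "\<And>a. a \<in>\<^sub>M tuples (osucc k) \<Longrightarrow> F a \<in>\<^sub>M omega"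
      "\<And>a. a \<in>\<^sub>M tuples k \<Longrightarrow> F (snoc k a emp) = G a"
      "\<And>a n. a \<in>\<^sub>M tuples k \<Longrightarrow> n \<in>\<^sub>M omega \<Longrightarrow>
        F (snoc k a (osucc n)) = H (snoc (osucc k) (snoc k a n) (F (snoc k a n)))"
  shows "RK C (osucc k) F"
proof -
  have F0: "tm (\<lambda>s. F (s 0))" by (rule F(1)[OF tm_var])
  let ?f = "lam (tuples (osucc k)) F" and ?g = "lam (tuples k) G" and ?h = "lam (tuples (osucc (osucc k))) H"
  have f: "?f \<in>\<^sub>M ops (osucc k)" unfolding ops_def by (rule lam_funs[OF F0 F(2)])
  have fa: "?f \<bullet> snoc k a n = F (snoc k a n)" if "a \<in>\<^sub>M tuples k" "n \<in>\<^sub>M omega" for a n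
    using ap_lam[OF F0 snoc_tuples(1)[OF that]] .
  have "?f \<in>\<^sub>M C"
  proof (rule C_primrec[OF k f])
    show "?g \<in>\<^sub>M inter C (ops k)" "?h \<in>\<^sub>M inter C (ops (osucc (osucc k)))"
      using RK_lam(2,3)[OF G] RK_lam(2,3)[OF H] by simp_all
    fix a assume a: "a \<in>\<^sub>M tuples k"
    have "?f \<bullet> snoc k a emp = ?g \<bullet> a" using fa[OF a] F(3)[OF a] RK_lam(4)[OF G a] by simp
    moreover have "?f \<bullet> snoc k a (osucc n) = ?h \<bullet> snoc (osucc k) (snoc k a n) (?f \<bullet> snoc k a n)"
      if n: "n \<in>\<^sub>M omega" for n
    proof -
      have "F (snoc k a n) \<in>\<^sub>M omega" using F(2) snoc_tuples(1)[OF a n] by blast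
      then show ?thesis
        using fa[OF a] F(4)[OF a n] RK_lam(4)[OF H] snoc_tuples(1)[OF snoc_tuples(1)[OF a n]] n by simp
    qed
    ultimately show "?f \<bullet> snoc k a emp = ?g \<bullet> a \<and> (\<forall>n \<in> elts omega.
      ?f \<bullet> snoc k a (osucc n) = ?h \<bullet> snoc (osucc k) (snoc k a n) (?f \<bullet> snoc k a n))" by blast
  qed
  then show ?thesis unfolding RK_def using F(1,2) by blast
qed

lemma RK_mu:
  assumes k: "k \<in>\<^sub>M omega" and G: "RK C (osucc k) G"
    and F: "\<And>a. tm a \<Longrightarrow> tm (\<lambda>s. F (a s))" "\<And>a. a \<in>\<^sub>M tuples k \<Longrightarrow> F a \<in>\<^sub>M omega"
      "\<And>a. a \<in>\<^sub>M tuples k \<Longrightarrow> G (snoc k a (F a)) = emp"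
      "\<And>a n. a \<in>\<^sub>M tuples k \<Longrightarrow> n \<in>\<^sub>M F a \<Longrightarrow> G (snoc k a n) \<noteq> emp"
  shows "RK C k F"
proof -
  have F0: "tm (\<lambda>s. F (s 0))" by (rule F(1)[OF tm_var])
  let ?f = "lam (tuples k) F" and ?g = "lam (tuples (osucc k)) G"
  have f: "?f \<in>\<^sub>M ops k" unfolding ops_def by (rule lam_funs[OF F0 F(2)])
  have "?f \<in>\<^sub>M C"
  proof (rule C_mu[OF k f])
    show "?g \<in>\<^sub>M inter C (ops (osucc k))" using RK_lam(2,3)[OF G] by simp
    fix a assume a: "a \<in>\<^sub>M tuples k"
    have fa: "?f \<bullet> a = F a" by (rule ap_lam[OF F0 a])
    have ga: "?g \<bullet> snoc k a n = G (snoc k a n)" if "n \<in>\<^sub>M omega" for n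
      using RK_lam(4)[OF G snoc_tuples(1)[OF a that]] .
    show "?g \<bullet> snoc k a (?f \<bullet> a) = emp \<and> (\<forall>n \<in> elts (?f \<bullet> a). ?g \<bullet> snoc k a n \<noteq> emp)"
      unfolding fa using ga F(2,3,4)[OF a] nat_trans(1)[OF F(2)[OF a]] by simp
  qed
  then show ?thesis unfolding RK_def using F(1,2) by blast
qed

end

end

section \<open>Primitive recursive operations in a closed class\<close>

context ZF_model
begin

lemma RK_cong:
  assumes "RK C k F" "\<And>a. tm a \<Longrightarrow> tm (\<lambda>s. F' (a s))" "\<And>a. a \<in>\<^sub>M tuples k \<Longrightarrow> F' a = F a"
  shows "RK C k F'"
proof -
  have "lam (tuples k) F' = lam (tuples k) F"
  proof (rule fun_ext)
    show "lam (tuples k) F \<in>\<^sub>M funs (tuples k) omega" using RK_lam(2)[OF assms(1)] unfolding ops_def .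
    show "lam (tuples k) F' \<in>\<^sub>M funs (tuples k) omega"
      using assms(2)[OF tm_var] assms(3) RK_lam(5)[OF assms(1)] by (intro lam_funs) simp_all
    show "lam (tuples k) F' \<bullet> a = lam (tuples k) F \<bullet> a" if "a \<in>\<^sub>M tuples k" for a
      using ap_lam[OF assms(2)[OF tm_var] that] RK_lam(4)[OF assms(1) that] assms(3)[OF that] by simp
  qed
  then show ?thesis using assms unfolding RK_def by simp
qed

lemma tuples_emp: "emp \<in>\<^sub>M tuples emp"
  unfolding tuples_def by (simp add: mem_funs)

lemma tuple1: "u \<in>\<^sub>M omega \<Longrightarrow> \<exists>b. b \<in>\<^sub>M tuples one \<and> b \<bullet> emp = u"
  using snoc_tuples(1,2)[OF tuples_emp] unfolding one_def by blast

lemma tuple2: "u \<in>\<^sub>M omega \<Longrightarrow> v \<in>\<^sub>M omega \<Longrightarrow> \<exists>b. b \<in>\<^sub>M tuples two \<and> b \<bullet> emp = u \<and> b \<bullet> one = v"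
  using tuple1[of u] snoc_tuples[of _ one v] unfolding two_def by (metis mem_one)

lemma tuple3: "u \<in>\<^sub>M omega \<Longrightarrow> v \<in>\<^sub>M omega \<Longrightarrow> w \<in>\<^sub>M omega \<Longrightarrow>
  \<exists>b. b \<in>\<^sub>M tuples (osucc two) \<and> b \<bullet> emp = u \<and> b \<bullet> one = v \<and> b \<bullet> two = w"
  using tuple2[of u v] snoc_tuples[of _ two w] by (metis mem_two)

lemma three_omega: "osucc two \<in>\<^sub>M omega" by simp

context
  fixes C z
  assumes C: "rec_closed' z C"
begin

lemma RK_comp1:
  assumes f: "RK C one (\<lambda>a. f (a \<bullet> emp))" "\<And>a. tm a \<Longrightarrow> tm (\<lambda>s. f (a s))"
    and k: "k \<in>\<^sub>M omega" and A: "RK C k A"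
  shows "RK C k (\<lambda>a. f (A a))"
proof (rule RK_comp[OF C k one_omega f(1), of "\<lambda>i. lam (tuples k) A"])
  have A': "\<And>a. tm a \<Longrightarrow> tm (\<lambda>s. A (a s))" using A unfolding RK_def by blast
  show "tm (\<lambda>s. f (A (a s)))" if "tm a" for a by (intro f(2) A' that)
  show "\<exists>b. b \<in>\<^sub>M tuples one \<and> (\<forall>i. i \<in>\<^sub>M one \<longrightarrow> b \<bullet> i = lam (tuples k) A \<bullet> a) \<and> f (A a) = f (b \<bullet> emp)"
    if "a \<in>\<^sub>M tuples k" for a
    using tuple1[OF RK_lam(5)[OF A that]] RK_lam(4)[OF A that] by auto
qed (use RK_lam[OF A] in \<open>auto intro: fos\<close>)

lemma RK_comp2:
  assumes f: "RK C two (\<lambda>a. f (a \<bullet> emp) (a \<bullet> one))" "\<And>a b. tm a \<Longrightarrow> tm b \<Longrightarrow> tm (\<lambda>s. f (a s) (b s))"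
    and k: "k \<in>\<^sub>M omega" and A: "RK C k A" and B: "RK C k B"
  shows "RK C k (\<lambda>a. f (A a) (B a))"
proof (rule RK_comp[OF C k two_omega f(1), of "\<lambda>i. if i = emp then lam (tuples k) A else lam (tuples k) B"])
  have AB: "\<And>a. tm a \<Longrightarrow> tm (\<lambda>s. A (a s))" "\<And>a. tm a \<Longrightarrow> tm (\<lambda>s. B (a s))"
    using A B unfolding RK_def by blast+
  show "tm (\<lambda>s. f (A (a s)) (B (a s)))" if "tm a" for a by (intro f(2) AB that)
  show "\<exists>b. b \<in>\<^sub>M tuples two \<and> (\<forall>i. i \<in>\<^sub>M two \<longrightarrow>
      b \<bullet> i = (if i = emp then lam (tuples k) A else lam (tuples k) B) \<bullet> a) \<and> f (A a) (B a) = f (b \<bullet> emp) (b \<bullet> one)"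
    if "a \<in>\<^sub>M tuples k" for a
    using tuple2[OF RK_lam(5)[OF A that] RK_lam(5)[OF B that]] RK_lam(4)[OF A that] RK_lam(4)[OF B that] by auto
  show "tm (\<lambda>s. if s 0 = emp then lam (tuples k) A else lam (tuples k) B)" by (intro fos)
qed (use RK_lam[OF A] RK_lam[OF B] in auto)

lemma RK_comp3:
  assumes f: "RK C (osucc two) (\<lambda>a. f (a \<bullet> emp) (a \<bullet> one) (a \<bullet> two))"
      "\<And>a b c. tm a \<Longrightarrow> tm b \<Longrightarrow> tm c \<Longrightarrow> tm (\<lambda>s. f (a s) (b s) (c s))"
    and k: "k \<in>\<^sub>M omega" and A: "RK C k A" and B: "RK C k B" and D: "RK C k D"
  shows "RK C k (\<lambda>a. f (A a) (B a) (D a))"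
proof (rule RK_comp[OF C k osucc_omega[OF two_omega] f(1),
      of "\<lambda>i. if i = emp then lam (tuples k) A else if i = one then lam (tuples k) B else lam (tuples k) D"])
  have ABD: "\<And>a. tm a \<Longrightarrow> tm (\<lambda>s. A (a s))" "\<And>a. tm a \<Longrightarrow> tm (\<lambda>s. B (a s))" "\<And>a. tm a \<Longrightarrow> tm (\<lambda>s. D (a s))"
    using A B D unfolding RK_def by blast+
  have ne: "two \<noteq> emp" "two \<noteq> one" by (simp_all add: two_def one_def)
  show "tm (\<lambda>s. f (A (a s)) (B (a s)) (D (a s)))" if "tm a" for a by (intro f(2) ABD that)
  show "\<exists>b. b \<in>\<^sub>M tuples (osucc two) \<and> (\<forall>i. i \<in>\<^sub>M osucc two \<longrightarrow> b \<bullet> i =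
      (if i = emp then lam (tuples k) A else if i = one then lam (tuples k) B else lam (tuples k) D) \<bullet> a) \<and>
      f (A a) (B a) (D a) = f (b \<bullet> emp) (b \<bullet> one) (b \<bullet> two)"
    if "a \<in>\<^sub>M tuples k" for a
    using tuple3[OF RK_lam(5)[OF A that] RK_lam(5)[OF B that] RK_lam(5)[OF D that]] ne
      RK_lam(4)[OF A that] RK_lam(4)[OF B that] RK_lam(4)[OF D that] by auto
  show "tm (\<lambda>s. if s 0 = emp then lam (tuples k) A else if s 0 = one then lam (tuples k) B else lam (tuples k) D)"
    by (intro fos)
qed (use RK_lam[OF A] RK_lam[OF B] RK_lam[OF D] in auto)

lemma RK_osucc: "k \<in>\<^sub>M omega \<Longrightarrow> RK C k A \<Longrightarrow> RK C k (\<lambda>a. osucc (A a))"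
  by (rule RK_comp1[OF RK_succ[OF C]]) (intro fos)

text \<open>The number \<open>c\<close> may be nonstandard and is then not reached by iterating the
  successor rule in HOL. The induction is internal, on membership of the constant function in
  \<open>C\<close>.\<close>

lemma RK_const:
  assumes k: "k \<in>\<^sub>M omega" and c: "c \<in>\<^sub>M omega"
  shows "RK C k (\<lambda>a. c)"
proof -
  have *: "RK C k (\<lambda>a. c) \<longleftrightarrow> lam (tuples k) (\<lambda>a. c) \<in>\<^sub>M C" if "c \<in>\<^sub>M omega" for c
    unfolding RK_def using that by (auto intro: fos)
  have "lam (tuples k) (\<lambda>a. c) \<in>\<^sub>M C"
    using c
  proof (induction rule: nat_induct)
    case emp
    show ?case using RK_zero[OF C k] *[of emp] by simp
  next
    case (osucc n)
    then have "RK C k (\<lambda>a. n)" using * by blast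
    then show ?case using RK_osucc[OF k] * osucc_omega osucc(1) by blast
  qed (intro fos)
  then show ?thesis using * c by blast
qed

lemma RK_ifz:
  assumes k: "k \<in>\<^sub>M omega" and A: "RK C k A" "RK C k B" "RK C k D"
  shows "RK C k (\<lambda>a. ifz (A a) (B a) (D a))"
proof (rule RK_comp3[OF _ _ k A])
  show "tm (\<lambda>s. ifz (a s) (b s) (c s))" if "tm a" "tm b" "tm c" for a b c using that by (intro fos)
  show "RK C (osucc two) (\<lambda>a. ifz (a \<bullet> emp) (a \<bullet> one) (a \<bullet> two))"
  proof (rule RK_primrec[OF C two_omega])
    show "RK C two (\<lambda>a. a \<bullet> emp)" by (rule RK_proj[OF C]) simp_all
    show "RK C (osucc (osucc two)) (\<lambda>a. a \<bullet> one)" by (rule RK_proj[OF C]) simp_all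
    show "tm (\<lambda>s. ifz (a s \<bullet> emp) (a s \<bullet> one) (a s \<bullet> two))" if "tm a" for a by (intro fos that)
    show "ifz (a \<bullet> emp) (a \<bullet> one) (a \<bullet> two) \<in>\<^sub>M omega" if "a \<in>\<^sub>M tuples (osucc two)" for a
      using tuples_ap[OF that] by (simp add: ifz_def)
    show "ifz (snoc two a emp \<bullet> emp) (snoc two a emp \<bullet> one) (snoc two a emp \<bullet> two) = a \<bullet> emp"
      if "a \<in>\<^sub>M tuples two" for a
      using snoc_tuples[OF that emp_omega] by (simp add: ifz_def)
    fix a n assume a: "a \<in>\<^sub>M tuples two" and n: "n \<in>\<^sub>M omega"
    define r where "r = ifz (snoc two a n \<bullet> emp) (snoc two a n \<bullet> one) (snoc two a n \<bullet> two)"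
    have "r \<in>\<^sub>M omega"
      unfolding r_def ifz_def using tuples_ap[OF snoc_tuples(1)[OF a n]] by simp
    then have "snoc (osucc two) (snoc two a n) r \<bullet> one = snoc two a n \<bullet> one"
      using snoc_tuples(3)[OF snoc_tuples(1)[OF a n]] by simp
    then show "ifz (snoc two a (osucc n) \<bullet> emp) (snoc two a (osucc n) \<bullet> one) (snoc two a (osucc n) \<bullet> two) =
      snoc (osucc two) (snoc two a n) (ifz (snoc two a n \<bullet> emp) (snoc two a n \<bullet> one) (snoc two a n \<bullet> two)) \<bullet> one"
      unfolding r_def[symmetric]
      using snoc_tuples(2,3)[OF a osucc_omega[OF n]] snoc_tuples(3)[OF a n] by (simp add: ifz_def)
  qed
qed

lemma RK_primrec2:
  assumes g: "RK C one (\<lambda>a. g (a \<bullet> emp))"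
    and h: "RK C (osucc two) (\<lambda>a. h (a \<bullet> emp) (a \<bullet> one) (a \<bullet> two))"
    and f: "\<And>a b. tm a \<Longrightarrow> tm b \<Longrightarrow> tm (\<lambda>s. f (a s) (b s))"
      "\<And>p n. p \<in>\<^sub>M omega \<Longrightarrow> n \<in>\<^sub>M omega \<Longrightarrow> f p n \<in>\<^sub>M omega"
      "\<And>p. p \<in>\<^sub>M omega \<Longrightarrow> f p emp = g p"
      "\<And>p n. p \<in>\<^sub>M omega \<Longrightarrow> n \<in>\<^sub>M omega \<Longrightarrow> f p (osucc n) = h p n (f p n)"
    and k: "k \<in>\<^sub>M omega" and A: "RK C k A" and B: "RK C k B"
  shows "RK C k (\<lambda>a. f (A a) (B a))"
proof (rule RK_comp2[OF _ f(1) k A B])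
  have h': "RK C (osucc (osucc one)) (\<lambda>a. h (a \<bullet> emp) (a \<bullet> one) (a \<bullet> osucc one))" using h unfolding two_def .
  show "RK C two (\<lambda>a. f (a \<bullet> emp) (a \<bullet> one))"
    unfolding two_def
  proof (rule RK_primrec[OF C one_omega g h'])
    fix a assume a: "a \<in>\<^sub>M tuples one"
    have p: "a \<bullet> emp \<in>\<^sub>M omega" using tuples_ap[OF a] by simp
    have s: "snoc one a n \<bullet> emp = a \<bullet> emp" "snoc one a n \<bullet> one = n" if "n \<in>\<^sub>M omega" for n
      using snoc_tuples[OF a that] by simp_all
    show "f (snoc one a emp \<bullet> emp) (snoc one a emp \<bullet> one) = g (a \<bullet> emp)" using s f(3)[OF p] by simp
    fix n assume n: "n \<in>\<^sub>M omega"
    have r: "f (a \<bullet> emp) n \<in>\<^sub>M omega" using f(2)[OF p n] .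
    have "snoc (osucc one) (snoc one a n) (f (a \<bullet> emp) n) \<bullet> emp = a \<bullet> emp"
      "snoc (osucc one) (snoc one a n) (f (a \<bullet> emp) n) \<bullet> one = n"
      "snoc (osucc one) (snoc one a n) (f (a \<bullet> emp) n) \<bullet> osucc one = f (a \<bullet> emp) n"
      using snoc_tuples[OF snoc_tuples(1)[OF a n] r] s[OF n] by simp_all
    then show "f (snoc one a (osucc n) \<bullet> emp) (snoc one a (osucc n) \<bullet> one) =
        h (snoc (osucc one) (snoc one a n) (f (snoc one a n \<bullet> emp) (snoc one a n \<bullet> one)) \<bullet> emp)
          (snoc (osucc one) (snoc one a n) (f (snoc one a n \<bullet> emp) (snoc one a n \<bullet> one)) \<bullet> one)
          (snoc (osucc one) (snoc one a n) (f (snoc one a n \<bullet> emp) (snoc one a n \<bullet> one)) \<bullet> osucc one)"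
      using s[OF n] s[OF osucc_omega[OF n]] f(4)[OF p n] by simp
  next
    show "tm (\<lambda>s. f (a s \<bullet> emp) (a s \<bullet> one))" if "tm a" for a by (intro f(1) fos that)
    show "f (a \<bullet> emp) (a \<bullet> one) \<in>\<^sub>M omega" if "a \<in>\<^sub>M tuples (osucc one)" for a
      using f(2) tuples_ap[OF that] by simp
  qed
qed

lemma RK_primrec1:
  assumes c: "c \<in>\<^sub>M omega"
    and h: "RK C (osucc two) (\<lambda>a. h (a \<bullet> one) (a \<bullet> two))"
    and f: "\<And>a. tm a \<Longrightarrow> tm (\<lambda>s. f (a s))"
      "\<And>n. n \<in>\<^sub>M omega \<Longrightarrow> f n \<in>\<^sub>M omega" "f emp = c"
      "\<And>n. n \<in>\<^sub>M omega \<Longrightarrow> f (osucc n) = h n (f n)"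
    and k: "k \<in>\<^sub>M omega" and A: "RK C k A"
  shows "RK C k (\<lambda>a. f (A a))"
  by (rule RK_primrec2[where f = "\<lambda>p. f" and g = "\<lambda>_. c" and h = "\<lambda>_. h", OF RK_const[OF one_omega c] h])
     (use assms in auto)

lemma RK_p3: "RK C (osucc two) (\<lambda>a. a \<bullet> emp)" "RK C (osucc two) (\<lambda>a. a \<bullet> one)" "RK C (osucc two) (\<lambda>a. a \<bullet> two)"
  by (rule RK_proj[OF C]; simp)+

lemma RK_prd: "k \<in>\<^sub>M omega \<Longrightarrow> RK C k A \<Longrightarrow> RK C k (\<lambda>a. prd (A a))"
  by (rule RK_primrec1[where c = emp and h = "\<lambda>n r. n"]) (simp_all add: RK_p3 fos)

lemma RK_dbl: "k \<in>\<^sub>M omega \<Longrightarrow> RK C k A \<Longrightarrow> RK C k (\<lambda>a. dbl (A a))"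
  by (rule RK_primrec1[where c = emp and h = "\<lambda>n r. osucc (osucc r)"])
     (simp_all add: RK_p3 RK_osucc fos)

lemma RK_add: "k \<in>\<^sub>M omega \<Longrightarrow> m \<in>\<^sub>M omega \<Longrightarrow> RK C k A \<Longrightarrow> RK C k (\<lambda>a. add m (A a))"
  by (rule RK_primrec1[where c = m and h = "\<lambda>n r. osucc r"])
     (simp_all add: RK_p3 RK_osucc fos)

lemma RK_par: "k \<in>\<^sub>M omega \<Longrightarrow> RK C k A \<Longrightarrow> RK C k (\<lambda>a. par (A a))"
  by (rule RK_primrec1[where c = emp and h = "\<lambda>n r. ifz one emp r"])
     (simp_all add: RK_p3 RK_ifz RK_const fos, simp add: ifz_def)

lemma RK_half: "k \<in>\<^sub>M omega \<Longrightarrow> RK C k A \<Longrightarrow> RK C k (\<lambda>a. half (A a))"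
  by (rule RK_primrec1[where c = emp and h = "\<lambda>n r. ifz r (osucc r) (par n)"])
     (simp_all add: RK_p3 RK_ifz RK_osucc RK_par fos, simp add: ifz_def)

context
  fixes x
  assumes x: "x \<in>\<^sub>M cantor" and Cx: "RK C one (\<lambda>a. x \<bullet> (a \<bullet> emp))"
begin

lemma RK_real: "k \<in>\<^sub>M omega \<Longrightarrow> RK C k A \<Longrightarrow> RK C k (\<lambda>a. x \<bullet> A a)"
  by (rule RK_comp1[OF Cx]) (intro fos)

lemma RK_K: "k \<in>\<^sub>M omega \<Longrightarrow> RK C k A \<Longrightarrow> RK C k (\<lambda>a. K x (A a))"
  by (rule RK_primrec1[where c = emp and h = "\<lambda>n r. ifz (osucc (dbl r)) (osucc (osucc (dbl r))) (x \<bullet> n)"])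
     (simp_all add: RK_p3 RK_ifz RK_osucc RK_dbl RK_real fos, simp add: ifz_def)

end

end

end

section \<open>Decoding the states from the emitted bits\<close>

context set_structure
begin

text \<open>
  \<open>trace w M i\<close> follows, from time \<open>M\<close> on, the position at which the states contain the bit that the
  state at time \<open>M\<close> has at position \<open>2 i\<close>.
\<close>

definition trace :: "'a \<Rightarrow> 'a \<Rightarrow> 'a \<Rightarrow> 'a \<Rightarrow> 'a" where
  "trace w M i t = nrec (dbl i) (\<lambda>t q.
     if pfst (w \<bullet> add M t) = emp then prd q
     else if pfst (w \<bullet> add M t) = one then dbl q else osucc (dbl q)) t"

end

context ZF_model
begin

lemma tm_trace [fos]:
  "tm a \<Longrightarrow> tm b \<Longrightarrow> tm c \<Longrightarrow> tm d \<Longrightarrow> tm (\<lambda>s. trace (a s) (b s) (c s) (d s))"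
  unfolding trace_def by (intro fos tm_shift | assumption)+

lemma trace_emp: "trace w M i emp = dbl i"
  and trace_osucc: "t \<in>\<^sub>M omega \<Longrightarrow> trace w M i (osucc t) =
    (if pfst (w \<bullet> add M t) = emp then prd (trace w M i t)
     else if pfst (w \<bullet> add M t) = one then dbl (trace w M i t) else osucc (dbl (trace w M i t)))"
  unfolding trace_def by ((rule nrec_emp nrec_osucc; (intro fos | assumption)+)+)

lemma trace_omega: "t \<in>\<^sub>M omega \<Longrightarrow> i \<in>\<^sub>M omega \<Longrightarrow> trace w M i t \<in>\<^sub>M omega"
  by (induction rule: nat_induct) ((intro fos)?; simp add: trace_emp trace_osucc)+

lemma trace_cong:
  assumes t: "t \<in>\<^sub>M omega" and w: "\<And>s. s \<in>\<^sub>M t \<Longrightarrow> w \<bullet> add M s = w' \<bullet> add M s"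
  shows "trace w M i t = trace w' M i t"
proof -
  have "n \<in>\<^sub>M osucc t \<longrightarrow> trace w M i n = trace w' M i n" if "n \<in>\<^sub>M omega" for n
    using that
  proof (induction rule: nat_induct)
    case (osucc n)
    show ?case
    proof
      assume "osucc n \<in>\<^sub>M osucc t"
      then have n: "n \<in>\<^sub>M t" using osucc_mem_osucc[OF t] by blast
      then show "trace w M i (osucc n) = trace w' M i (osucc n)"
        using osucc w[OF n] by (simp add: trace_osucc)
    qed
  qed ((intro fos)?; simp add: trace_emp)+
  then show ?thesis using t by simp
qed

lemma add_less: "t \<in>\<^sub>M omega \<Longrightarrow> m \<in>\<^sub>M omega \<Longrightarrow> s \<in>\<^sub>M t \<Longrightarrow> add m s \<in>\<^sub>M add m t"
proof -
  assume t: "t \<in>\<^sub>M omega" and m: "m \<in>\<^sub>M omega" and s: "s \<in>\<^sub>M t"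
  have "\<forall>s. s \<in>\<^sub>M t \<longrightarrow> add m s \<in>\<^sub>M add m t"
    using t by (induction rule: nat_induct) ((intro fos)?; auto)+
  then show ?thesis using s by blast
qed

lemma add_ge: "t \<in>\<^sub>M omega \<Longrightarrow> m \<in>\<^sub>M omega \<Longrightarrow> t \<in>\<^sub>M osucc (add m t)"
proof (induction rule: nat_induct)
  case emp
  then show ?case using emp_mem_osucc by simp
next
  case (osucc n)
  then show ?case using osucc_mem_osucc[of "osucc (add m n)" n] by simp
qed (intro fos)

text \<open>The tags and bits in the emission tell whether a letter removes a bit or in which half
  it places the state, and this is all that is needed to follow the position of a bit of y. When
  that bit is at position 0 and is removed, it is emitted. So y i is found by unbounded search for
  the first such time.\<close>

lemma turing_le_of_trace:
  assumes D: "closed D" "zero \<in>\<^sub>M D" and w: "w \<in>\<^sub>M funs omega (letters D)"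
    and y: "y \<in>\<^sub>M cantor" and M: "M \<in>\<^sub>M omega"
    and state: "\<And>i. i \<in>\<^sub>M omega \<Longrightarrow> state w M \<bullet> dbl i = y \<bullet> i"
    and stop: "\<And>i. i \<in>\<^sub>M omega \<Longrightarrow> \<exists>t. t \<in>\<^sub>M omega \<and> pfst (w \<bullet> add M t) = emp \<and> trace w M i t = emp"
  shows "y \<le>\<^sub>T emission w"
proof -
  define e where "e = emission w"
  have e: "e \<in>\<^sub>M cantor" unfolding e_def by (rule emission_cantor[OF D w])
  have emit_tag: "e \<bullet> dbl n = emit_tag (w \<bullet> n)" and emit_bit: "e \<bullet> osucc (dbl n) = emit_bit (state w n) (w \<bullet> n)" if "n \<in>\<^sub>M omega" for n
    unfolding e_def using emission_ap[of "dbl n" w] emission_ap[of "osucc (dbl n)" w] that by simp_all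
  define T where "T = trace w M"
  \<comment> \<open>The recursion step of \<open>trace\<close>, rewritten so as to read e alone: the
    even place tells whether a bit is removed, the odd place which half is used.\<close>
  define h where "h n q = ifz (prd q) (ifz (dbl q) (osucc (dbl q)) (e \<bullet> osucc (dbl (add M n)))) (e \<bullet> dbl (add M n))" for n q
  have T: "T i emp = dbl i" "n \<in>\<^sub>M omega \<Longrightarrow> T i (osucc n) = h n (T i n)" for i n
    unfolding T_def h_def using M by (simp_all add: trace_emp trace_osucc emit_tag emit_bit emit_tag_def emit_bit_def ifz_def)
  \<comment> \<open>Zero exactly when the traced bit is at position 0 and is about to be removed;
    this is the function to be minimised.\<close>
  define g where "g i t = ifz (e \<bullet> dbl (add M t)) one (T i t)" for i t
  let ?D = "lam omega (\<lambda>n. n)"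
  define u where "u i = pick omega ?D (\<lambda>t. g i t = emp)" for i
  have tm_g: "tm (\<lambda>s. g (a s) (b s))" if "tm a" "tm b" for a b
    unfolding g_def T_def by (intro fos that)
  have tm_u: "tm (\<lambda>s. u (a s))" if "tm a" for a
    unfolding u_def by (intro fos tm_g tm_shift that)
  have g_iff: "g i t = emp \<longleftrightarrow> pfst (w \<bullet> add M t) = emp \<and> T i t = emp" if "t \<in>\<^sub>M omega" for i t
    unfolding g_def using emit_tag[OF add_omega[OF that M]] by (simp add: ifz_def emit_tag_def)
  have u: "u i \<in>\<^sub>M omega" "g i (u i) = emp" "\<And>n. n \<in>\<^sub>M u i \<Longrightarrow> g i n \<noteq> emp" if i: "i \<in>\<^sub>M omega" for i
  proof -
    obtain t where t: "t \<in>\<^sub>M omega" "g i t = emp" using stop[OF i] g_iff unfolding T_def by blast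
    have fo: "fo (\<lambda>s. g i (s 0) = emp)" by (intro fos tm_g)
    have id: "?D \<bullet> n = n" if "n \<in>\<^sub>M omega" for n using that by (intro ap_lam fos)
    note p = pick[OF ctb_omega fo t, folded u_def]
    show 1: "u i \<in>\<^sub>M omega" "g i (u i) = emp" using p(1,2) .
    show "g i n \<noteq> emp" if n: "n \<in>\<^sub>M u i" for n
      using p(3)[OF nat_trans(1)[OF 1(1) n]] id[OF 1(1)] id[OF nat_trans(1)[OF 1(1) n]] n by auto
  qed
  have val: "y \<bullet> i = e \<bullet> osucc (dbl (add M (u i)))" if i: "i \<in>\<^sub>M omega" for i
  proof -
    \<comment> \<open>The bound \<open>u i\<close> is essential: after the removal the bit is gone,
      while the trace continues with the default \<open>prd emp = emp\<close>.\<close>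
    have inv: "t \<in>\<^sub>M osucc (u i) \<longrightarrow> state w (add M t) \<bullet> T i t = y \<bullet> i" if "t \<in>\<^sub>M omega" for t
      using that
    proof (induction rule: nat_induct)
      case emp
      show ?case using state[OF i] by (simp add: T)
    next
      case (osucc t)
      show ?case
      proof
        assume "osucc t \<in>\<^sub>M osucc (u i)"
        then have tu: "t \<in>\<^sub>M u i" using osucc_mem_osucc[OF u(1)[OF i]] by blast
        then have IH: "state w (add M t) \<bullet> T i t = y \<bullet> i" using osucc(2) by simp
        have ng: "\<not> (pfst (w \<bullet> add M t) = emp \<and> T i t = emp)"
          using u(3)[OF i tu] g_iff[OF osucc(1)] by blast
        have Tw: "T i t \<in>\<^sub>M omega" unfolding T_def by (rule trace_omega[OF osucc(1) i])
        have am: "add M t \<in>\<^sub>M omega" using osucc(1) M by simp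
        have "state w (add M (osucc t)) = next_state (state w (add M t)) (w \<bullet> add M t)"
          using osucc(1) state_osucc[OF am] by simp
        moreover have "T i (osucc t) = (if pfst (w \<bullet> add M t) = emp then prd (T i t)
            else if pfst (w \<bullet> add M t) = one then dbl (T i t) else osucc (dbl (T i t)))"
          unfolding T_def using trace_osucc[OF osucc(1)] .
        moreover have "\<exists>q. q \<in>\<^sub>M omega \<and> T i t = osucc q" if "pfst (w \<bullet> add M t) = emp"
          using that ng nat_cases[OF Tw] by blast
        ultimately show "state w (add M (osucc t)) \<bullet> T i (osucc t) = y \<bullet> i"
          using IH Tw by (auto simp: next_state_def shift_ap join_ap)
      qed
    qed (unfold T_def, intro fos)
    have "state w (add M (u i)) \<bullet> T i (u i) = y \<bullet> i" using inv[OF u(1)[OF i]] by simp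
    moreover have "pfst (w \<bullet> add M (u i)) = emp" "T i (u i) = emp" using g_iff[OF u(1)[OF i]] u(2)[OF i] by blast+
    ultimately show ?thesis using emit_bit[OF add_omega[OF u(1)[OF i] M]] by (simp add: emit_bit_def)
  qed
  have "RK C one (\<lambda>a. y \<bullet> (a \<bullet> emp))" if C: "rec_closed' e C" for C
  proof -
    note Ce = RK_oracle[OF C e]
    note R = RK_ifz[OF C] RK_prd[OF C] RK_dbl[OF C] RK_osucc[OF C] RK_add[OF C _ M] RK_real[OF C e Ce] RK_const[OF C]
    have p2: "RK C two (\<lambda>a. a \<bullet> emp)" "RK C two (\<lambda>a. a \<bullet> one)" and p1: "RK C one (\<lambda>a. a \<bullet> emp)"
      by (rule RK_proj[OF C]; simp)+
    have "RK C two (\<lambda>a. T (a \<bullet> emp) (a \<bullet> one))"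
    proof (rule RK_primrec2[OF C, where f = T and g = dbl and h = "\<lambda>_. h"])
      show "RK C (osucc two) (\<lambda>a. h (a \<bullet> one) (a \<bullet> two))"
        unfolding h_def by (intro R RK_p3[OF C] three_omega)
      show "RK C one (\<lambda>a. dbl (a \<bullet> emp))" by (intro R p1 one_omega)
      show "T p n \<in>\<^sub>M omega" if "p \<in>\<^sub>M omega" "n \<in>\<^sub>M omega" for p n
        unfolding T_def using that by (simp add: trace_omega)
    qed (use T p2 in \<open>auto simp: T_def intro!: fos\<close>)
    then have "RK C (osucc one) (\<lambda>a. g (a \<bullet> emp) (a \<bullet> one))"
      unfolding g_def two_def[symmetric] by (intro R p2 two_omega one_omega)
    then have "RK C one (\<lambda>a. u (a \<bullet> emp))"
    proof (rule RK_mu[OF C one_omega])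
      show "tm (\<lambda>s. u (a s \<bullet> emp))" if "tm a" for a by (intro tm_u fos that)
      fix a assume a: "a \<in>\<^sub>M tuples one"
      have i: "a \<bullet> emp \<in>\<^sub>M omega" using tuples_ap[OF a] by simp
      have s: "snoc one a n \<bullet> emp = a \<bullet> emp" "snoc one a n \<bullet> one = n" if "n \<in>\<^sub>M omega" for n
        using snoc_tuples[OF a that] by simp_all
      show "u (a \<bullet> emp) \<in>\<^sub>M omega" by (rule u(1)[OF i])
      show "g (snoc one a (u (a \<bullet> emp)) \<bullet> emp) (snoc one a (u (a \<bullet> emp)) \<bullet> one) = emp"
        using s[OF u(1)[OF i]] u(2)[OF i] by simp
      show "g (snoc one a n \<bullet> emp) (snoc one a n \<bullet> one) \<noteq> emp" if n: "n \<in>\<^sub>M u (a \<bullet> emp)" for n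
        using s[OF nat_trans(1)[OF u(1)[OF i] n]] u(3)[OF i n] by simp
    qed
    then have "RK C one (\<lambda>a. e \<bullet> osucc (dbl (add M (u (a \<bullet> emp)))))"
      by (intro R one_omega)
    then show ?thesis
    proof (rule RK_cong)
      show "tm (\<lambda>s. y \<bullet> (a s \<bullet> emp))" if "tm a" for a by (intro fos that)
      show "y \<bullet> (a \<bullet> emp) = e \<bullet> osucc (dbl (add M (u (a \<bullet> emp))))" if "a \<in>\<^sub>M tuples one" for a
        using val tuples_ap[OF that, of emp] by simp
    qed
  qed
  then show ?thesis unfolding turing_le_iff_RK[OF y e, unfolded e_def] e_def by blast
qed

end

section \<open>Cones above members of a closed set\<close>

context ZF_model
begin

text \<open>A generic sequence contains the letter \<open>\<langle>two, y\<rangle>\<close>, after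
  which y is the even half of the state. Genericity also ensures that each bit of y is removed at
  some later time, so that \<open>turing_le_of_trace\<close> applies.\<close>

lemma large_cone:
  assumes D: "closed D" "zero \<in>\<^sub>M D" and y: "y \<in>\<^sub>M D"
    and A: "\<And>x. x \<in>\<^sub>M cantor \<Longrightarrow> y \<le>\<^sub>T x \<Longrightarrow> x \<in>\<^sub>M A"
  shows "large D A"
proof -
  define Y where "Y = letters D"
  define l where "l = \<langle>two, y\<rangle>"
  have l: "l \<in>\<^sub>M Y" unfolding l_def Y_def using y by (simp add: mem_letters)
  have l0: "\<langle>emp, zero\<rangle> \<in>\<^sub>M Y" unfolding Y_def using D(2) by (simp add: mem_letters)
  \<comment> \<open>The quantifier over all continuations \<open>w\<close> makes the condition
    closed under extension. It asserts that the bit traced from time \<open>M\<close> is certain to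
    be removed.\<close>
  define V where "V M i p \<longleftrightarrow> (\<forall>w. w \<in>\<^sub>M funs omega Y \<longrightarrow> p \<subseteq>\<^sub>M w \<longrightarrow>
    (\<exists>t. t \<in>\<^sub>M omega \<and> pfst (w \<bullet> add M t) = emp \<and> trace w M i t = emp))" for M i p
  have V_dense: "\<exists>q. q \<in>\<^sub>M sq Y \<and> p \<subseteq>\<^sub>M q \<and> V M i q"
    if p: "p \<in>\<^sub>M sq Y" and M: "M \<in>\<^sub>M omega" and i: "i \<in>\<^sub>M omega" for p M i
  proof -
    define w0 where "w0 = lam omega (\<lambda>_. \<langle>emp, zero\<rangle>)"
    have w0: "w0 \<in>\<^sub>M funs omega Y" unfolding w0_def by (intro lam_funs fos l0)
    have w0_ap: "w0 \<bullet> n = \<langle>emp, zero\<rangle>" if "n \<in>\<^sub>M omega" for n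
      unfolding w0_def using that by (intro ap_lam fos)
    define w where "w = ovr p w0"
    have w: "w \<in>\<^sub>M funs omega Y" "p \<subseteq>\<^sub>M w"
      unfolding w_def using ovr_funs[OF p w0] ovr_prefix[OF p w0] by blast+
    have lp: "len p \<in>\<^sub>M omega" by (rule sq_len(1)[OF p])
    have shift: "pfst (w \<bullet> add M t) = emp" if t: "t \<in>\<^sub>M omega" "\<not> t \<in>\<^sub>M len p" for t
    proof -
      have a: "add M t \<in>\<^sub>M omega" using t(1) M by simp
      have "\<not> add M t \<in>\<^sub>M len p"
        using t(2) add_ge[OF t(1) M] nat_trans(2)[OF lp, of "add M t" t] unfolding mem_osucc by metis
      then show ?thesis unfolding w_def using ovr_ap[OF a] w0_ap[OF a] by simp
    qed
    \<comment> \<open>Past the end of p all letters are removals, each of which lowers the traced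
      position by one. Hence the induction on that position, with the time left arbitrary.\<close>
    have "\<forall>t. t \<in>\<^sub>M omega \<longrightarrow> \<not> t \<in>\<^sub>M len p \<longrightarrow> trace w M i t = v \<longrightarrow>
      (\<exists>t'. t' \<in>\<^sub>M omega \<and> \<not> t' \<in>\<^sub>M len p \<and> trace w M i t' = emp)" if "v \<in>\<^sub>M omega" for v
      using that
    proof (induction rule: nat_induct)
      case (osucc v)
      show ?case
      proof (intro allI impI)
        fix t assume t: "t \<in>\<^sub>M omega" "\<not> t \<in>\<^sub>M len p" "trace w M i t = osucc v"
        have "\<not> osucc t \<in>\<^sub>M len p" using t(2) nat_trans(2)[OF lp, of "osucc t" t] by auto
        moreover have "trace w M i (osucc t) = v"
          using trace_osucc[OF t(1)] shift[OF t(1,2)] t(3) osucc(1) by simp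
        ultimately show "\<exists>t'. t' \<in>\<^sub>M omega \<and> \<not> t' \<in>\<^sub>M len p \<and> trace w M i t' = emp"
          using osucc(2) t(1) osucc_omega by blast
      qed
    next
      case emp
      show ?case by blast
    qed (intro fos)
    from this[OF trace_omega[OF lp i]] obtain t where
      t: "t \<in>\<^sub>M omega" "\<not> t \<in>\<^sub>M len p" "trace w M i t = emp"
      using lp mem_irrefl by blast
    have a: "add M t \<in>\<^sub>M omega" using t(1) M by simp
    obtain N where N: "N \<in>\<^sub>M omega" "len p \<in>\<^sub>M osucc N" "osucc (add M t) \<in>\<^sub>M osucc N"
      using nat_common_bound[OF lp osucc_omega[OF a]] .
    have aN: "add M t \<in>\<^sub>M N" using N(3) osucc_mem_osucc[OF N(1)] by blast
    have "p \<subseteq>\<^sub>M rs w N"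
      using prefix_rs[OF p w N(1)] nat_subset_iff[OF lp N(1)] N(2) by blast
    moreover have "V M i (rs w N)"
      unfolding V_def
    proof (intro allI impI)
      fix v assume v: "v \<in>\<^sub>M funs omega Y" "rs w N \<subseteq>\<^sub>M v"
      have eq: "v \<bullet> j = w \<bullet> j" if "j \<in>\<^sub>M N" for j
        using prefix_ap[OF rs_sq[OF w(1) N(1)] v(1,2)] that len_rs[OF w(1) N(1)] by simp
      have "v \<bullet> add M s = w \<bullet> add M s" if s: "s \<in>\<^sub>M t" for s
        by (rule eq) (rule nat_trans(2)[OF N(1) aN add_less[OF t(1) M s]])
      then have "trace v M i t = emp" using trace_cong[OF t(1)] t(3) by metis
      then show "\<exists>t. t \<in>\<^sub>M omega \<and> pfst (v \<bullet> add M t) = emp \<and> trace v M i t = emp"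
        using t(1) eq[OF aN] shift[OF t(1,2)] by auto
    qed
    ultimately show ?thesis using rs_sq[OF w(1) N(1)] by blast
  qed
  \<comment> \<open>The time at which y is joined depends on the generic sequence, so removal is
    requested for all pairs of a starting time and a bit.\<close>
  define X where "X k p \<longleftrightarrow> (\<exists>m. m \<in>\<^sub>M len p \<and> p \<bullet> m = l) \<and>
    (\<forall>M i. M \<in>\<^sub>M omega \<longrightarrow> i \<in>\<^sub>M omega \<longrightarrow> k = J M i \<longrightarrow> V M i p)" for k p
  define \<O> where "\<O> = lam omega (\<lambda>k. sep (sq Y) (X k))"
  have \<O>: "p \<in>\<^sub>M \<O> \<bullet> k \<longleftrightarrow> p \<in>\<^sub>M sq Y \<and> X k p" if k: "k \<in>\<^sub>M omega" for k p
  proof -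
    have "\<O> \<bullet> k = sep (sq Y) (X k)"
      unfolding \<O>_def X_def V_def using k by (intro ap_lam fos)
    moreover have "fo (\<lambda>s. X k (s 0))" unfolding X_def V_def by (intro fos)
    ultimately show ?thesis by (simp only: mem_sep)
  qed
  have X_open: "X k q" if p: "p \<in>\<^sub>M sq Y" "X k p" and q: "q \<in>\<^sub>M sq Y" "p \<subseteq>\<^sub>M q" for k p q
  proof -
    obtain m where m: "m \<in>\<^sub>M len p" "p \<bullet> m = l" using p(2) unfolding X_def by blast
    have "m \<in>\<^sub>M len q" using prefix_len[OF p(1) q] m(1) unfolding subset_def by blast
    moreover have "q \<bullet> m = l" using prefix_ap[OF p(1) sq_len(2)[OF q(1)] q(2) m(1)] m(2) by simp
    moreover have "V M i q" if "V M i p" for M i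
      using that q(2) subset_trans unfolding V_def by blast
    ultimately show ?thesis using p(2) unfolding X_def by blast
  qed
  have "dense_family Y \<O>"
    unfolding dense_family_def dense_open_def
  proof (intro allI impI conjI)
    fix k assume k: "k \<in>\<^sub>M omega"
    show "\<O> \<bullet> k \<subseteq>\<^sub>M sq Y" by (simp add: subset_def \<O>[OF k])
    show "q \<in>\<^sub>M \<O> \<bullet> k" if "p \<in>\<^sub>M \<O> \<bullet> k" "q \<in>\<^sub>M sq Y" "p \<subseteq>\<^sub>M q" for p q
      using that X_open unfolding \<O>[OF k] by blast
    fix p assume p: "p \<in>\<^sub>M sq Y"
    define q where "q = snoc (len p) p l"
    have q: "q \<in>\<^sub>M sq Y" "len q = osucc (len p)" "q \<bullet> len p = l"
      unfolding q_def using snoc_sq[OF p l] len_snoc[OF p l] snoc_funs(2)[OF sq_len(2)[OF p] l] by blast+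
    have pq: "p \<subseteq>\<^sub>M q" unfolding q_def by (simp add: subset_def mem_snoc)
    have ql: "\<exists>m. m \<in>\<^sub>M len r \<and> r \<bullet> m = l" if r: "r \<in>\<^sub>M sq Y" "q \<subseteq>\<^sub>M r" for r
    proof (intro exI conjI)
      have "len p \<in>\<^sub>M len q" using q(2) by simp
      then show "len p \<in>\<^sub>M len r" using prefix_len[OF q(1) r] unfolding subset_def by blast
      show "r \<bullet> len p = l"
        using prefix_ap[OF q(1) sq_len(2)[OF r(1)] r(2) \<open>len p \<in>\<^sub>M len q\<close>] q(3) by simp
    qed
    show "\<exists>r. r \<in>\<^sub>M \<O> \<bullet> k \<and> p \<subseteq>\<^sub>M r"
    proof (cases "\<exists>M i. M \<in>\<^sub>M omega \<and> i \<in>\<^sub>M omega \<and> k = J M i")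
      case True
      then obtain M i where M: "M \<in>\<^sub>M omega" "i \<in>\<^sub>M omega" "k = J M i" by blast
      obtain r where r: "r \<in>\<^sub>M sq Y" "q \<subseteq>\<^sub>M r" "V M i r" using V_dense[OF q(1) M(1,2)] by blast
      have "M' = M \<and> i' = i" if "M' \<in>\<^sub>M omega" "i' \<in>\<^sub>M omega" "k = J M' i'" for M' i'
        using J_inject[OF that(1,2) M(1,2)] that(3) M(3) by simp
      then have "X k r" using ql[OF r(1,2)] r(3) unfolding X_def by blast
      then show ?thesis using r(1,2) pq subset_trans unfolding \<O>[OF k] by blast
    next
      case False
      then have "X k q" using ql[OF q(1) subset_refl] unfolding X_def by blast
      then show ?thesis using q(1) pq unfolding \<O>[OF k] by blast
    qed
  qed
  moreover have "emission w \<in>\<^sub>M A" if w: "generic Y \<O> w" for w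
  proof -
    have wY: "w \<in>\<^sub>M funs omega Y" using w unfolding generic_def by blast
    have meet: "\<exists>n. n \<in>\<^sub>M omega \<and> X k (rs w n)" if k: "k \<in>\<^sub>M omega" for k
      using w k \<O>[OF k] unfolding generic_def by blast
    obtain n m where n: "n \<in>\<^sub>M omega" "m \<in>\<^sub>M n" "w \<bullet> m = l"
    proof -
      obtain n where n: "n \<in>\<^sub>M omega" "X emp (rs w n)" using meet[OF emp_omega] by blast
      then obtain m where "m \<in>\<^sub>M n" "rs w n \<bullet> m = l" unfolding X_def len_rs[OF wY n(1)] by blast
      then show thesis using that n(1) by simp
    qed
    have m: "m \<in>\<^sub>M omega" using nat_trans(1)[OF n(1,2)] .
    have state: "state w n \<in>\<^sub>M cantor" if n: "n \<in>\<^sub>M omega" for n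
      by (intro closedD(1)[OF D(1)] state_closed[OF D n] ap_type[OF wY[unfolded Y_def] nat_trans(1)[OF n]])
    have yC: "y \<in>\<^sub>M cantor" by (rule closedD(1)[OF D(1) y])
    have "y \<le>\<^sub>T emission w"
    proof (rule turing_le_of_trace[OF D wY[unfolded Y_def] yC osucc_omega[OF m]])
      have "state w (osucc m) = join y (state w m)"
        using state_osucc[OF m] n(3) by (simp add: l_def next_state_def two_def one_def)
      then show "state w (osucc m) \<bullet> dbl i = y \<bullet> i" if "i \<in>\<^sub>M omega" for i
        using that by (simp add: join_ap)
      fix i assume i: "i \<in>\<^sub>M omega"
      obtain n' where n': "n' \<in>\<^sub>M omega" "X (J (osucc m) i) (rs w n')"
        using meet[of "J (osucc m) i"] m i by auto
      then have "V (osucc m) i (rs w n')" unfolding X_def using osucc_omega[OF m] i by blast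
      then show "\<exists>t. t \<in>\<^sub>M omega \<and> pfst (w \<bullet> add (osucc m) t) = emp \<and> trace w (osucc m) i t = emp"
        unfolding V_def using wY rs_prefix[OF wY n'(1)] by blast
    qed
    then show ?thesis using A emission_cantor[OF D wY[unfolded Y_def]] by blast
  qed
  ultimately show ?thesis unfolding large_def Y_def[symmetric] by blast
qed

subsection \<open>Turing degrees\<close>

lemma turing_leI:
  assumes "x \<in>\<^sub>M cantor" "z \<in>\<^sub>M cantor"
    and F: "\<And>C. rec_closed' z C \<Longrightarrow> RK C one (\<lambda>a. F (a \<bullet> emp))"
    and eq: "\<And>n. n \<in>\<^sub>M omega \<Longrightarrow> x \<bullet> n = F n"
  shows "x \<le>\<^sub>T z"
  unfolding turing_le_iff_RK[OF assms(1,2)]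
proof (intro allI impI)
  fix C assume "rec_closed' z C"
  from F[OF this] show "RK C one (\<lambda>a. x \<bullet> (a \<bullet> emp))"
    by (rule RK_cong) (intro fos, assumption, use eq tuples_ap[of _ one emp] in simp)
qed

lemma RK_id: "rec_closed' z C \<Longrightarrow> RK C one (\<lambda>a. a \<bullet> emp)"
  by (rule RK_proj) simp_all

lemma RK_oracle_at:
  "rec_closed' z C \<Longrightarrow> z \<in>\<^sub>M cantor \<Longrightarrow> k \<in>\<^sub>M omega \<Longrightarrow> RK C k A \<Longrightarrow> RK C k (\<lambda>a. z \<bullet> A a)"
  by (rule RK_real[OF _ _ RK_oracle])

lemma turing_le_refl: "x \<in>\<^sub>M cantor \<Longrightarrow> x \<le>\<^sub>T x"
  by (rule turing_leI[of x x "\<lambda>n. x \<bullet> n"]) (simp_all add: RK_oracle)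

lemma turing_le_playI: "x \<in>\<^sub>M cantor \<Longrightarrow> s \<in>\<^sub>M cantor \<Longrightarrow> x \<le>\<^sub>T playI s x"
  by (rule turing_leI[of _ _ "\<lambda>n. playI s x \<bullet> osucc (dbl n)"])
     (auto simp: playI_def join_ap intro!: RK_oracle_at RK_osucc RK_dbl RK_id)

lemma turing_le_playII: "x \<in>\<^sub>M cantor \<Longrightarrow> s \<in>\<^sub>M cantor \<Longrightarrow> x \<le>\<^sub>T playII s x"
  by (rule turing_leI[of _ _ "\<lambda>n. playII s x \<bullet> dbl n"])
     (auto simp: playII_def join_ap intro!: RK_oracle_at RK_dbl RK_id)

text \<open>A reply is looked up in \<open>s\<close> at the code of an initial part of
  \<open>x\<close>, and this code is recursive in \<open>x\<close>.\<close>

lemma play_turing_le: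
  assumes x: "x \<in>\<^sub>M cantor" and s: "s \<in>\<^sub>M cantor" and le: "s \<le>\<^sub>T x"
  shows "playI s x \<le>\<^sub>T x" "playII s x \<le>\<^sub>T x"
proof -
  have "RK C one (\<lambda>a. ifz (s \<bullet> K x (half (a \<bullet> emp))) (x \<bullet> half (a \<bullet> emp)) (par (a \<bullet> emp))) \<and>
      RK C one (\<lambda>a. ifz (x \<bullet> half (a \<bullet> emp)) (s \<bullet> K x (osucc (half (a \<bullet> emp)))) (par (a \<bullet> emp)))"
    if C: "rec_closed' x C" for C
  proof -
    have Cs: "RK C one (\<lambda>a. s \<bullet> (a \<bullet> emp))" using le C turing_le_iff_RK[OF s x] by blast
    note R = RK_ifz[OF C] RK_par[OF C] RK_half[OF C] RK_osucc[OF C] RK_real[OF C s Cs]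
      RK_real[OF C x RK_oracle[OF C x]] RK_K[OF C x RK_oracle[OF C x]] RK_id[OF C] one_omega
    show ?thesis by (intro conjI R)
  qed
  note F = this
  show "playI s x \<le>\<^sub>T x"
  proof (rule turing_leI[of _ _ "\<lambda>n. ifz (s \<bullet> K x (half n)) (x \<bullet> half n) (par n)"])
    show "playI s x \<bullet> n = ifz (s \<bullet> K x (half n)) (x \<bullet> half n) (par n)" if "n \<in>\<^sub>M omega" for n
      using that by (simp add: playI_def join_ap resp_ap ifz_def)
  qed (use x s F in \<open>auto simp: playI_def\<close>)
  show "playII s x \<le>\<^sub>T x"
  proof (rule turing_leI[of _ _ "\<lambda>n. ifz (x \<bullet> half n) (s \<bullet> K x (osucc (half n))) (par n)"])
    show "playII s x \<bullet> n = ifz (x \<bullet> half n) (s \<bullet> K x (osucc (half n))) (par n)" if "n \<in>\<^sub>M omega" for n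
      using that by (simp add: playII_def join_ap resp_ap shift_ap ifz_def del: K_osucc)
  qed (use x s F in \<open>auto simp: playII_def\<close>)
qed

text \<open>The number of differing places may be nonstandard, so a finite table cannot be written
  out in HOL. An internal induction on a bound for these places passes from \<open>x\<close> to
  \<open>shift x\<close>, then to \<open>shift y\<close>, then to \<open>y\<close>; the bit lost by
  the shift is restored as a constant.\<close>

lemma E0r_turing_le:
  assumes "x \<in>\<^sub>M cantor" "y \<in>\<^sub>M cantor" "E0r x y"
  shows "x \<le>\<^sub>T y"
proof -
  have "\<forall>x y. x \<in>\<^sub>M cantor \<longrightarrow> y \<in>\<^sub>M cantor \<longrightarrow>
    (\<forall>n. n \<in>\<^sub>M omega \<longrightarrow> \<not> n \<in>\<^sub>M m \<longrightarrow> x \<bullet> n = y \<bullet> n) \<longrightarrow> turing_le' x y" if "m \<in>\<^sub>M omega" for m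
    using that
  proof (induction rule: nat_induct)
    case emp
    show ?case
    proof (intro allI impI)
      fix x y assume *: "x \<in>\<^sub>M cantor" "y \<in>\<^sub>M cantor" "\<forall>n. n \<in>\<^sub>M omega \<longrightarrow> \<not> n \<in>\<^sub>M emp \<longrightarrow> x \<bullet> n = y \<bullet> n"
      have "x = y" using *(3) by (intro cantor_ext[OF *(1,2)]) simp
      then show "turing_le' x y" using turing_le_refl[OF *(1)] turing_le_iff[OF *(1,1)] by simp
    qed
  next
    case (osucc m)
    show ?case
    proof (intro allI impI)
      fix x y assume x: "x \<in>\<^sub>M cantor" and y: "y \<in>\<^sub>M cantor"
        and *: "\<forall>n. n \<in>\<^sub>M omega \<longrightarrow> \<not> n \<in>\<^sub>M osucc m \<longrightarrow> x \<bullet> n = y \<bullet> n"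
      have "shift x \<bullet> n = shift y \<bullet> n" if n: "n \<in>\<^sub>M omega" "\<not> n \<in>\<^sub>M m" for n
        using * n osucc_mem_osucc[OF osucc(1), of n] by (simp add: shift_ap del: mem_osucc)
      then have 1: "shift x \<le>\<^sub>T shift y" using osucc(2) x y by (simp add: turing_le_iff)
      have 2: "shift y \<le>\<^sub>T y"
        using y by (intro turing_leI[of _ _ "\<lambda>n. y \<bullet> osucc n"])
          (auto simp: shift_ap intro!: RK_oracle_at RK_osucc RK_id)
      have 3: "x \<le>\<^sub>T shift x"
      proof (rule turing_leI[of _ _ "\<lambda>n. ifz (x \<bullet> emp) (shift x \<bullet> prd n) n"])
        show "RK C one (\<lambda>a. ifz (x \<bullet> emp) (shift x \<bullet> prd (a \<bullet> emp)) (a \<bullet> emp))"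
          if C: "rec_closed' (shift x) C" for C
          using x by (intro RK_ifz[OF C] RK_oracle_at[OF C] RK_prd[OF C] RK_id[OF C] RK_const[OF C]) simp_all
        show "x \<bullet> n = ifz (x \<bullet> emp) (shift x \<bullet> prd n) n" if "n \<in>\<^sub>M omega" for n
          using that by (cases rule: nat_cases) (simp_all add: ifz_def shift_ap)
      qed (use x in simp_all)
      show "turing_le' x y"
        using turing_le_trans[OF x _ _ 3 turing_le_trans[OF _ _ _ 1 2]] x y turing_le_iff by simp
    qed
  qed (intro fos)
  then show ?thesis using assms turing_le_iff unfolding E0r_def by blast
qed

text \<open>Martin's cone theorem: if \<open>x\<close> computes the winning strategy
  \<open>s\<close>, the play of \<open>s\<close> against \<open>x\<close> is Turing equivalent to
  \<open>x\<close>, so the outcome of the play decides \<open>x\<close> itself.\<close>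

lemma turing_cone:
  assumes AD: AD and A: "\<And>x y. x \<in>\<^sub>M A \<Longrightarrow> y \<in>\<^sub>M cantor \<Longrightarrow> x \<le>\<^sub>T y \<Longrightarrow> y \<le>\<^sub>T x \<Longrightarrow> y \<in>\<^sub>M A"
  shows "(\<exists>s. s \<in>\<^sub>M cantor \<and> (\<forall>x. x \<in>\<^sub>M cantor \<longrightarrow> s \<le>\<^sub>T x \<longrightarrow> x \<in>\<^sub>M A)) \<or>
    (\<exists>s. s \<in>\<^sub>M cantor \<and> (\<forall>x. x \<in>\<^sub>M cantor \<longrightarrow> s \<le>\<^sub>T x \<longrightarrow> \<not> x \<in>\<^sub>M A))"
proof -
  have "fo (\<lambda>s. s 0 \<in>\<^sub>M A)" by (intro fos)
  then show ?thesis
  proof (rule binary_AD[OF AD])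
    fix s assume s: "s \<in>\<^sub>M cantor" "\<And>x. x \<in>\<^sub>M cantor \<Longrightarrow> playI s x \<in>\<^sub>M A"
    have "x \<in>\<^sub>M A" if x: "x \<in>\<^sub>M cantor" "s \<le>\<^sub>T x" for x
      using A[OF s(2)[OF x(1)] x(1) play_turing_le(1)[OF x(1) s(1) x(2)] turing_le_playI[OF x(1) s(1)]] .
    then show ?thesis using s(1) by blast
  next
    fix s assume s: "s \<in>\<^sub>M cantor" "\<And>x. x \<in>\<^sub>M cantor \<Longrightarrow> \<not> playII s x \<in>\<^sub>M A"
    have "\<not> x \<in>\<^sub>M A" if x: "x \<in>\<^sub>M cantor" "s \<le>\<^sub>T x" for x
      using A[OF _ _ turing_le_playII[OF x(1) s(1)] play_turing_le(2)[OF x(1) s(1) x(2)]] s x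
      by (auto simp: playII_def)
    then show ?thesis using s(1) by blast
  qed
qed

end

section \<open>The ultrafilter\<close>

context ZF_model
begin

lemma mem_E0: "\<langle>x, y\<rangle> \<in>\<^sub>M E0 \<longleftrightarrow> x \<in>\<^sub>M cantor \<and> y \<in>\<^sub>M cantor \<and> E0r x y"
proof -
  let ?P = "\<lambda>p. \<exists>x \<in> elts cantor. \<exists>y \<in> elts cantor. p = \<langle>x, y\<rangle> \<and> E0r x y"
  have *: "(\<exists>m \<in> elts omega. \<forall>n \<in> elts omega. \<not> n \<in>\<^sub>M m \<longrightarrow> x \<cdot> n = y \<cdot> n) \<longleftrightarrow> E0r x y"
    if "x \<in>\<^sub>M cantor" "y \<in>\<^sub>M cantor" for x y
    using cantor_app[OF that(1)] cantor_app[OF that(2)] unfolding E0r_def by simp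
  have "isset ?P" by (rule isset_subset[of _ "cart cantor cantor"]) (intro fos, auto)
  moreover have "E0 = the_set ?P"
    unfolding E0_def
    by (rule arg_cong[of _ _ the_set], rule HOL.ext, intro bex_cong conj_cong refl *) simp_all
  ultimately show ?thesis by (auto simp: mem_the_set)
qed

lemma mem_turing_equiv:
  "\<langle>x, y\<rangle> \<in>\<^sub>M turing_equiv \<longleftrightarrow> x \<in>\<^sub>M cantor \<and> y \<in>\<^sub>M cantor \<and> x \<le>\<^sub>T y \<and> y \<le>\<^sub>T x"
proof -
  let ?P = "\<lambda>p. \<exists>x \<in> elts cantor. \<exists>y \<in> elts cantor. p = \<langle>x, y\<rangle> \<and> turing_le' x y \<and> turing_le' y x"
  have "isset ?P" by (rule isset_subset[of _ "cart cantor cantor"]) (intro fos, auto)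
  moreover have "turing_equiv = the_set ?P"
    unfolding turing_equiv_def by (rule arg_cong[of _ _ the_set]) (auto simp: fun_eq_iff turing_le_iff)
  ultimately show ?thesis by (auto simp: mem_the_set turing_le_iff)
qed

lemma isset_eq_class: "isset (\<lambda>y. \<langle>x, y\<rangle> \<in>\<^sub>M E)"
proof (rule isset_subset)
  show "y \<in>\<^sub>M Uni (Uni E)" if E: "\<langle>x, y\<rangle> \<in>\<^sub>M E" for y
  proof -
    have "upair x y \<in>\<^sub>M \<langle>x, y\<rangle>" "y \<in>\<^sub>M upair x y" by (simp_all add: opair_def)
    then show ?thesis using E unfolding mem_Uni by blast
  qed
qed (intro fos)

lemma tm_eq_class [fos]: "tm E \<Longrightarrow> tm x \<Longrightarrow> tm (\<lambda>s. eq_class (E s) (x s))"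
  unfolding eq_class_def by (rule tm_the_setI) (intro fos tm_shift isset_eq_class | assumption)+

lemma mem_eq_class: "y \<in>\<^sub>M eq_class E x \<longleftrightarrow> \<langle>x, y\<rangle> \<in>\<^sub>M E"
  unfolding eq_class_def by (rule mem_the_set[OF isset_eq_class])

lemma mem_quot: "c \<in>\<^sub>M quot X E \<longleftrightarrow> (\<exists>x. x \<in>\<^sub>M X \<and> c = eq_class E x)"
proof -
  have "tm (\<lambda>s. eq_class E (s 0))" by (intro fos)
  from mem_the_set[OF isset_repl[OF this]] show ?thesis unfolding quot_def by simp
qed

lemma invariant_E0: "invariant cantor E0 A \<longleftrightarrow>
  A \<subseteq>\<^sub>M cantor \<and> (\<forall>x y. x \<in>\<^sub>M A \<longrightarrow> y \<in>\<^sub>M cantor \<longrightarrow> E0r x y \<longrightarrow> y \<in>\<^sub>M A)"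
  unfolding invariant_def mem_E0 subset_def by blast

lemma invariant_turing_equiv: "invariant cantor turing_equiv A \<longleftrightarrow>
  A \<subseteq>\<^sub>M cantor \<and> (\<forall>x y. x \<in>\<^sub>M A \<longrightarrow> y \<in>\<^sub>M cantor \<longrightarrow> x \<le>\<^sub>T y \<longrightarrow> y \<le>\<^sub>T x \<longrightarrow> y \<in>\<^sub>M A)"
  unfolding invariant_def mem_turing_equiv subset_def by blast

lemma E0_turing_equiv: "\<langle>x, y\<rangle> \<in>\<^sub>M E0 \<Longrightarrow> \<langle>x, y\<rangle> \<in>\<^sub>M turing_equiv"
  unfolding mem_E0 mem_turing_equiv using E0r_turing_le E0r_sym by blast

lemma invariant_turing_E0: "invariant cantor turing_equiv A \<Longrightarrow> invariant cantor E0 A"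
  unfolding invariant_def using E0_turing_equiv by blast

lemma mem_martin_measure: "A \<in>\<^sub>M martin_measure \<longleftrightarrow> invariant cantor turing_equiv A \<and>
  (\<exists>y. y \<in>\<^sub>M cantor \<and> (\<forall>x. x \<in>\<^sub>M cantor \<longrightarrow> y \<le>\<^sub>T x \<longrightarrow> x \<in>\<^sub>M A))"
proof -
  let ?P = "\<lambda>A. invariant cantor turing_equiv A \<and>
     (\<exists>y \<in> elts cantor. \<forall>x \<in> elts cantor. turing_le' y x \<longrightarrow> x \<in>\<^sub>M A)"
  have "fo (\<lambda>s. ?P (s 0))" unfolding invariant_def by (intro fos)
  then have "isset ?P"
    by (rule isset_subset[of _ "Pw cantor"]) (simp add: invariant_def)
  moreover have "martin_measure = the_set ?P"
    unfolding martin_measure_def by (rule arg_cong[of _ _ the_set]) (auto simp: fun_eq_iff turing_le_iff)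
  ultimately have "A \<in>\<^sub>M martin_measure \<longleftrightarrow> ?P A" by (simp add: mem_the_set)
  then show ?thesis by (auto simp: turing_le_iff)
qed

text \<open>The preimage of a Borel set is its intersection with Cantor space. That Borel sets lie
  in Cantor space is seen by testing \<open>is_borel\<close> on the sigma-algebra of all
  subsets.\<close>

lemma borel_map_id: "borel_map (lam cantor (\<lambda>x. x))"
proof -
  have tm: "tm (\<lambda>s. s 0)" by (intro fos)
  have g: "lam cantor (\<lambda>x. x) \<in>\<^sub>M funs cantor cantor" by (rule lam_funs[OF tm])
  have "is_sigma_algebra (Pw cantor)"
    unfolding is_sigma_algebra_def
  proof (intro conjI ballI)
    fix F assume "F \<in> elts (funs omega (Pw cantor))"
    then have F: "F \<in>\<^sub>M funs omega (Pw cantor)" by simp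
    let ?P = "\<lambda>x. \<exists>n \<in> elts omega. x \<in>\<^sub>M F \<bullet> n"
    have sub: "x \<in>\<^sub>M cantor" if "?P x" for x
      using that ap_type[OF F] by (auto simp: subset_def)
    have "fo (\<lambda>s. ?P (s 0))" by (intro fos)
    then have "isset ?P" by (rule isset_subset) (rule sub)
    then have "the_set ?P \<subseteq>\<^sub>M cantor" using sub by (simp add: subset_def mem_the_set)
    moreover have "(\<lambda>x. \<exists>n \<in> elts omega. x \<in>\<^sub>M F \<cdot> n) = ?P"
      using app_eq_ap[OF F] by simp
    ultimately show "the_set (\<lambda>x. \<exists>n \<in> elts omega. x \<in>\<^sub>M F \<cdot> n) \<in>\<^sub>M Pw cantor" by simp
  qed (auto simp: subset_def)
  moreover have "\<forall>B. is_open B \<longrightarrow> B \<in>\<^sub>M Pw cantor" by (simp add: is_open_def)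
  ultimately have sub: "B \<subseteq>\<^sub>M cantor" if "is_borel B" for B
    using that unfolding is_borel_def by (metis mem_Pw)
  have "the_set (\<lambda>x. x \<in>\<^sub>M cantor \<and> lam cantor (\<lambda>x. x) \<cdot> x \<in>\<^sub>M B) = B" if "is_borel B" for B
    using sub[OF that] app_eq_ap[OF g] ap_lam[OF tm]
    by (intro the_set_eqI) (auto simp: subset_def)
  then show ?thesis using g unfolding borel_map_def by simp
qed

lemma zero_clo: "x \<in>\<^sub>M cantor \<Longrightarrow> zero \<in>\<^sub>M clo x"
  using closedD(7)[OF closed_clo clo_self] .

text \<open>The limit of the filters of large sets for \<open>clo x\<close>, along cones taken in
  the sense of closures: x ranges over the reals whose closure contains a given y.\<close>

definition cone_limit :: 'a where
  "cone_limit = sep (Pw cantor) (\<lambda>A. invariant cantor E0 A \<and>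
     (\<exists>y. y \<in>\<^sub>M cantor \<and> (\<forall>x. x \<in>\<^sub>M cantor \<longrightarrow> y \<in>\<^sub>M clo x \<longrightarrow> large (clo x) A)))"

lemma mem_cone_limit: "A \<in>\<^sub>M cone_limit \<longleftrightarrow> invariant cantor E0 A \<and>
   (\<exists>y. y \<in>\<^sub>M cantor \<and> (\<forall>x. x \<in>\<^sub>M cantor \<longrightarrow> y \<in>\<^sub>M clo x \<longrightarrow> large (clo x) A))"
proof -
  have "fo (\<lambda>s. invariant cantor E0 (s 0) \<and>
     (\<exists>y. y \<in>\<^sub>M cantor \<and> (\<forall>x. x \<in>\<^sub>M cantor \<longrightarrow> y \<in>\<^sub>M clo x \<longrightarrow> large (clo x) (s 0))))"
    unfolding invariant_def by (intro fos)
  then show ?thesis unfolding cone_limit_def by (subst mem_sep) (auto simp: invariant_def)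
qed

lemma cone_limit_inter:
  assumes "A \<in>\<^sub>M cone_limit" "B \<in>\<^sub>M cone_limit"
  shows "inter A B \<in>\<^sub>M cone_limit"
proof -
  obtain y z where y: "y \<in>\<^sub>M cantor" "\<And>x. x \<in>\<^sub>M cantor \<Longrightarrow> y \<in>\<^sub>M clo x \<Longrightarrow> large (clo x) A"
    and z: "z \<in>\<^sub>M cantor" "\<And>x. x \<in>\<^sub>M cantor \<Longrightarrow> z \<in>\<^sub>M clo x \<Longrightarrow> large (clo x) B"
    using assms unfolding mem_cone_limit by blast
  have "large (clo x) (inter A B)" if x: "x \<in>\<^sub>M cantor" "join y z \<in>\<^sub>M clo x" for x
  proof -
    have yz: "y \<in>\<^sub>M clo x" "z \<in>\<^sub>M clo x"
      using closedD(4,5)[OF closed_clo x(2)] y(1) z(1) by simp_all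
    show ?thesis by (rule large_inter[OF y(2)[OF x(1) yz(1)] z(2)[OF x(1) yz(2)]])
  qed
  moreover have "invariant cantor E0 (inter A B)"
    using assms unfolding mem_cone_limit invariant_E0 mem_inter subset_def by blast
  moreover have "join y z \<in>\<^sub>M cantor" using y(1) z(1) by simp
  ultimately show ?thesis unfolding mem_cone_limit by blast
qed

lemma cone_limit_not_emp: "\<not> emp \<in>\<^sub>M cone_limit"
proof
  assume "emp \<in>\<^sub>M cone_limit"
  then obtain y where "y \<in>\<^sub>M cantor" "large (clo y) emp" unfolding mem_cone_limit using clo_self by blast
  then show False using large_not_emp ctb_clo zero_clo by blast
qed

text \<open>Martin's argument for the property that \<open>A\<close> is large for
  \<open>clo x\<close>, which a play shares with x by \<open>playI_clo\<close> and
  \<open>playII_clo\<close>. If the second player wins, \<open>A\<close> fails to be large on a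
  cone, and only the zero-one law turns this failure into largeness of the complement.\<close>

lemma cone_limit_ultra:
  assumes AD: AD and A: "invariant cantor E0 A"
  shows "A \<in>\<^sub>M cone_limit \<or> diff cantor A \<in>\<^sub>M cone_limit"
proof -
  have "fo (\<lambda>s. large (clo (s 0)) A)" by (intro fos)
  then show ?thesis
  proof (rule binary_AD[OF AD])
    fix s assume s: "s \<in>\<^sub>M cantor" "\<And>x. x \<in>\<^sub>M cantor \<Longrightarrow> large (clo (playI s x)) A"
    then have "large (clo x) A" if "x \<in>\<^sub>M cantor" "s \<in>\<^sub>M clo x" for x
      using playI_clo[OF that(2,1)] s(2)[OF that(1)] by simp
    then show ?thesis using A s(1) unfolding mem_cone_limit by blast
  next
    fix s assume s: "s \<in>\<^sub>M cantor" "\<And>x. x \<in>\<^sub>M cantor \<Longrightarrow> \<not> large (clo (playII s x)) A"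
    have "large (clo x) (diff cantor A)" if x: "x \<in>\<^sub>M cantor" "s \<in>\<^sub>M clo x" for x
    proof -
      have "\<not> large (clo x) A" using playII_clo[OF x(2,1)] s(2)[OF x(1)] by simp
      moreover obtain c where "ctb (clo x) c" using ctb_clo[OF x(1)] by blast
      then have "large (clo x) A \<or> large (clo x) (diff cantor A)"
        using zero_one[OF AD closed_clo zero_clo[OF x(1)]] A unfolding invariant_E0 by blast
      ultimately show ?thesis by blast
    qed
    moreover have "invariant cantor E0 (diff cantor A)"
      using A E0r_sym unfolding invariant_E0 mem_diff subset_def by blast
    ultimately show ?thesis using s(1) unfolding mem_cone_limit by blast
  qed
qed

text \<open>Turing cones belong to the limit by \<open>large_cone\<close>. Conversely, if a Turing
  invariant member contained no cone, the cone theorem would put a cone into its complement, and two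
  disjoint sets would belong to the filter.\<close>

lemma martin_measure_cone_limit:
  assumes AD: AD and A: "invariant cantor turing_equiv A"
  shows "A \<in>\<^sub>M martin_measure \<longleftrightarrow> A \<in>\<^sub>M cone_limit"
proof -
  have cone: "B \<in>\<^sub>M cone_limit" if B: "invariant cantor turing_equiv B" "y \<in>\<^sub>M cantor"
    "\<And>x. x \<in>\<^sub>M cantor \<Longrightarrow> y \<le>\<^sub>T x \<Longrightarrow> x \<in>\<^sub>M B" for B y
    using invariant_turing_E0[OF B(1)] B(2) large_cone[OF closed_clo zero_clo _ B(3)]
    unfolding mem_cone_limit by blast
  show ?thesis
  proof
    assume "A \<in>\<^sub>M martin_measure"
    then show "A \<in>\<^sub>M cone_limit" using cone[OF A] unfolding mem_martin_measure by blast
  next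
    assume U: "A \<in>\<^sub>M cone_limit"
    have inv: "invariant cantor turing_equiv (diff cantor A)"
      using A unfolding invariant_turing_equiv mem_diff subset_def by blast
    have "\<not> (\<exists>s. s \<in>\<^sub>M cantor \<and> (\<forall>x. x \<in>\<^sub>M cantor \<longrightarrow> s \<le>\<^sub>T x \<longrightarrow> \<not> x \<in>\<^sub>M A))"
    proof
      assume "\<exists>s. s \<in>\<^sub>M cantor \<and> (\<forall>x. x \<in>\<^sub>M cantor \<longrightarrow> s \<le>\<^sub>T x \<longrightarrow> \<not> x \<in>\<^sub>M A)"
      then have "diff cantor A \<in>\<^sub>M cone_limit" using cone[OF inv] by auto
      then have "inter A (diff cantor A) \<in>\<^sub>M cone_limit" by (rule cone_limit_inter[OF U])
      moreover have "inter A (diff cantor A) = emp" by (rule emp_eqI) simp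
      ultimately show False using cone_limit_not_emp by simp
    qed
    then show "A \<in>\<^sub>M martin_measure"
      using turing_cone[OF AD, of A] A unfolding mem_martin_measure invariant_turing_equiv by blast
  qed
qed

lemma ultrafilter_cone_limit: "AD \<Longrightarrow> ultrafilter_on_quot cantor E0 cone_limit"
  unfolding ultrafilter_on_quot_def
proof (intro conjI ballI allI impI)
  show "B \<in>\<^sub>M cone_limit" if "A \<in> elts cone_limit" "invariant cantor E0 B \<and> A \<subseteq>\<^sub>M B" for A B
    using that large_mono unfolding mem_Collect_eq mem_cone_limit by blast
qed (simp_all add: cone_limit_inter cone_limit_not_emp cone_limit_ultra, simp add: mem_cone_limit)

lemma reduction:
  assumes AD: AD
  shows "\<exists>\<phi>. rk_reduction cantor E0 cone_limit cantor turing_equiv martin_measure \<phi> \<and> borel_induced E0 turing_equiv \<phi>"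
proof -
  let ?q = "\<lambda>x. eq_class E0 x" and ?r = "\<lambda>x. eq_class turing_equiv x"
  \<comment> \<open>The map induced by the identity, as a set of pairs of classes. It is
    single-valued because E_0-equivalent reals are Turing equivalent.\<close>
  define \<phi> where "\<phi> = repl cantor (\<lambda>x. \<langle>?q x, ?r x\<rangle>)"
  have tm: "tm (\<lambda>s. \<langle>?q (s 0), ?r (s 0)\<rangle>)" by (intro fos)
  have \<phi>: "p \<in>\<^sub>M \<phi> \<longleftrightarrow> (\<exists>x. x \<in>\<^sub>M cantor \<and> p = \<langle>?q x, ?r x\<rangle>)" for p
    unfolding \<phi>_def by (rule mem_repl[OF tm])
  have self: "x \<in>\<^sub>M ?r x" if "x \<in>\<^sub>M cantor" for x
    using that turing_le_refl by (simp add: mem_eq_class mem_turing_equiv)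
  have rq: "?r x = ?r x'" if x: "x \<in>\<^sub>M cantor" "x' \<in>\<^sub>M cantor" "?q x = ?q x'" for x x'
  proof -
    have "x' \<in>\<^sub>M ?q x" unfolding x(3) mem_eq_class mem_E0 using x(2) emp_omega unfolding E0r_def by blast
    then have le: "x \<le>\<^sub>T x'" "x' \<le>\<^sub>T x"
      using E0_turing_equiv unfolding mem_eq_class mem_turing_equiv by blast+
    show ?thesis
      by (rule ext, unfold mem_eq_class mem_turing_equiv)
        (use x(1,2) le turing_le_trans in blast)
  qed
  have f: "\<phi> \<in>\<^sub>M funs (quot cantor E0) (quot cantor turing_equiv)"
    unfolding mem_funs
  proof (intro conjI allI impI)
    show "\<exists>x y. x \<in>\<^sub>M quot cantor E0 \<and> y \<in>\<^sub>M quot cantor turing_equiv \<and> p = \<langle>x, y\<rangle>" if "p \<in>\<^sub>M \<phi>" for p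
      using that unfolding \<phi> mem_quot by blast
    fix c assume "c \<in>\<^sub>M quot cantor E0"
    then obtain x where x: "x \<in>\<^sub>M cantor" "c = ?q x" unfolding mem_quot by blast
    show "\<exists>!y. \<langle>c, y\<rangle> \<in>\<^sub>M \<phi>"
    proof (rule ex1I)
      show "\<langle>c, ?r x\<rangle> \<in>\<^sub>M \<phi>" unfolding \<phi> using x by blast
      fix y assume "\<langle>c, y\<rangle> \<in>\<^sub>M \<phi>"
      then obtain x' where x': "x' \<in>\<^sub>M cantor" "c = ?q x'" "y = ?r x'" unfolding \<phi> by auto
      show "y = ?r x" using rq[OF x(1) x'(1)] x(2) x'(2,3) by simp
    qed
  qed
  have val: "\<phi> \<cdot> ?q x = ?r x" if x: "x \<in>\<^sub>M cantor" for x
  proof -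
    have "?q x \<in>\<^sub>M quot cantor E0" unfolding mem_quot using x by blast
    moreover have "\<langle>?q x, ?r x\<rangle> \<in>\<^sub>M \<phi>" unfolding \<phi> using x by blast
    ultimately show ?thesis using app_eq_ap[OF f] pair_in_fun[OF f] by simp
  qed
  \<comment> \<open>An invariant set includes the Turing class of x as soon as it contains x, so
    pulling back along the identity changes nothing.\<close>
  have pb: "pullback cantor E0 \<phi> A = A" if A: "invariant cantor turing_equiv A" for A
    unfolding pullback_def
  proof (rule the_set_eqI)
    fix x
    have "?r x \<subseteq>\<^sub>M A \<longleftrightarrow> x \<in>\<^sub>M A" if "x \<in>\<^sub>M cantor"
      using A self[OF that] unfolding invariant_def subset_def mem_eq_class by blast
    then show "x \<in>\<^sub>M A \<longleftrightarrow> x \<in>\<^sub>M cantor \<and> \<phi> \<cdot> ?q x \<subseteq>\<^sub>M A"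
      using A val[of x] unfolding invariant_def subset_def[of A] by auto
  qed
  have "rk_reduction cantor E0 cone_limit cantor turing_equiv martin_measure \<phi>"
    unfolding rk_reduction_def using f pb martin_measure_cone_limit[OF AD] by simp
  moreover have "borel_induced E0 turing_equiv \<phi>"
    unfolding borel_induced_def
  proof (intro exI[of _ "lam cantor (\<lambda>x. x)"] conjI allI impI ballI borel_map_id)
    have g: "lam cantor (\<lambda>x. x) \<cdot> x = x" if "x \<in>\<^sub>M cantor" for x
      using app_eq_ap[OF _ that, of "lam cantor (\<lambda>x. x)" cantor] ap_lam[OF tm_var that]
        lam_funs[OF tm_var, of cantor cantor] by simp
    show "\<langle>lam cantor (\<lambda>x. x) \<cdot> x, lam cantor (\<lambda>x. x) \<cdot> x'\<rangle> \<in>\<^sub>M turing_equiv" if "\<langle>x, x'\<rangle> \<in>\<^sub>M E0" for x x'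
      using E0_turing_equiv[OF that] that g unfolding mem_E0 by simp
    show "\<phi> \<cdot> ?q x = ?r (lam cantor (\<lambda>x. x) \<cdot> x)" if "x \<in> elts cantor" for x
      using that g val by simp
  qed
  ultimately show ?thesis by blast
qed

end

theorem theorem1p8:
  fixes mem :: "'a \<Rightarrow> 'a \<Rightarrow> bool"
  assumes "ZF_model mem"
    and "set_structure.AD mem"
  shows "\<exists>U. set_structure.ultrafilter_on_quot mem
                (set_structure.cantor mem) (set_structure.E0 mem) U \<and>
             (\<exists>\<phi>. set_structure.rk_reduction mem
                    (set_structure.cantor mem) (set_structure.E0 mem) U
                    (set_structure.cantor mem) (set_structure.turing_equiv mem)
                    (set_structure.martin_measure mem) \<phi> \<and>
                  set_structure.borel_induced mem
                    (set_structure.E0 mem) (set_structure.turing_equiv mem) \<phi>)"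
proof -
  interpret ZF_model mem by (rule assms(1))
  show ?thesis using ultrafilter_cone_limit[OF assms(2)] reduction[OF assms(2)] by blast
qed

end
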